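(* Suppose that $\mathbf{E}|X_1|^p<\infty$ for some $p>c^2+2$, where $c>0$, that $\frac{\log n}{\min(k_n,m_n)}\to0$ as $n\to\infty$, and that $\max(\alpha_n,\beta_n)=O\bigl((\log n)^{-\gamma}\bigr)$ as $n\to\infty$ for some $\gamma>2p/(p-2)$. Then, as $n\to\infty$, $$n^{1/2}(\mathbf{E}T_n-\mu_n)=o\bigl((\log n)^{-1}\bigr),$$ $$\frac{\sigma_{W,n}}{\sigma}=1+o\bigl((\log n)^{-2}\bigr),$$ $$\frac{\sqrt{\mathrm{Var}(T_n)}}{\sigma_{W,n}/\sqrt n}=1+o\bigl((\log n)^{-1}\bigr).$$ Moreover, in the moderate deviation relations $$\mathbf{P}\Bigl(\frac{\sqrt{n}(T_n-\mu_n)}{\sigma_{W,n}}>x\Bigr)=[1-\Phi(x)](1+o(1)),\qquad \mathbf{P}\Bigl(\frac{\sqrt{n}(T_n-\mu_n)}{\sigma_{W,n}}<-x\Bigr)=\Phi(-x)(1+o(1)),$$ as $n\to\infty$, uniformly in the range $-A\le x\le c\sqrt{\log n}$ (for each $A>0$), $\mu_n$ and $\sigma_{W,n}$ can be replaced respectively by $\mathbf{E}T_n$ and by $\sigma$ or $\sqrt{n\,\mathrm{Var}(T_n)}$, and the relations remain valid uniformly in the same range. Furthermore, if in addition $$\max(\alpha_n,\beta_n)=o\bigl[(n\log n)^{-\frac{p}{2(p-1)}}\bigr],$$ then $$n^{1/2}(\mathbf{E}X_1-\mu_n)=o\bigl((\log n)^{-1/2}\bigr)$$ as $n\to\infty$,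 and $\mu_n$ in the two moderate deviation relations above can be replaced by $\mathbf{E}X_1$, the relations remaining valid uniformly in the same range.
   Context: Let $X_1,X_2,\dots$ be i.i.d. real-valued random variables with common distribution function $F$, and for each $n\ge1$ let $X_{1:n}\le\dots\le X_{n:n}$ be the order statistics of $X_1,\dots,X_n$. Let $F^{-1}(u)=\inf\{x:F(x)\ge u\}$ for $0<u\le1$, $F^{-1}(0)=F^{-1}(0^+)$, be the left-continuous inverse, and write $\xi_\nu=F^{-1}(\nu)$ for $0<\nu<1$. $\Phi$ is the standard normal distribution function, and $\sigma=[\mathrm{Var}(X_1)]^{1/2}$. Let $k_n,m_n$ be integer sequences with $0\le k_n<n-m_n\le n$, and put $\alpha_n=k_n/n$, $\beta_n=m_n/n$. Standing assumption: $\min(k_n,m_n)\to\infty$ as $n\to\infty$. The trimmed mean is $T_n=\frac1n\sum_{i=k_n+1}^{n-m_n}X_{i:n}$ (note the normalization by $n$). Let $W_i^{(n)}$, $i=1,\dots,n$, be $X_i$ Winsorized outside $(\xi_{\alpha_n},\xi_{1-\beta_n}]$: $W_i^{(n)}=\xi_{\alpha_n}$ if $X_i\le\xi_{\alpha_n}$; $W_i^{(n)}=X_i$ if $\xi_{\alpha_n}<X_i\le\xi_{1-\beta_n}$; $W_i^{(n)}=\xi_{1-\beta_n}$ if $X_i>\xi_{1-\beta_n}$. Normalizing sequences: $\mu_n=\int_{\alpha_n}^{1-\beta_n}F^{-1}(s)\,ds$ and $\sigma_{W,n}=\bigl(\mathrm{Var}(W_1^{(n)})\bigr)^{1/2}$.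 Standing assumption: $\liminf_{n\to\infty}\sigma_{W,n}>0$. *)

theory Defs
  imports "HOL-Probability.Probability"
begin

text \<open>The quantile function is \<open>ereal\<close>-valued: the values at the arguments 0 and 1 may be
  infinite, and the infimum over the empty set is then \<open>\<infinity>\<close>.\<close>

definition quantile :: "(real \<Rightarrow> real) \<Rightarrow> real \<Rightarrow> ereal" where
  "quantile F u =
    (if u = 0 then Lim (at_right 0) (\<lambda>v. INF x\<in>{x. F x \<ge> v}. ereal x)
     else (INF x\<in>{x. F x \<ge> u}. ereal x))"

text \<open>Winsorization of \<open>x\<close> outside \<open>(\<xi>\<^sub>a, \<xi>\<^sub>1\<^sub>-\<^sub>b]\<close>. An infinite quantile never
  triggers its branch, so \<open>real_of_ereal\<close> is only applied to finite values (for \<open>F\<close> a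
  distribution function, \<open>a < 1\<close> and \<open>b < 1\<close>).\<close>

definition winsorize :: "(real \<Rightarrow> real) \<Rightarrow> real \<Rightarrow> real \<Rightarrow> real \<Rightarrow> real" where
  "winsorize F a b x =
    (if ereal x \<le> quantile F a then real_of_ereal (quantile F a)
     else if ereal x \<le> quantile F (1 - b) then x
     else real_of_ereal (quantile F (1 - b)))"

text \<open>Sequences are indexed from 1, as are the ranks \<open>i\<close>: the \<open>i\<close>-th smallest of
  \<open>x 1, \<dots>, x n\<close>.\<close>

definition order_stat :: "(nat \<Rightarrow> real) \<Rightarrow> nat \<Rightarrow> nat \<Rightarrow> real" where
  "order_stat x n i = sort (map x [1..<Suc n]) ! (i - 1)"

definition trimmed_mean ::
  "(nat \<Rightarrow> 'a \<Rightarrow> real) \<Rightarrow> (nat \<Rightarrow> nat) \<Rightarrow> (nat \<Rightarrow> nat) \<Rightarrow> nat \<Rightarrow> 'a \<Rightarrow> real" where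
  "trimmed_mean X k m n \<omega> =
    (\<Sum>i = k n + 1..n - m n. order_stat (\<lambda>j. X j \<omega>) n i) / real n"

definition trim_frac :: "(nat \<Rightarrow> nat) \<Rightarrow> nat \<Rightarrow> real" where
  "trim_frac k n = real (k n) / real n"

definition trimmed_center ::
  "(real \<Rightarrow> real) \<Rightarrow> (nat \<Rightarrow> nat) \<Rightarrow> (nat \<Rightarrow> nat) \<Rightarrow> nat \<Rightarrow> real" where
  "trimmed_center F k m n =
    (LBINT s:{trim_frac k n..1 - trim_frac m n}. real_of_ereal (quantile F s))"

definition winsorized_sd ::
  "'a measure \<Rightarrow> (nat \<Rightarrow> 'a \<Rightarrow> real) \<Rightarrow> (nat \<Rightarrow> nat) \<Rightarrow> (nat \<Rightarrow> nat) \<Rightarrow> nat \<Rightarrow> real" where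
  "winsorized_sd M X k m n = sqrt (prob_space.variance M
    (\<lambda>\<omega>. winsorize (cdf (distr M borel (X 1))) (trim_frac k n) (trim_frac m n) (X 1 \<omega>)))"

abbreviation std_normal_cdf :: "real \<Rightarrow> real" where
  "std_normal_cdf \<equiv> cdf std_normal_distribution"

text \<open>Both moderate deviation relations for \<open>\<surd>n (T\<^sub>n - a\<^sub>n) / s\<^sub>n\<close>, uniformly in
  \<open>-A \<le> x \<le> c \<surd>(log n)\<close> for each \<open>A > 0\<close>: the relative errors tend to 0 uniformly
  over this range.\<close>

definition moderate_deviations ::
  "'a measure \<Rightarrow> (nat \<Rightarrow> 'a \<Rightarrow> real) \<Rightarrow> real \<Rightarrow> (nat \<Rightarrow> real) \<Rightarrow> (nat \<Rightarrow> real) \<Rightarrow> bool" where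
  "moderate_deviations M T c a s \<longleftrightarrow>
    (\<forall>A>0. \<forall>\<epsilon>>0. \<forall>\<^sub>F n in sequentially. \<forall>x. - A \<le> x \<and> x \<le> c * sqrt (ln (real n)) \<longrightarrow>
      \<bar>\<P>(\<omega> in M. sqrt (real n) * (T n \<omega> - a n) / s n > x) / (1 - std_normal_cdf x) - 1\<bar> < \<epsilon> \<and>
      \<bar>\<P>(\<omega> in M. sqrt (real n) * (T n \<omega> - a n) / s n < - x) / std_normal_cdf (- x) - 1\<bar> < \<epsilon>)"

end

theory Submission
  imports Defs "HOL-Real_Asymp.Real_Asymp"
begin

text \<open>Let \<open>a\<close>, \<open>b\<close> be the quantiles of order \<open>\<alpha>\<^sub>n\<close>, \<open>1 - \<beta>\<^sub>n\<close>. The sum \<open>n T\<^sub>n\<close> is the sum of the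
  winsorized observations, minus \<open>k\<^sub>n a + m\<^sub>n b\<close>, plus a remainder that is at most the deviation
  of the number of observations beyond \<open>a\<close> (or \<open>b\<close>) from its target, times the size of the order
  statistics next to the cut. The count deviates by about \<open>\<surd>k\<^sub>n\<close>, and both \<open>a\<close> and those order statistics
  are of order \<open>\<alpha>\<^sub>n\<close> to the power \<open>-1/p\<close>; the growth condition on \<open>\<gamma>\<close> makes the standardized remainder
  \<open>o(1 / log n)\<close> in mean square and \<open>o((log n) powr (-1/2))\<close> outside an event of polynomially small probability.

  The winsorized summands are bounded by a multiple of \<open>n powr (1/p)\<close> with \<open>p > 2\<close>, so no change of measure is
  needed for their moderate deviations: Lindeberg's replacement argument is run for a smoothed
  indicator of \<open>(x, \<infinity>)\<close> whose third-order Taylor error carries the weight \<open>exp (x (t - x))\<close>. This weight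
  is multiplicative under convolution and contributes the factor \<open>exp (-x\<^sup>2/2)\<close>, so that a polynomially small
  Lindeberg error is small relative to the normal tail.\<close>

section \<open>Lindeberg replacement with an exponential weight\<close>

text \<open>All errors are measured by one quantity, \<open>\<theta> n\<close>: the larger trimming
  fraction to the power 1/2 - 1/p. The standardized remainder has mean square of order
  \<open>\<theta> n\<close> squared and, off the exceptional event, is at most a multiple of
  \<open>\<theta> n\<close> times sqrt(log n). Shifting the argument x of the normal tail by e
  changes the tail by a relative amount of about (1 + x) e, so up to x = c sqrt(log n) a shift is
  harmless once it is o(1/sqrt(log n)). Both facts lead to the same condition, that
  \<open>\<theta> n\<close> log n tends to 0, and the bound on \<open>\<gamma>\<close> says exactly
  that \<open>\<gamma>\<close> (1/2 - 1/p) > 1.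

  The exponent h of the weight is max(x, 0): the Gaussian moment generating function contributes
  exp(h^2/2 - h x), which is smallest at h = x. What is left of the Lindeberg error is the inverse
  cube of the smoothing width times a negative power of n. A width of 1/log n is therefore narrow
  enough not to disturb the tail and costs only a power of log n.\<close>

text \<open>\<open>f1\<close> and \<open>f2\<close> are not required to be derivatives, so the class is stable under averaging over
  translates without differentiating under the integral sign.\<close>

definition taylor3 :: "real \<Rightarrow> real \<Rightarrow> (real \<Rightarrow> real) \<Rightarrow> (real \<Rightarrow> real) \<Rightarrow> (real \<Rightarrow> real) \<Rightarrow> bool" where
  "taylor3 K h f f1 f2 \<longleftrightarrow>
    (\<forall>g\<in>{f, f1, f2}. g \<in> borel_measurable borel \<and> (\<exists>B. \<forall>x. \<bar>g x\<bar> \<le> B)) \<and>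
    (\<forall>s u. \<bar>f (s + u) - f s - f1 s * u - f2 s * u\<^sup>2 / 2\<bar> \<le> K * exp (h * s) * (\<bar>u\<bar> ^ 3 * exp (h * \<bar>u\<bar>)))"

definition shift_mean :: "real measure \<Rightarrow> (real \<Rightarrow> real) \<Rightarrow> real \<Rightarrow> real" where
  "shift_mean N f s = (\<integral>z. f (s + z) \<partial>N)"

lemma integrable_shift:
  fixes f :: "real \<Rightarrow> real"
  assumes "prob_space N" "sets N = sets borel" "f \<in> borel_measurable borel" "\<And>x. \<bar>f x\<bar> \<le> B"
  shows "integrable N (\<lambda>z. f (s + z))"
proof -
  interpret prob_space N by fact
  have [measurable_cong]: "sets N = sets borel" by fact
  have [measurable]: "f \<in> borel_measurable borel" by fact
  show ?thesis
    by (rule integrable_const_bound[where B = B]) (auto simp: assms(4))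
qed

lemma shift_mean_bounded:
  assumes "prob_space N" "sets N = sets borel" "f \<in> borel_measurable borel" "\<And>x. \<bar>f x\<bar> \<le> B"
  shows "\<bar>shift_mean N f s\<bar> \<le> B"
proof -
  interpret prob_space N by fact
  have "\<bar>\<integral>z. f (s + z) \<partial>N\<bar> \<le> (\<integral>z. \<bar>f (s + z)\<bar> \<partial>N)"
    by (rule integral_abs_bound)
  also have "\<dots> \<le> B"
    by (rule integral_le_const) (auto intro!: integrable_abs integrable_shift[OF assms] simp: assms(4))
  finally show ?thesis
    unfolding shift_mean_def .
qed

lemma shift_mean_measurable:
  assumes "prob_space N" "sets N = sets borel" "f \<in> borel_measurable borel"
  shows "shift_mean N f \<in> borel_measurable borel"
proof -
  interpret prob_space N by fact
  have [measurable_cong]: "sets N = sets borel" by fact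
  have [measurable]: "f \<in> borel_measurable borel" by fact
  have "(\<lambda>s. \<integral>z. f (s + z) \<partial>N) \<in> borel_measurable borel"
    by measurable
  then show ?thesis
    by (simp add: shift_mean_def[abs_def])
qed

text \<open>The weight splits as exp(h (s + z)) = exp(h s) exp(h z), so averaging over translates
  costs one factor of the moment generating function in \<open>K\<close> and leaves the shape of the
  bound unchanged.\<close>

lemma taylor3_shift_mean:
  assumes t: "taylor3 K h f f1 f2" and N: "prob_space N" "sets N = sets borel"
    and e: "integrable N (\<lambda>z. exp (h * z))"
  shows "taylor3 (K * (\<integral>z. exp (h * z) \<partial>N)) h (shift_mean N f) (shift_mean N f1) (shift_mean N f2)"
proof -
  interpret prob_space N by fact
  have m: "g \<in> borel_measurable borel" "\<exists>B. \<forall>x. \<bar>g x\<bar> \<le> B" if "g \<in> {f, f1, f2}" for g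
    using t that unfolding taylor3_def by auto
  have i: "integrable N (\<lambda>z. g (s + z))" if "g \<in> {f, f1, f2}" for g s
  proof -
    from m(2)[OF that] obtain B where "\<And>x. \<bar>g x\<bar> \<le> B" by blast
    from integrable_shift[OF N m(1)[OF that] this] show ?thesis .
  qed
  have "shift_mean N g \<in> borel_measurable borel \<and> (\<exists>B. \<forall>x. \<bar>shift_mean N g x\<bar> \<le> B)"
    if "g \<in> {f, f1, f2}" for g
  proof -
    from m(2)[OF that] obtain B where "\<And>x. \<bar>g x\<bar> \<le> B" by blast
    from shift_mean_bounded[OF N m(1)[OF that] this] shift_mean_measurable[OF N m(1)[OF that]]
    show ?thesis by blast
  qed
  moreover have "\<bar>shift_mean N f (s + u) - shift_mean N f s - shift_mean N f1 s * u - shift_mean N f2 s * u\<^sup>2 / 2\<bar>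
     \<le> K * (\<integral>z. exp (h * z) \<partial>N) * exp (h * s) * (\<bar>u\<bar> ^ 3 * exp (h * \<bar>u\<bar>))" for s u
  proof -
    define g where "g z = f (s + z + u) - f (s + z) - f1 (s + z) * u - f2 (s + z) * u\<^sup>2 / 2" for z
    have i2: "integrable N (\<lambda>z. f (s + z + u))"
      using i[of f "s + u"] by (simp add: ac_simps)
    have gi: "integrable N g"
      unfolding g_def by (intro Bochner_Integration.integrable_diff i2 i integrable_mult_left integrable_divide) auto
    have "integral\<^sup>L N g = shift_mean N f (s + u) - shift_mean N f s - shift_mean N f1 s * u - shift_mean N f2 s * u\<^sup>2 / 2"
      unfolding g_def shift_mean_def using i2 i[of f s] i[of f1 s] i[of f2 s] by (simp add: ac_simps)
    moreover have "\<bar>integral\<^sup>L N g\<bar> \<le> (\<integral>z. \<bar>g z\<bar> \<partial>N)"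
      by (rule integral_abs_bound)
    moreover have "\<dots> \<le> (\<integral>z. exp (h * z) * (K * exp (h * s) * (\<bar>u\<bar> ^ 3 * exp (h * \<bar>u\<bar>))) \<partial>N)"
    proof (rule integral_mono)
      fix z
      have "\<bar>g z\<bar> \<le> K * exp (h * (s + z)) * (\<bar>u\<bar> ^ 3 * exp (h * \<bar>u\<bar>))"
        using t unfolding taylor3_def g_def by blast
      then show "\<bar>g z\<bar> \<le> exp (h * z) * (K * exp (h * s) * (\<bar>u\<bar> ^ 3 * exp (h * \<bar>u\<bar>)))"
        by (simp add: distrib_left exp_add ac_simps)
    qed (auto intro!: gi e integrable_abs)
    ultimately show ?thesis
      by (simp add: ac_simps)
  qed
  ultimately show ?thesis
    unfolding taylor3_def by simp
qed

text \<open>Both averages are compared with the average of the same quadratic polynomial,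
  \<open>T\<close>, which sees a measure only through its first two moments. Only the weighted third
  moments survive.\<close>

lemma taylor3_swap:
  assumes t: "taylor3 K h f f1 f2"
    and N: "prob_space N" "sets N = sets borel" and L: "prob_space L" "sets L = sets borel"
    and m1: "integrable N (\<lambda>z. z)" "integrable L (\<lambda>z. z)" "(\<integral>z. z \<partial>N) = (\<integral>z. z \<partial>L)"
    and m2: "integrable N (\<lambda>z. z\<^sup>2)" "integrable L (\<lambda>z. z\<^sup>2)" "(\<integral>z. z\<^sup>2 \<partial>N) = (\<integral>z. z\<^sup>2 \<partial>L)"
    and e: "integrable N (\<lambda>z. \<bar>z\<bar> ^ 3 * exp (h * \<bar>z\<bar>))" "integrable L (\<lambda>z. \<bar>z\<bar> ^ 3 * exp (h * \<bar>z\<bar>))"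
  shows "\<bar>shift_mean N f s - shift_mean L f s\<bar> \<le> K * exp (h * s) *
    ((\<integral>z. \<bar>z\<bar> ^ 3 * exp (h * \<bar>z\<bar>) \<partial>N) + (\<integral>z. \<bar>z\<bar> ^ 3 * exp (h * \<bar>z\<bar>) \<partial>L))"
proof -
  define g where "g z = f (s + z) - f s - f1 s * z - f2 s * z\<^sup>2 / 2" for z
  define T where "T P = f s + f1 s * (\<integral>z. z \<partial>P) + f2 s * (\<integral>z. z\<^sup>2 \<partial>P) / 2" for P
  have *: "\<bar>shift_mean P f s - T P\<bar> \<le> K * exp (h * s) * (\<integral>z. \<bar>z\<bar> ^ 3 * exp (h * \<bar>z\<bar>) \<partial>P)"
    if P: "prob_space P" "sets P = sets borel" and i: "integrable P (\<lambda>z. z)" "integrable P (\<lambda>z. z\<^sup>2)"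
      "integrable P (\<lambda>z. \<bar>z\<bar> ^ 3 * exp (h * \<bar>z\<bar>))" for P
  proof -
    interpret prob_space P by fact
    obtain B where "f \<in> borel_measurable borel" "\<And>x. \<bar>f x\<bar> \<le> B"
      using t unfolding taylor3_def by blast
    from integrable_shift[OF P this] have if': "integrable P (\<lambda>z. f (s + z))" .
    have gi: "integrable P g"
      unfolding g_def using if' i by (intro Bochner_Integration.integrable_diff integrable_mult_right integrable_divide) auto
    have "integral\<^sup>L P g = shift_mean P f s - T P"
      unfolding g_def shift_mean_def T_def using if' i by (simp add: prob_space)
    moreover have "\<bar>integral\<^sup>L P g\<bar> \<le> (\<integral>z. \<bar>g z\<bar> \<partial>P)"
      by (rule integral_abs_bound)
    moreover have "\<dots> \<le> (\<integral>z. K * exp (h * s) * (\<bar>z\<bar> ^ 3 * exp (h * \<bar>z\<bar>)) \<partial>P)"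
    proof (rule integral_mono)
      fix z show "\<bar>g z\<bar> \<le> K * exp (h * s) * (\<bar>z\<bar> ^ 3 * exp (h * \<bar>z\<bar>))"
        using t unfolding taylor3_def g_def by blast
    qed (use gi i in auto)
    ultimately show ?thesis by simp
  qed
  have "T N = T L" unfolding T_def using m1 m2 by simp
  with *[OF N m1(1) m2(1) e(1)] *[OF L m1(2) m2(2) e(2)] show ?thesis
    by (simp add: distrib_left)
qed

lemma taylor3_funpow:
  assumes "taylor3 K h f f1 f2" "prob_space N" "sets N = sets borel"
    "integrable N (\<lambda>z. exp (h * z))"
  shows "\<exists>f1 f2. taylor3 (K * (\<integral>z. exp (h * z) \<partial>N) ^ n) h ((shift_mean N ^^ n) f) f1 f2"
proof (induction n)
  case 0
  then show ?case using assms(1) by auto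
next
  case (Suc n)
  then obtain f1 f2 where "taylor3 (K * (\<integral>z. exp (h * z) \<partial>N) ^ n) h ((shift_mean N ^^ n) f) f1 f2"
    by blast
  from taylor3_shift_mean[OF this assms(2-4)] show ?case
    by (auto simp: mult.assoc mult.commute[of "_ ^ n"])
qed

text \<open>Telescoping over the summands. In the induction step the old error is averaged over one
  more translate, which costs a factor \<open>m\<close>, and one copy of \<open>N\<close> is then
  exchanged for \<open>L\<close> in front of the already replaced function. The starting point is
  generalised because the induction hypothesis is integrated over \<open>s + z\<close>.\<close>

lemma lindeberg_iterate:
  assumes t: "taylor3 K h f f1 f2"
    and N: "prob_space N" "sets N = sets borel" and L: "prob_space L" "sets L = sets borel"
    and m1: "integrable N (\<lambda>z. z)" "integrable L (\<lambda>z. z)" "(\<integral>z. z \<partial>N) = (\<integral>z. z \<partial>L)"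
    and m2: "integrable N (\<lambda>z. z\<^sup>2)" "integrable L (\<lambda>z. z\<^sup>2)" "(\<integral>z. z\<^sup>2 \<partial>N) = (\<integral>z. z\<^sup>2 \<partial>L)"
    and m3: "integrable N (\<lambda>z. \<bar>z\<bar> ^ 3 * exp (h * \<bar>z\<bar>))" "integrable L (\<lambda>z. \<bar>z\<bar> ^ 3 * exp (h * \<bar>z\<bar>))"
    and e: "integrable N (\<lambda>z. exp (h * z))" "(\<integral>z. exp (h * z) \<partial>N) \<le> m"
      "integrable L (\<lambda>z. exp (h * z))" "(\<integral>z. exp (h * z) \<partial>L) \<le> m" "1 \<le> m" and K: "0 \<le> K"
    and \<tau>: "(\<integral>z. \<bar>z\<bar> ^ 3 * exp (h * \<bar>z\<bar>) \<partial>N) + (\<integral>z. \<bar>z\<bar> ^ 3 * exp (h * \<bar>z\<bar>) \<partial>L) \<le> \<tau>"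
  shows "\<bar>(shift_mean N ^^ n) f s - (shift_mean L ^^ n) f s\<bar> \<le> real n * K * m ^ n * \<tau> * exp (h * s)"
proof (induction n arbitrary: s)
  case 0
  then show ?case by simp
next
  case (Suc n)
  interpret N: prob_space N by fact
  define F where "F = (shift_mean N ^^ n) f"
  define G where "G = (shift_mean L ^^ n) f"
  define E where "E = real n * K * m ^ n * \<tau>"
  have \<tau>0: "0 \<le> \<tau>"
    by (rule order_trans[OF _ \<tau>]) (intro add_nonneg_nonneg integral_nonneg_AE AE_I2; simp)
  have E0: "0 \<le> E" unfolding E_def using K e \<tau>0 by simp
  \<comment> \<open>For \<open>F\<close> only measurability and boundedness are extracted from the
    expansion; the function that is really expanded is \<open>G\<close>.\<close>
  obtain F1 F2 where tF: "taylor3 (K * (\<integral>z. exp (h * z) \<partial>N) ^ n) h F F1 F2"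
    using taylor3_funpow[OF t N e(1)] unfolding F_def by blast
  obtain G1 G2 where tG: "taylor3 (K * (\<integral>z. exp (h * z) \<partial>L) ^ n) h G G1 G2"
    using taylor3_funpow[OF t L e(3)] unfolding G_def by blast
  obtain BF where "F \<in> borel_measurable borel" "\<And>x. \<bar>F x\<bar> \<le> BF"
    using tF unfolding taylor3_def by blast
  from integrable_shift[OF N this] have iF: "integrable N (\<lambda>z. F (s + z))" .
  obtain BG where "G \<in> borel_measurable borel" "\<And>x. \<bar>G x\<bar> \<le> BG"
    using tG unfolding taylor3_def by blast
  from integrable_shift[OF N this] have iG: "integrable N (\<lambda>z. G (s + z))" .
  have "\<bar>shift_mean N F s - shift_mean N G s\<bar> = \<bar>\<integral>z. F (s + z) - G (s + z) \<partial>N\<bar>"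
    unfolding shift_mean_def using iF iG by simp
  also have "\<dots> \<le> (\<integral>z. \<bar>F (s + z) - G (s + z)\<bar> \<partial>N)"
    by (rule integral_abs_bound)
  also have "\<dots> \<le> (\<integral>z. E * exp (h * s) * exp (h * z) \<partial>N)"
  proof (rule integral_mono)
    fix z
    show "\<bar>F (s + z) - G (s + z)\<bar> \<le> E * exp (h * s) * exp (h * z)"
      using Suc.IH[of "s + z"] unfolding F_def G_def E_def by (simp add: distrib_left exp_add mult.assoc)
  qed (use iF iG e in auto)
  also have "\<dots> \<le> E * exp (h * s) * m"
    using e(2) E0 by (simp add: mult_left_mono)
  finally have 1: "\<bar>shift_mean N F s - shift_mean N G s\<bar> \<le> E * exp (h * s) * m" .
  have l0: "0 \<le> (\<integral>z. exp (h * z) \<partial>L)"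
    by (intro integral_nonneg_AE AE_I2; simp)
  have "\<bar>shift_mean N G s - shift_mean L G s\<bar> \<le> K * (\<integral>z. exp (h * z) \<partial>L) ^ n * exp (h * s) *
    ((\<integral>z. \<bar>z\<bar> ^ 3 * exp (h * \<bar>z\<bar>) \<partial>N) + (\<integral>z. \<bar>z\<bar> ^ 3 * exp (h * \<bar>z\<bar>) \<partial>L))"
    by (rule taylor3_swap[OF tG N L m1 m2 m3])
  also have "\<dots> \<le> K * m ^ n * exp (h * s) * \<tau>"
    using K e \<tau> l0 by (intro mult_mono power_mono mult_nonneg_nonneg add_nonneg_nonneg integral_nonneg_AE AE_I2) auto
  \<comment> \<open>Padding with one more factor \<open>m\<close>, which is at least 1, gives the
    new error the same form as the averaged old one.\<close>
  also have "\<dots> \<le> K * (m ^ n * m) * exp (h * s) * \<tau>"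
    using K e \<tau>0 by (intro mult_mono) (auto simp: mult_le_cancel_left1)
  finally have 2: "\<bar>shift_mean N G s - shift_mean L G s\<bar> \<le> K * (m ^ n * m) * exp (h * s) * \<tau>" .
  have "\<bar>shift_mean N F s - shift_mean L G s\<bar> \<le> E * exp (h * s) * m + K * (m ^ n * m) * exp (h * s) * \<tau>"
    using 1 2 by linarith
  also have "\<dots> = real (Suc n) * K * m ^ Suc n * \<tau> * exp (h * s)"
    unfolding E_def by (simp add: algebra_simps)
  finally show ?case
    unfolding F_def G_def by simp
qed

text \<open>By independence and Fubini, integrating out one summand \<open>y\<close> moves the
  starting point from \<open>s\<close> to \<open>s + y\<close>; this is one application of
  \<open>shift_mean\<close>.\<close>

lemma (in prob_space) expectation_sum_eq_funpow:
  fixes Y :: "'i \<Rightarrow> 'a \<Rightarrow> real"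
  assumes "finite I" "indep_vars (\<lambda>_. borel) Y I" "\<And>i. i \<in> I \<Longrightarrow> distr M borel (Y i) = N"
    and f: "f \<in> borel_measurable borel" "\<And>x. \<bar>f x\<bar> \<le> B"
  shows "expectation (\<lambda>\<omega>. f (s + (\<Sum>i\<in>I. Y i \<omega>))) = (shift_mean N ^^ card I) f s"
  using assms(1-3)
proof (induction I arbitrary: s rule: finite_induct)
  case empty
  then show ?case by (simp add: prob_space)
next
  case (insert i I)
  note f(1)[measurable]
  have Yi[measurable]: "Y i \<in> borel_measurable M"
    using insert.prems unfolding indep_vars_def by auto
  have Yj: "Y j \<in> borel_measurable M" if "j \<in> I" for j
    using insert.prems that unfolding indep_vars_def by auto
  define S where "S \<omega> = (\<Sum>j\<in>I. Y j \<omega>)" for \<omega>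
  have S[measurable]: "S \<in> borel_measurable M" unfolding S_def[abs_def] using Yj by measurable
  have ind: "indep_var borel (Y i) borel S"
    unfolding S_def[abs_def] by (rule indep_vars_sum) (use insert in auto)
  have ID: "distr M borel (Y i) = N" using insert.prems by auto
  interpret D1: prob_space "distr M borel (Y i)" by (rule prob_space_distr) measurable
  interpret D2: prob_space "distr M borel S" by (rule prob_space_distr) measurable
  interpret P: pair_prob_space "distr M borel (Y i)" "distr M borel S" ..
  have "expectation (\<lambda>\<omega>. f (s + (\<Sum>i\<in>insert i I. Y i \<omega>))) = expectation (\<lambda>\<omega>. f (s + (Y i \<omega> + S \<omega>)))"
    using insert.hyps by (simp add: S_def)
  also have "\<dots> = (\<integral>w. f (s + (fst w + snd w)) \<partial>distr M (borel \<Otimes>\<^sub>M borel) (\<lambda>\<omega>. (Y i \<omega>, S \<omega>)))"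
    by (subst integral_distr) auto
  also have "\<dots> = (\<integral>w. f (s + (fst w + snd w)) \<partial>(distr M borel (Y i) \<Otimes>\<^sub>M distr M borel S))"
    using ind by (simp add: indep_var_distribution_eq)
  also have "\<dots> = (\<integral>y. (\<integral>z. f (s + (fst (y, z) + snd (y, z))) \<partial>distr M borel S) \<partial>distr M borel (Y i))"
    by (rule P.integral_fst'[of "\<lambda>w. f (s + (fst w + snd w))", symmetric], rule P.integrable_const_bound[where B = B])
      (simp_all add: f(2))
  also have "\<dots> = (\<integral>y. expectation (\<lambda>\<omega>. f ((s + y) + (\<Sum>j\<in>I. Y j \<omega>))) \<partial>distr M borel (Y i))"
    by (intro Bochner_Integration.integral_cong refl, subst integral_distr) (auto simp: S_def ac_simps)
  also have "\<dots> = (\<integral>y. (shift_mean N ^^ card I) f (s + y) \<partial>distr M borel (Y i))"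
    using insert.prems by (intro Bochner_Integration.integral_cong refl insert.IH indep_vars_subset[OF insert.prems(1)]) auto
  also have "\<dots> = (shift_mean N ^^ card (insert i I)) f s"
    using insert.hyps by (simp add: shift_mean_def[of N "(shift_mean N ^^ card I) f"] ID)
  finally show ?case .
qed

section \<open>Centred normal laws, indexed by the variance so that convolution adds the
  indices\<close>

definition gauss :: "real \<Rightarrow> real measure" where
  "gauss v = density lborel (\<lambda>x. ennreal (normal_density 0 (sqrt v) x))"

lemma prob_space_gauss: "0 < v \<Longrightarrow> prob_space (gauss v)"
  unfolding gauss_def by (rule prob_space_normal_density) simp

lemma sets_gauss[simp, measurable_cong]: "sets (gauss v) = sets borel"
  unfolding gauss_def by simp

lemma space_gauss[simp]: "space (gauss v) = UNIV"
  unfolding gauss_def by simp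

lemma convolution_gauss:
  assumes "0 < v" "0 < w"
  shows "gauss v \<star> gauss w = gauss (v + w)"
proof -
  have "gauss v \<star> gauss w = density lborel (\<lambda>x. \<integral>\<^sup>+y. ennreal (normal_density 0 (sqrt v) (x - y)) *
      ennreal (normal_density 0 (sqrt w) y) \<partial>lborel)"
    unfolding gauss_def using assms
    by (intro convolution_density)
      (auto intro!: prob_space.finite_measure prob_space_normal_density)
  also have "(\<lambda>x. \<integral>\<^sup>+y. ennreal (normal_density 0 (sqrt v) (x - y)) *
      ennreal (normal_density 0 (sqrt w) y) \<partial>lborel) = (\<lambda>x. ennreal (normal_density 0 (sqrt (v + w)) x))"
    using conv_normal_density_zero_mean[of "sqrt v" "sqrt w"] assms
    by (simp add: ennreal_mult'[symmetric])
  finally show ?thesis by (simp add: gauss_def)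
qed

lemma integral_gauss:
  fixes f :: "real \<Rightarrow> real"
  assumes "f \<in> borel_measurable borel"
  shows "(\<integral>x. f x \<partial>gauss v) = (\<integral>x. normal_density 0 (sqrt v) x * f x \<partial>lborel)"
    "integrable (gauss v) f \<longleftrightarrow> integrable lborel (\<lambda>x. normal_density 0 (sqrt v) x * f x)"
  unfolding gauss_def using assms by (auto simp: integral_density integrable_density)

text \<open>The iteration count is \<open>Suc n\<close> because \<open>gauss 0\<close> is the zero
  measure and not the point mass at 0.\<close>

lemma shift_mean_gauss_funpow:
  assumes v: "0 < v" and f: "f \<in> borel_measurable borel" "\<And>x. \<bar>f x\<bar> \<le> B"
  shows "(shift_mean (gauss v) ^^ Suc n) f s = (\<integral>z. f (s + z) \<partial>gauss (real (Suc n) * v))"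
proof (induction n arbitrary: s)
  case 0
  then show ?case by (simp add: shift_mean_def)
next
  case (Suc n)
  note f(1)[measurable]
  define w where "w = real (Suc n) * v"
  have w: "0 < w" using v by (simp add: w_def)
  interpret V: prob_space "gauss v" by (rule prob_space_gauss[OF v])
  interpret W: prob_space "gauss w" by (rule prob_space_gauss[OF w])
  interpret P: pair_prob_space "gauss v" "gauss w" ..
  have "(shift_mean (gauss v) ^^ Suc (Suc n)) f s = (\<integral>y. (\<integral>z. f (s + (fst (y, z) + snd (y, z))) \<partial>gauss w) \<partial>gauss v)"
    using Suc.IH by (simp add: shift_mean_def[of _ "shift_mean _ _"] w_def add.assoc)
  also have "\<dots> = (\<integral>w. f (s + (fst w + snd w)) \<partial>(gauss v \<Otimes>\<^sub>M gauss w))"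
    by (rule P.integral_fst'[of "\<lambda>w. f (s + (fst w + snd w))"], rule P.integrable_const_bound[where B = B])
      (simp_all add: f(2))
  also have "\<dots> = (\<integral>t. f (s + t) \<partial>(gauss v \<star> gauss w))"
    unfolding convolution_def by (subst integral_distr) (auto simp: case_prod_beta)
  also have "\<dots> = (\<integral>t. f (s + t) \<partial>gauss (real (Suc (Suc n)) * v))"
    by (simp add: convolution_gauss[OF v w]) (simp add: w_def algebra_simps)
  finally show ?case .
qed

text \<open>Completing the square: tilting by exp(h x) moves the mean of the density to
  \<open>v * h\<close> and leaves a constant factor.\<close>

lemma gauss_exp:
  assumes "0 < v"
  shows "integrable (gauss v) (\<lambda>z. exp (h * z))" "(\<integral>z. exp (h * z) \<partial>gauss v) = exp (h\<^sup>2 * v / 2)"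
proof -
  have *: "normal_density 0 (sqrt v) x * exp (h * x) = exp (h\<^sup>2 * v / 2) * normal_density (v * h) (sqrt v) x" for x
  proof -
    have "- x\<^sup>2 / (2 * v) + h * x = h\<^sup>2 * v / 2 + - (x - v * h)\<^sup>2 / (2 * v)"
      using assms by (simp add: field_simps power2_eq_square)
    then show ?thesis using assms
      by (simp add: normal_density_def exp_add[symmetric])
  qed
  show "integrable (gauss v) (\<lambda>z. exp (h * z))" "(\<integral>z. exp (h * z) \<partial>gauss v) = exp (h\<^sup>2 * v / 2)"
    using assms by (simp_all add: integral_gauss *)
qed

lemma gauss_moments:
  assumes "0 < v"
  shows "integrable (gauss v) (\<lambda>z. z)" "(\<integral>z. z \<partial>gauss v) = 0"
    "integrable (gauss v) (\<lambda>z. z\<^sup>2)" "(\<integral>z. z\<^sup>2 \<partial>gauss v) = v"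
  using assms integrable_normal_moment[of "sqrt v" 0 1] integrable_normal_moment[of "sqrt v" 0 2]
    integral_normal_moment_odd[of "sqrt v" 0 0] integral_normal_moment_even[of "sqrt v" 0 1]
  by (simp_all add: integral_gauss numeral_2_eq_2)

lemma cube_le_exp: "0 \<le> x \<Longrightarrow> x ^ 3 \<le> 6 * exp (x::real)"
proof -
  assume "0 \<le> x"
  then have "(\<Sum>k<4. x ^ k /\<^sub>R fact k) \<le> exp x"
    unfolding exp_def by (intro sum_le_suminf summable_exp_generic) auto
  then have "1 + x + x * x / 2 + x ^ 3 / 6 \<le> exp x"
    by (simp add: numeral_eq_Suc field_simps)
  moreover have "0 \<le> x * x / 2" by simp
  ultimately show ?thesis
    using \<open>0 \<le> x\<close> by linarith
qed

text \<open>The cube is absorbed into the exponential at scale sqrt v, which raises the rate from h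
  to r = h + 1/sqrt v. Under the assumption on h, r sqrt v is at most 2, so each of the two signs
  contributes at most 6 exp 2 times the cube of sqrt v.\<close>

lemma gauss_third:
  assumes v: "0 < v" and h: "0 \<le> h" "h * sqrt v \<le> 1"
  shows "integrable (gauss v) (\<lambda>z. \<bar>z\<bar> ^ 3 * exp (h * \<bar>z\<bar>))"
    "(\<integral>z. \<bar>z\<bar> ^ 3 * exp (h * \<bar>z\<bar>) \<partial>gauss v) \<le> 12 * exp 2 * sqrt v ^ 3"
proof -
  define r where "r = h + 1 / sqrt v"
  define U where "U z = 6 * sqrt v ^ 3 * (exp (r * z) + exp ((-r) * z))" for z
  have sv: "0 < sqrt v" using v by simp
  have le: "\<bar>z\<bar> ^ 3 * exp (h * \<bar>z\<bar>) \<le> U z" for z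
  proof -
    have "(\<bar>z\<bar> / sqrt v) ^ 3 \<le> 6 * exp (\<bar>z\<bar> / sqrt v)"
      using sv by (intro cube_le_exp) simp
    then have "\<bar>z\<bar> ^ 3 \<le> 6 * sqrt v ^ 3 * exp (\<bar>z\<bar> / sqrt v)"
      using sv by (simp add: power_divide field_simps)
    then have "\<bar>z\<bar> ^ 3 * exp (h * \<bar>z\<bar>) \<le> 6 * sqrt v ^ 3 * exp (\<bar>z\<bar> / sqrt v) * exp (h * \<bar>z\<bar>)"
      by (intro mult_right_mono) auto
    also have "\<dots> = 6 * sqrt v ^ 3 * exp (r * \<bar>z\<bar>)"
      by (simp add: r_def exp_add[symmetric] algebra_simps)
    also have "\<dots> \<le> U z"
      unfolding U_def using sv by (intro mult_left_mono) (auto simp: abs_if)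
    finally show ?thesis .
  qed
  have Ui: "integrable (gauss v) U"
    unfolding U_def by (intro integrable_mult_right Bochner_Integration.integrable_add gauss_exp v)
  show i: "integrable (gauss v) (\<lambda>z. \<bar>z\<bar> ^ 3 * exp (h * \<bar>z\<bar>))"
    by (rule Bochner_Integration.integrable_bound[OF Ui])
       (use le order_trans[OF _ abs_ge_self] in auto)
  have "(\<integral>z. \<bar>z\<bar> ^ 3 * exp (h * \<bar>z\<bar>) \<partial>gauss v) \<le> integral\<^sup>L (gauss v) U"
    using i Ui le by (intro integral_mono) auto
  also have "\<dots> = 6 * sqrt v ^ 3 * (exp (r\<^sup>2 * v / 2) + exp ((-r)\<^sup>2 * v / 2))"
    unfolding U_def integral_mult_right_zero
      Bochner_Integration.integral_add[OF gauss_exp(1)[OF v] gauss_exp(1)[OF v]] gauss_exp(2)[OF v] ..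
  also have "\<dots> = 12 * sqrt v ^ 3 * exp (r\<^sup>2 * v / 2)" by simp
  also have "r\<^sup>2 * v / 2 \<le> 2"
  proof -
    have "r * sqrt v \<le> 2" using h sv by (simp add: r_def distrib_right)
    moreover have "0 \<le> r * sqrt v" using h sv by (simp add: r_def)
    ultimately have "(r * sqrt v)\<^sup>2 \<le> 2\<^sup>2" by (intro power_mono)
    then show ?thesis using v by (simp add: power_mult_distrib)
  qed
  then have "12 * sqrt v ^ 3 * exp (r\<^sup>2 * v / 2) \<le> 12 * sqrt v ^ 3 * exp 2"
    using sv by (intro mult_left_mono) auto
  finally show "(\<integral>z. \<bar>z\<bar> ^ 3 * exp (h * \<bar>z\<bar>) \<partial>gauss v) \<le> 12 * exp 2 * sqrt v ^ 3"
    by (simp only: ac_simps)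
qed

section \<open>A cubic spline step function\<close>

text \<open>The distribution function of a sum of three independent uniform variables on \<open>[0, 1]\<close>: twice
  differentiable with Lipschitz second derivative, 0 on the left of 0 and 1 on the right of 3.\<close>

definition spline_step :: "real \<Rightarrow> real" where
  "spline_step t = (max t 0 ^ 3 - 3 * max (t - 1) 0 ^ 3 + 3 * max (t - 2) 0 ^ 3 - max (t - 3) 0 ^ 3) / 6"

definition spline_step1 :: "real \<Rightarrow> real" where
  "spline_step1 t = ((max t 0)\<^sup>2 - 3 * (max (t - 1) 0)\<^sup>2 + 3 * (max (t - 2) 0)\<^sup>2 - (max (t - 3) 0)\<^sup>2) / 2"

definition spline_step2 :: "real \<Rightarrow> real" where
  "spline_step2 t = max t 0 - 3 * max (t - 1) 0 + 3 * max (t - 2) 0 - max (t - 3) 0"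

text \<open>The second derivative of the cubed positive part is 6 max(s, 0), which is Lipschitz with
  constant 6, and 6/3! = 1. The proof checks the four sign patterns of s and s + u directly.\<close>

lemma cube_max_taylor:
  "\<bar>max (s + u) 0 ^ 3 - max s 0 ^ 3 - 3 * (max s 0)\<^sup>2 * u - 3 * max s 0 * u\<^sup>2\<bar> \<le> \<bar>u :: real\<bar> ^ 3"
proof -
  consider "0 \<le> s" "0 \<le> s + u" | "0 \<le> s" "s + u < 0" | "s < 0" "0 \<le> s + u" | "s < 0" "s + u < 0"
    by linarith
  then show ?thesis
  proof cases
    case 1
    then have "max (s + u) 0 ^ 3 - max s 0 ^ 3 - 3 * (max s 0)\<^sup>2 * u - 3 * max s 0 * u\<^sup>2 = u ^ 3"
      by (simp add: algebra_simps power2_eq_square power3_eq_cube)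
    then show ?thesis by (simp add: power_abs)
  next
    case 2
    have "max (s + u) 0 ^ 3 - max s 0 ^ 3 - 3 * (max s 0)\<^sup>2 * u - 3 * max s 0 * u\<^sup>2 = (- (s + u)) ^ 3 - (- u) ^ 3"
      using 2 by (simp add: algebra_simps power2_eq_square power3_eq_cube)
    moreover have "0 \<le> (- (s + u)) ^ 3" by (rule zero_le_power) (use 2 in simp)
    moreover have "(- (s + u)) ^ 3 \<le> (- u) ^ 3" by (rule power_mono) (use 2 in simp_all)
    moreover have "\<bar>u\<bar> ^ 3 = (- u) ^ 3" using 2 by simp
    ultimately show ?thesis by linarith
  next
    case 3
    have "(s + u) ^ 3 \<le> u ^ 3" using 3 by (intro power_mono) auto
    then show ?thesis using 3 by simp
  next
    case 4
    then show ?thesis by simp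
  qed
qed

lemma spline_step_taylor:
  "\<bar>spline_step (s + u) - spline_step s - spline_step1 s * u - spline_step2 s * u\<^sup>2 / 2\<bar> \<le> 2 * \<bar>u\<bar> ^ 3"
proof -
  define R where "R s = max (s + u) 0 ^ 3 - max s 0 ^ 3 - 3 * (max s 0)\<^sup>2 * u - 3 * max s 0 * u\<^sup>2" for s
  have e: "spline_step (s + u) - spline_step s - spline_step1 s * u - spline_step2 s * u\<^sup>2 / 2 =
    (R s - 3 * R (s - 1) + 3 * R (s - 2) - R (s - 3)) / 6"
    unfolding spline_step_def spline_step1_def spline_step2_def R_def by (simp add: field_simps)
  have "\<bar>R s\<bar> \<le> \<bar>u\<bar> ^ 3" for s
    unfolding R_def by (rule cube_max_taylor)
  \<comment> \<open>The binomial weights 1, 3, 3, 1 add up to 8, and 8/6 is rounded up to 2.\<close>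
  from this[of s] this[of "s - 1"] this[of "s - 2"] this[of "s - 3"]
  have "\<bar>R s - 3 * R (s - 1) + 3 * R (s - 2) - R (s - 3)\<bar> \<le> 8 * \<bar>u\<bar> ^ 3"
    by linarith
  then show ?thesis unfolding e abs_divide by simp
qed

lemma spline_step_nonpos:
  "t \<le> 0 \<Longrightarrow> spline_step t = 0" "t \<le> 0 \<Longrightarrow> spline_step1 t = 0" "t \<le> 0 \<Longrightarrow> spline_step2 t = 0"
  by (simp_all add: spline_step_def spline_step1_def spline_step2_def)

lemma spline_step_ge3:
  "3 \<le> t \<Longrightarrow> spline_step t = 1" "3 \<le> t \<Longrightarrow> spline_step1 t = 0" "3 \<le> t \<Longrightarrow> spline_step2 t = 0"
  by (simp_all add: spline_step_def spline_step1_def spline_step2_def algebra_simps power2_eq_square power3_eq_cube)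

lemma spline_step_bounds: "0 \<le> spline_step t" "spline_step t \<le> 1"
proof -
  have "0 \<le> spline_step t \<and> spline_step t \<le> 1"
  proof -
    consider "t \<le> 0" | "0 \<le> t" "t \<le> 1" | "1 \<le> t" "t \<le> 2" | "2 \<le> t" "t \<le> 3" | "3 \<le> t" by linarith
    then show ?thesis
    proof cases
      case 2
      then have "t ^ 3 \<le> 1" by (intro power_le_one)
      then show ?thesis using 2 by (simp add: spline_step_def)
    next
      case 3
      define v where "v = t - 1"
      have v: "0 \<le> v" "v \<le> 1" using 3 by (auto simp: v_def)
      have e: "spline_step t = (1 + 3 * v + 3 * v\<^sup>2 - 2 * v ^ 3) / 6"
        using 3 by (simp add: spline_step_def v_def algebra_simps power2_eq_square power3_eq_cube)
      \<comment> \<open>This yields v^3 \<ge> 2 v^2 - v. With v^3 \<ge> 0 alone the numerator would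
        only be bounded by 7 instead of 6.\<close>
      have "0 \<le> v * (v - 1)\<^sup>2" using v by simp
      then have "2 * v\<^sup>2 - v \<le> v ^ 3" by (simp add: algebra_simps power2_eq_square power3_eq_cube)
      moreover have "v ^ 3 \<le> v\<^sup>2" "v\<^sup>2 \<le> v" "0 \<le> v ^ 3" "0 \<le> v\<^sup>2" using v power_decreasing[of 2 3 v] power_decreasing[of 1 2 v] by auto
      ultimately have "0 \<le> 1 + 3 * v + 3 * v\<^sup>2 - 2 * v ^ 3" "1 + 3 * v + 3 * v\<^sup>2 - 2 * v ^ 3 \<le> 6"
        using v by linarith+
      then show ?thesis unfolding e by simp
    next
      case 4
      then have "0 \<le> 3 - t" "(3 - t) ^ 3 \<le> 1" by (auto intro!: power_le_one)
      moreover from this have "0 \<le> (3 - t) ^ 3" by simp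
      moreover have "spline_step t = 1 - (3 - t) ^ 3 / 6"
        using 4 by (simp add: spline_step_def field_simps power2_eq_square power3_eq_cube)
      ultimately show ?thesis by simp
    qed (auto simp: spline_step_nonpos spline_step_ge3)
  qed
  then show "0 \<le> spline_step t" "spline_step t \<le> 1" by auto
qed

text \<open>From 3 on both functions vanish, and up to 3 every positive part lies in [0, 3]. Only
  the finiteness of the bounds matters, so cancellation is ignored.\<close>

lemma spline_step_deriv_bounded: "\<bar>spline_step1 t\<bar> \<le> 36" "\<bar>spline_step2 t\<bar> \<le> 24"
proof -
  have "\<bar>spline_step1 t\<bar> \<le> 36 \<and> \<bar>spline_step2 t\<bar> \<le> 24"
  proof (cases "t \<le> 3")
    case True
    define a b c where "a = max t 0" "b = max (t - 1) 0" "c = max (t - 2) 0"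
    have b: "0 \<le> a" "a \<le> 3" "0 \<le> b" "b \<le> 3" "0 \<le> c" "c \<le> 3" using True by (auto simp: a_b_c_def)
    then have sq: "a\<^sup>2 \<le> 9" "b\<^sup>2 \<le> 9" "c\<^sup>2 \<le> 9"
      using power_mono[of a 3 2] power_mono[of b 3 2] power_mono[of c 3 2] by simp_all
    have sq0: "0 \<le> a\<^sup>2" "0 \<le> b\<^sup>2" "0 \<le> c\<^sup>2" by (rule zero_le_power2)+
    have e: "spline_step1 t = (a\<^sup>2 - 3 * b\<^sup>2 + 3 * c\<^sup>2) / 2" "spline_step2 t = a - 3 * b + 3 * c"
      using True by (simp_all add: spline_step1_def spline_step2_def a_b_c_def)
    have "\<bar>(x - 3 * y + 3 * z) / 2\<bar> \<le> 36"
      if "x \<le> 9" "y \<le> 9" "z \<le> 9" "0 \<le> x" "0 \<le> y" "0 \<le> z" for x y z :: real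
      using that by (simp add: abs_le_iff)
    from this[OF sq sq0] have "\<bar>spline_step1 t\<bar> \<le> 36" unfolding e .
    moreover have "\<bar>spline_step2 t\<bar> \<le> 24" unfolding e using b by linarith
    ultimately show ?thesis ..
  qed (simp add: spline_step_ge3)
  then show "\<bar>spline_step1 t\<bar> \<le> 36" "\<bar>spline_step2 t\<bar> \<le> 24" by auto
qed

lemma spline_step_measurable[measurable]:
  "spline_step \<in> borel_measurable borel" "spline_step1 \<in> borel_measurable borel" "spline_step2 \<in> borel_measurable borel"
  unfolding spline_step_def[abs_def] spline_step1_def[abs_def] spline_step2_def[abs_def] by measurable

text \<open>The exponential weight comes for free: both sides of the expansion vanish unless
  \<open>s\<close> or \<open>s + u\<close> exceeds \<open>y\<close>, and then \<open>h * (s - y + \<bar>u\<bar>) \<ge> 0\<close>.\<close>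

lemma taylor3_spline_step:
  assumes d: "0 < d" and h: "0 \<le> h"
  shows "taylor3 (2 / d ^ 3 * exp (- (h * y))) h (\<lambda>t. spline_step ((t - y) / d))
    (\<lambda>t. spline_step1 ((t - y) / d) / d) (\<lambda>t. spline_step2 ((t - y) / d) / d\<^sup>2)"
proof -
  have "\<bar>spline_step ((s + u - y) / d) - spline_step ((s - y) / d) - spline_step1 ((s - y) / d) / d * u -
       spline_step2 ((s - y) / d) / d\<^sup>2 * u\<^sup>2 / 2\<bar>
       \<le> 2 / d ^ 3 * exp (- (h * y)) * exp (h * s) * (\<bar>u\<bar> ^ 3 * exp (h * \<bar>u\<bar>))" (is "\<bar>?R\<bar> \<le> ?B") for s u
  proof (cases "s \<le> y \<and> s + u \<le> y")
    case True
    then have "?R = 0" using d by (simp add: spline_step_nonpos divide_nonpos_pos)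
    then show ?thesis using d by simp
  next
    case False
    then have e: "1 \<le> exp (h * (s - y + \<bar>u\<bar>))" using h by (auto simp: abs_if)
    have "?R = spline_step ((s - y) / d + u / d) - spline_step ((s - y) / d) - spline_step1 ((s - y) / d) * (u / d) -
       spline_step2 ((s - y) / d) * (u / d)\<^sup>2 / 2"
      by (simp add: add_divide_distrib diff_divide_distrib power_divide algebra_simps)
    then have "\<bar>?R\<bar> \<le> 2 * \<bar>u / d\<bar> ^ 3"
      using spline_step_taylor[of "(s - y) / d" "u / d"] by simp
    also have "\<dots> = 2 / d ^ 3 * \<bar>u\<bar> ^ 3" using d by (simp add: power_divide)
    also have "\<dots> \<le> 2 / d ^ 3 * \<bar>u\<bar> ^ 3 * exp (h * (s - y + \<bar>u\<bar>))"
      using mult_left_mono[OF e, of "2 / d ^ 3 * \<bar>u\<bar> ^ 3"] d by simp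
    also have "exp (h * (s - y + \<bar>u\<bar>)) = exp (- (h * y)) * exp (h * s) * exp (h * \<bar>u\<bar>)"
      by (simp add: exp_add[symmetric] algebra_simps)
    finally show ?thesis by (simp only: ac_simps)
  qed
  moreover have "\<exists>B. \<forall>t. \<bar>spline_step ((t - y) / d)\<bar> \<le> B"
    using spline_step_bounds by (intro exI[of _ 1]) auto
  moreover have "\<exists>B. \<forall>t. \<bar>spline_step1 ((t - y) / d) / d\<bar> \<le> B"
    using spline_step_deriv_bounded d by (intro exI[of _ "36 / d"]) (auto simp: divide_right_mono)
  moreover have "\<exists>B. \<forall>t. \<bar>spline_step2 ((t - y) / d) / d\<^sup>2\<bar> \<le> B"
    using spline_step_deriv_bounded d by (intro exI[of _ "24 / d\<^sup>2"]) (auto simp: divide_right_mono)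
  ultimately show ?thesis
    unfolding taylor3_def by simp
qed

lemma exp_le_quadratic: "exp x \<le> 1 + x + x\<^sup>2 / 2 * exp \<bar>x\<bar>" for x :: real
proof -
  obtain t where t: "\<bar>t\<bar> \<le> \<bar>x\<bar>" "exp x = (\<Sum>m<2. x ^ m / fact m) + exp t / fact 2 * x ^ 2"
    using Maclaurin_exp_le[of x 2] by blast
  have "exp t / 2 * x\<^sup>2 \<le> exp \<bar>x\<bar> / 2 * x\<^sup>2"
    using t(1) by (intro mult_right_mono divide_right_mono) auto
  then show ?thesis using t(2) by (simp add: numeral_2_eq_2 ac_simps)
qed

text \<open>Summands bounded by b with variance 1/n have weighted third moment at most b exp(h b)/n
  and moment generating function at most exp(h^2 exp(h b)/(2n)). Over n replacements the first
  becomes b exp(h b), and the n-th power of the second becomes the exponential factor of the bound.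
  The condition h \<le> sqrt n is what \<open>gauss_third\<close> asks of the replacing normal
  variable of variance 1/n.\<close>

lemma (in prob_space) spline_step_normal_approx:
  fixes Y :: "'i \<Rightarrow> 'a \<Rightarrow> real"
  assumes I: "finite I" "card I = n" "0 < n" and ind: "indep_vars (\<lambda>_. borel) Y I"
    and id: "\<And>i. i \<in> I \<Longrightarrow> distr M borel (Y i) = N"
    and N: "prob_space N" "sets N = sets borel" and b: "AE y in N. \<bar>y\<bar> \<le> b"
    and m1: "(\<integral>y. y \<partial>N) = 0" and m2: "(\<integral>y. y\<^sup>2 \<partial>N) = 1 / n"
    and h: "0 \<le> h" "h \<le> sqrt n" and d: "0 < d"
  shows "\<bar>expectation (\<lambda>\<omega>. spline_step (((\<Sum>i\<in>I. Y i \<omega>) - y) / d)) - (\<integral>z. spline_step ((z - y) / d) \<partial>gauss 1)\<bar>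
    \<le> 2 / d ^ 3 * exp (h\<^sup>2 * exp (h * b) / 2 - h * y) * (b * exp (h * b) + 12 * exp 2 / sqrt n)"
proof -
  interpret N: prob_space N by fact
  have [measurable_cong]: "sets N = sets borel" by fact
  define f where "f t = spline_step ((t - y) / d)" for t
  have f: "f \<in> borel_measurable borel" "\<And>x. \<bar>f x\<bar> \<le> 1"
    unfolding f_def using spline_step_bounds by auto
  have b0: "0 \<le> b" using b N.AE_E_prob[of "\<lambda>y. \<bar>y\<bar> \<le> b"]
    by (metis (no_types, lifting) AE_False N.emeasure_space_1 abs_ge_zero eventually_mono order_trans N.AE_const)
  have i1: "integrable N (\<lambda>z. z)"
    by (rule N.integrable_const_bound[where B = b]) (use b in auto)
  have i2: "integrable N (\<lambda>z. z\<^sup>2)"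
    by (rule N.integrable_const_bound[where B = "b\<^sup>2"]) (use b in \<open>auto simp: abs_le_square_iff[symmetric]\<close>)
  have ae3: "AE z in N. \<bar>z\<bar> ^ 3 * exp (h * \<bar>z\<bar>) \<le> z\<^sup>2 * (b * exp (h * b))"
    using b
  proof eventually_elim
    case (elim z)
    have "\<bar>z\<bar> ^ 3 = z\<^sup>2 * \<bar>z\<bar>" by (simp add: power3_eq_cube power2_eq_square abs_mult_self_eq)
    then have "\<bar>z\<bar> ^ 3 * exp (h * \<bar>z\<bar>) = z\<^sup>2 * (\<bar>z\<bar> * exp (h * \<bar>z\<bar>))" by simp
    also have "\<dots> \<le> z\<^sup>2 * (b * exp (h * b))"
      using elim h b0 by (intro mult_left_mono mult_mono) (auto intro: mult_left_mono)
    finally show ?case .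
  qed
  have i3: "integrable N (\<lambda>z. \<bar>z\<bar> ^ 3 * exp (h * \<bar>z\<bar>))"
  proof (rule Bochner_Integration.integrable_bound)
    show "integrable N (\<lambda>z. z\<^sup>2 * (b * exp (h * b)))" using i2 by simp
    show "AE z in N. norm (\<bar>z\<bar> ^ 3 * exp (h * \<bar>z\<bar>)) \<le> norm (z\<^sup>2 * (b * exp (h * b)))"
      using ae3 by eventually_elim (use b0 in simp)
  qed auto
  have "(\<integral>z. \<bar>z\<bar> ^ 3 * exp (h * \<bar>z\<bar>) \<partial>N) \<le> (\<integral>z. z\<^sup>2 * (b * exp (h * b)) \<partial>N)"
    using i2 i3 ae3 by (intro integral_mono_AE) auto
  then have t3: "(\<integral>z. \<bar>z\<bar> ^ 3 * exp (h * \<bar>z\<bar>) \<partial>N) \<le> b * exp (h * b) / n"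
    using m2 by simp
  have ie: "integrable N (\<lambda>z. exp (h * z))"
  proof (rule N.integrable_const_bound[where B = "exp (h * b)"])
    show "AE z in N. norm (exp (h * z)) \<le> exp (h * b)"
      using b by eventually_elim (use h in \<open>auto intro: mult_left_mono\<close>)
  qed auto
  have "(\<integral>z. exp (h * z) \<partial>N) \<le> (\<integral>z. 1 + h * z + z\<^sup>2 * (h\<^sup>2 / 2 * exp (h * b)) \<partial>N)"
  proof (rule integral_mono_AE)
    show "AE z in N. exp (h * z) \<le> 1 + h * z + z\<^sup>2 * (h\<^sup>2 / 2 * exp (h * b))"
      using b
    proof eventually_elim
      case (elim z)
      have "exp (h * z) \<le> 1 + h * z + (h * z)\<^sup>2 / 2 * exp \<bar>h * z\<bar>" by (rule exp_le_quadratic)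
      also have "(h * z)\<^sup>2 / 2 * exp \<bar>h * z\<bar> \<le> (h * z)\<^sup>2 / 2 * exp (h * b)"
        using h elim by (intro mult_left_mono) (auto simp: abs_mult intro: mult_left_mono)
      finally show ?case by (simp add: power_mult_distrib ac_simps)
    qed
  qed (use ie i1 i2 in auto)
  also have "\<dots> = 1 + h\<^sup>2 / 2 * exp (h * b) / n"
    using i1 i2 m1 m2 by (simp add: N.prob_space)
  also have "\<dots> \<le> exp (h\<^sup>2 * exp (h * b) / (2 * n))"
    using exp_ge_add_one_self[of "h\<^sup>2 * exp (h * b) / (2 * n)"] by simp
  finally have te: "(\<integral>z. exp (h * z) \<partial>N) \<le> exp (h\<^sup>2 * exp (h * b) / (2 * n))" .
  define v where "v = 1 / real n"
  have v: "0 < v" using I by (simp add: v_def)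
  \<comment> \<open>The iteration uses one bound \<open>m\<close> for both measures. Since exp(h b)
    \<ge> 1, the bound found for \<open>N\<close> also covers the Gaussian value
    exp(h^2/(2n)).\<close>
  have ge: "(\<integral>z. exp (h * z) \<partial>gauss v) \<le> exp (h\<^sup>2 * exp (h * b) / (2 * n))"
  proof -
    have "h\<^sup>2 * 1 \<le> h\<^sup>2 * exp (h * b)" using h b0 by (intro mult_left_mono) auto
    then show ?thesis by (simp add: gauss_exp(2)[OF v]) (simp add: v_def divide_right_mono)
  qed
  have hv: "h * sqrt v \<le> 1" using h I by (simp add: v_def real_sqrt_divide)
  have "(\<integral>z. \<bar>z\<bar> ^ 3 * exp (h * \<bar>z\<bar>) \<partial>gauss v) \<le> 12 * exp 2 * sqrt v ^ 3"
    by (rule gauss_third[OF v h(1) hv])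
  also have "sqrt v ^ 3 = 1 / (n * sqrt n)"
    using I by (simp add: v_def real_sqrt_divide power_divide power3_eq_cube)
  finally have t4: "(\<integral>z. \<bar>z\<bar> ^ 3 * exp (h * \<bar>z\<bar>) \<partial>gauss v) \<le> 12 * exp 2 / (n * sqrt n)" by simp
  define m where "m = exp (h\<^sup>2 * exp (h * b) / (2 * n))"
  have lind: "\<bar>(shift_mean N ^^ n) f 0 - (shift_mean (gauss v) ^^ n) f 0\<bar> \<le>
      real n * (2 / d ^ 3 * exp (- (h * y))) * m ^ n * (b * exp (h * b) / n + 12 * exp 2 / (n * sqrt n)) * exp (h * 0)"
  proof (rule lindeberg_iterate[OF taylor3_spline_step[OF d h(1), of y, folded f_def] N prob_space_gauss[OF v] sets_gauss
      i1 gauss_moments(1)[OF v] _ i2 gauss_moments(3)[OF v] _ i3 gauss_third(1)[OF v h(1) hv] ie te[folded m_def]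
      gauss_exp(1)[OF v] ge[folded m_def]])
    show "1 \<le> m" using b0 h by (simp add: m_def)
    show "(\<integral>z. \<bar>z\<bar> ^ 3 * exp (h * \<bar>z\<bar>) \<partial>N) + (\<integral>z. \<bar>z\<bar> ^ 3 * exp (h * \<bar>z\<bar>) \<partial>gauss v) \<le> b * exp (h * b) / n + 12 * exp 2 / (n * sqrt n)"
      using t3 t4 by linarith
  qed (use m1 m2 gauss_moments[OF v] d in \<open>simp_all add: v_def\<close>)
  have mn: "m ^ n = exp (h\<^sup>2 * exp (h * b) / 2)"
    using I by (simp add: m_def exp_of_nat_mult[symmetric])
  obtain n' where n': "n = Suc n'" using I(3) by (cases n) auto
  have "(shift_mean (gauss v) ^^ n) f 0 = (\<integral>z. f z \<partial>gauss 1)"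
    using shift_mean_gauss_funpow[OF v f, of n' 0] I by (simp add: n' v_def del: funpow.simps)
  moreover have "expectation (\<lambda>\<omega>. f (\<Sum>i\<in>I. Y i \<omega>)) = (shift_mean N ^^ n) f 0"
    using expectation_sum_eq_funpow[OF I(1) ind id f, of 0] I by simp
  ultimately have "\<bar>expectation (\<lambda>\<omega>. f (\<Sum>i\<in>I. Y i \<omega>)) - (\<integral>z. f z \<partial>gauss 1)\<bar> \<le>
     real n * (2 / d ^ 3 * exp (- (h * y))) * exp (h\<^sup>2 * exp (h * b) / 2) * (b * exp (h * b) / n + 12 * exp 2 / (n * sqrt n))"
    using lind mn by simp
  also have "\<dots> = 2 / d ^ 3 * (exp (- (h * y)) * exp (h\<^sup>2 * exp (h * b) / 2)) * (real n * (b * exp (h * b) / n + 12 * exp 2 / (n * sqrt n)))"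
    by (simp only: ac_simps)
  also have "real n * (b * exp (h * b) / n + 12 * exp 2 / (n * sqrt n)) = b * exp (h * b) + 12 * exp 2 / sqrt n"
    using I by (simp add: distrib_left)
  also have "exp (- (h * y)) * exp (h\<^sup>2 * exp (h * b) / 2) = exp (h\<^sup>2 * exp (h * b) / 2 - h * y)"
    by (simp add: exp_add[symmetric])
  finally show ?thesis unfolding f_def .
qed

text \<open>One function for both relations of the theorem: it is at once 1 - \<Phi>(x) and
  \<Phi>(-x).\<close>

definition normal_tail :: "real \<Rightarrow> real" where
  "normal_tail x = measure (gauss 1) {x<..}"

text \<open>The smooth step rising between x - 3d and x dominates the indicator of (x, \<infinity>),
  and the one rising between x and x + 3d is dominated by it. The approximation error decreases in
  the starting point of the step, so \<open>E x\<close>, evaluated at x - 3d, serves in both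
  directions.\<close>

lemma (in prob_space) normal_tail_approx:
  fixes Y :: "'i \<Rightarrow> 'a \<Rightarrow> real"
  assumes I: "finite I" "card I = n" "0 < n" and ind: "indep_vars (\<lambda>_. borel) Y I"
    and id: "\<And>i. i \<in> I \<Longrightarrow> distr M borel (Y i) = N"
    and N: "prob_space N" "sets N = sets borel" and b: "AE y in N. \<bar>y\<bar> \<le> b"
    and m1: "(\<integral>y. y \<partial>N) = 0" and m2: "(\<integral>y. y\<^sup>2 \<partial>N) = 1 / n"
    and h: "0 \<le> h" "h \<le> sqrt n" and d: "0 < d"
  defines "E \<equiv> \<lambda>x. 2 / d ^ 3 * exp (h\<^sup>2 * exp (h * b) / 2 - h * (x - 3 * d)) * (b * exp (h * b) + 12 * exp 2 / sqrt n)"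
  shows "\<P>(\<omega> in M. (\<Sum>i\<in>I. Y i \<omega>) > x) \<le> normal_tail (x - 3 * d) + E x"
    and "\<P>(\<omega> in M. (\<Sum>i\<in>I. Y i \<omega>) > x) \<ge> normal_tail (x + 3 * d) - E x"
proof -
  interpret N: prob_space N by fact
  interpret G: prob_space "gauss 1" by (rule prob_space_gauss) simp
  define S where "S \<omega> = (\<Sum>i\<in>I. Y i \<omega>)" for \<omega>
  have S[measurable]: "S \<in> borel_measurable M"
    unfolding S_def[abs_def] using ind unfolding indep_vars_def by (intro borel_measurable_sum) auto
  define R where "R y = 2 / d ^ 3 * exp (h\<^sup>2 * exp (h * b) / 2 - h * y) * (b * exp (h * b) + 12 * exp 2 / sqrt n)" for y
  have app: "\<bar>expectation (\<lambda>\<omega>. spline_step ((S \<omega> - y) / d)) - (\<integral>z. spline_step ((z - y) / d) \<partial>gauss 1)\<bar> \<le> R y" for y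
    unfolding S_def R_def by (rule spline_step_normal_approx; fact)
  have b0: "0 \<le> b" using b N.AE_E_prob[of "\<lambda>y. \<bar>y\<bar> \<le> b"]
    by (metis (no_types, lifting) AE_False N.emeasure_space_1 abs_ge_zero eventually_mono order_trans N.AE_const)
  have RE: "R y \<le> E x" if "x - 3 * d \<le> y" for x y
  proof -
    have "h * (x - 3 * d) \<le> h * y" using that h by (intro mult_left_mono)
    then show ?thesis unfolding R_def E_def using d b0 by (intro mult_right_mono mult_left_mono) auto
  qed
  have iS: "integrable M (\<lambda>\<omega>. spline_step ((S \<omega> - y) / d))" for y
    using spline_step_bounds by (intro integrable_const_bound[where B = 1]) auto
  have iG: "integrable (gauss 1) (\<lambda>z. spline_step ((z - y) / d))" for y
    using spline_step_bounds by (intro G.integrable_const_bound[where B = 1]) auto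
  have lo: "indicator {x<..} z \<le> spline_step ((z - (x - 3 * d)) / d)" for x z :: real
    using d spline_step_ge3(1)[of "(z - (x - 3 * d)) / d"] spline_step_bounds(1)[of "(z - (x - 3 * d)) / d"]
    by (simp add: indicator_def pos_le_divide_eq)
  have iI: "integrable M (\<lambda>\<omega>. indicator {x<..} (S \<omega>) :: real)" for x
    by (intro integrable_const_bound[where B = 1]) auto
  have iJ: "integrable (gauss 1) (indicator {x<..} :: real \<Rightarrow> real)" for x
    by (intro G.integrable_const_bound[where B = 1]) auto
  have hi: "spline_step ((z - y) / d) \<le> indicator {y<..} z" for y z :: real
    using d spline_step_nonpos(1)[of "(z - y) / d"] spline_step_bounds(2)[of "(z - y) / d"]
    by (auto simp: indicator_def divide_nonpos_pos)
  have PS: "expectation (\<lambda>\<omega>. indicator {x<..} (S \<omega>)) = \<P>(\<omega> in M. S \<omega> > x)"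
  proof -
    have "expectation (\<lambda>\<omega>. indicator {x<..} (S \<omega>) :: real) = expectation (indicator {\<omega> \<in> space M. S \<omega> > x})"
      by (intro Bochner_Integration.integral_cong) (auto simp: indicator_def)
    moreover have "{\<omega> \<in> space M. S \<omega> > x} \<inter> space M = {\<omega> \<in> space M. S \<omega> > x}" by blast
    ultimately show ?thesis by simp
  qed
  have "\<P>(\<omega> in M. S \<omega> > x) = expectation (\<lambda>\<omega>. indicator {x<..} (S \<omega>))"
    by (rule PS[symmetric])
  also have "\<dots> \<le> expectation (\<lambda>\<omega>. spline_step ((S \<omega> - (x - 3 * d)) / d))"
    by (rule integral_mono[OF iI iS lo])
  also have "\<dots> \<le> (\<integral>z. spline_step ((z - (x - 3 * d)) / d) \<partial>gauss 1) + R (x - 3 * d)"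
    using app[of "x - 3 * d"] by linarith
  also have "\<dots> \<le> (\<integral>z. indicator {x - 3 * d<..} z \<partial>gauss 1) + E x"
    by (intro add_mono integral_mono iG iJ hi RE) simp
  finally show "\<P>(\<omega> in M. (\<Sum>i\<in>I. Y i \<omega>) > x) \<le> normal_tail (x - 3 * d) + E x"
    by (simp add: S_def normal_tail_def)
  have "normal_tail (x + 3 * d) - E x \<le> (\<integral>z. indicator {x + 3 * d<..} z \<partial>gauss 1) - R x"
    using RE[of x x] d by (simp add: normal_tail_def)
  also have "(\<integral>z. indicator {x + 3 * d<..} z \<partial>gauss 1) \<le> (\<integral>z. spline_step ((z - x) / d) \<partial>gauss 1)"
    by (rule integral_mono[OF iJ iG]) (use lo[of "x + 3 * d"] in simp)
  also have "\<dots> - R x \<le> expectation (\<lambda>\<omega>. spline_step ((S \<omega> - x) / d))"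
    using app[of x] by linarith
  also have "\<dots> \<le> expectation (\<lambda>\<omega>. indicator {x<..} (S \<omega>))"
    by (rule integral_mono[OF iS iI hi])
  also have "\<dots> = \<P>(\<omega> in M. S \<omega> > x)"
    by (rule PS)
  finally show "\<P>(\<omega> in M. (\<Sum>i\<in>I. Y i \<omega>) > x) \<ge> normal_tail (x + 3 * d) - E x"
    by (simp add: S_def)
qed

section \<open>Relative errors in the normal tail\<close>

lemma std_normal_gauss: "std_normal_distribution = gauss 1"
  by (simp add: gauss_def)

lemma normal_tail_cdf: "1 - std_normal_cdf x = normal_tail x" "std_normal_cdf (- x) = normal_tail x"
proof -
  interpret G: prob_space "gauss 1" by (rule prob_space_gauss) simp
  have "UNIV - {x<..} = {..x}" by auto
  then show "1 - std_normal_cdf x = normal_tail x"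
    using G.prob_compl[of "{x<..}"] by (simp add: cdf_def normal_tail_def std_normal_gauss)
  have sym: "distr (gauss 1) borel uminus = gauss 1"
  proof -
    have "distributed (gauss 1) lborel (\<lambda>x. x) (\<lambda>x. ennreal (normal_density 0 1 x))"
      unfolding distributed_def by (simp add: gauss_def distr_id2)
    from G.normal_density_affine[OF this, of "-1" 0]
    have "distributed (gauss 1) lborel uminus (\<lambda>x. ennreal (normal_density 0 1 x))" by simp
    then have "distr (gauss 1) lborel uminus = density lborel (\<lambda>x. ennreal (normal_density 0 1 x))"
      by (rule distributed_distr_eq_density)
    then show ?thesis by (simp add: gauss_def cong: distr_cong)
  qed
  have "measure (gauss 1) {.. - x} = measure (distr (gauss 1) borel uminus) {.. - x}"
    by (simp add: sym)
  also have "\<dots> = measure (gauss 1) {x..}"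
    by (subst measure_distr) (auto intro!: arg_cong[where f = "measure (gauss 1)"])
  also have "\<dots> = measure (gauss 1) {x<..}"
  proof -
    have "{x..} = insert x {x<..}" by auto
    moreover have "measure (gauss 1) {x} = 0"
      by (simp add: measure_def gauss_def emeasure_density_const emeasure_density nn_integral_null_set null_sets_def)
    ultimately show ?thesis
      by (simp add: G.finite_measure_Union[of "{x}" "{x<..}", simplified])
  qed
  finally show "std_normal_cdf (- x) = normal_tail x"
    by (simp add: cdf_def normal_tail_def std_normal_gauss)
qed


lemma measure_gauss_interval:
  assumes "a \<le> b"
  shows "normal_tail a - normal_tail b = (\<integral>t. std_normal_density t * indicator {a<..b} t \<partial>lborel)"
    and "integrable lborel (\<lambda>t. std_normal_density t * indicator {a<..b} t)"
proof -
  interpret G: prob_space "gauss 1" by (rule prob_space_gauss) simp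
  have "integrable (gauss 1) (indicator {a<..b} :: real \<Rightarrow> real)"
    by (intro G.integrable_const_bound[where B = 1]) auto
  then show "integrable lborel (\<lambda>t. std_normal_density t * indicator {a<..b} t)"
    by (simp add: integral_gauss)
  have "measure (gauss 1) ({a<..b} \<union> {b<..}) = measure (gauss 1) {a<..b} + measure (gauss 1) {b<..}"
    by (rule G.finite_measure_Union) auto
  moreover have "{a<..b} \<union> {b<..} = {a<..}" using assms by auto
  ultimately have "normal_tail a = measure (gauss 1) {a<..b} + normal_tail b"
    unfolding normal_tail_def by (simp only:)
  also have "measure (gauss 1) {a<..b} = (\<integral>t. indicator {a<..b} t \<partial>gauss 1)"
    by simp
  also have "\<dots> = (\<integral>t. std_normal_density t * indicator {a<..b} t \<partial>lborel)"
    by (subst integral_gauss(1)) simp_all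
  finally show "normal_tail a - normal_tail b = (\<integral>t. std_normal_density t * indicator {a<..b} t \<partial>lborel)"
    by simp
qed

lemma normal_tail_diff_le:
  assumes ab: "a \<le> b" and B: "\<And>t. a < t \<Longrightarrow> t \<le> b \<Longrightarrow> exp (- t\<^sup>2 / 2) \<le> B"
  shows "normal_tail a - normal_tail b \<le> (b - a) * B"
proof -
  have "normal_tail a - normal_tail b \<le> (\<integral>t. B * indicator {a<..b} t \<partial>lborel)"
    unfolding measure_gauss_interval(1)[OF ab]
  proof (rule integral_mono[OF measure_gauss_interval(2)[OF ab]])
    fix t
    have "1 / sqrt (2 * pi) \<le> 1" using pi_gt3 by (simp add: real_le_rsqrt)
    then have "std_normal_density t \<le> exp (- t\<^sup>2 / 2)"
      using mult_right_mono[of "1 / sqrt (2 * pi)" 1 "exp (- t\<^sup>2 / 2)"]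
      by (simp add: std_normal_density_def)
    then show "std_normal_density t * indicator {a<..b} t \<le> B * indicator {a<..b} t"
      using B[of t] by (auto simp: indicator_def)
  qed (intro integrable_mult_right integrable_real_indicator; simp add: ab)
  then show ?thesis using ab by (simp add: mult.commute)
qed

lemma normal_tail_diff_ge:
  assumes ab: "a \<le> b" and B: "\<And>t. a < t \<Longrightarrow> t \<le> b \<Longrightarrow> B \<le> exp (- t\<^sup>2 / 2)"
  shows "(b - a) * (B / sqrt (2 * pi)) \<le> normal_tail a - normal_tail b"
proof -
  have "(\<integral>t. B / sqrt (2 * pi) * indicator {a<..b} t \<partial>lborel) \<le> normal_tail a - normal_tail b"
    unfolding measure_gauss_interval(1)[OF ab]
  proof (rule integral_mono[OF _ measure_gauss_interval(2)[OF ab]])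
    fix t
    show "B / sqrt (2 * pi) * indicator {a<..b} t \<le> std_normal_density t * indicator {a<..b} t"
      using B[of t] by (auto simp: indicator_def std_normal_density_def divide_right_mono)
  qed (intro integrable_mult_right integrable_real_indicator; simp add: ab)
  then show ?thesis using ab by (simp add: mult.commute)
qed

lemma normal_tail_antimono: "x \<le> y \<Longrightarrow> normal_tail y \<le> normal_tail x"
proof -
  interpret G: prob_space "gauss 1" by (rule prob_space_gauss) simp
  assume "x \<le> y"
  then show ?thesis unfolding normal_tail_def by (intro G.finite_measure_mono) auto
qed

text \<open>A Mills ratio bound up to a constant. On the interval of length w = 1/(1 + z) to the
  right of z, t^2 exceeds z^2 by at most 2 z w + w^2 \<le> 3, which is the origin of the factor
  exp(-3/2).\<close>

lemma normal_tail_lower: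
  assumes "z = max x 0"
  shows "exp (- (3 / 2)) / sqrt (2 * pi) * exp (- z\<^sup>2 / 2) / (1 + z) \<le> normal_tail x"
proof -
  have z: "0 \<le> z" "x \<le> z" using assms by auto
  define w where "w = 1 / (1 + z)"
  have w: "0 \<le> w" "w \<le> 1" "z * w \<le> 1" "0 \<le> z * w" using z by (auto simp: w_def)
  have "(z + w - z) * (exp (- (3 / 2) - z\<^sup>2 / 2) / sqrt (2 * pi)) \<le> normal_tail z - normal_tail (z + w)"
  proof (rule normal_tail_diff_ge)
    fix t assume t: "z < t" "t \<le> z + w"
    have "t\<^sup>2 \<le> (z + w)\<^sup>2" using t z by (intro power_mono) auto
    also have "\<dots> = z\<^sup>2 + 2 * (z * w) + w * w" by (simp add: algebra_simps power2_eq_square)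
    also have "\<dots> \<le> z\<^sup>2 + 2 * 1 + 1 * 1" using w by (intro add_mono mult_mono) auto
    finally show "exp (- (3 / 2) - z\<^sup>2 / 2) \<le> exp (- t\<^sup>2 / 2)" by simp
  qed (use w in simp)
  moreover have e: "exp (- (3 / 2) - z\<^sup>2 / 2) = exp (- (3 / 2)) * exp (- z\<^sup>2 / 2)"
    by (simp add: exp_add[symmetric])
  moreover have "0 \<le> normal_tail (z + w)" by (simp add: normal_tail_def)
  moreover have "normal_tail z \<le> normal_tail x" using z by (intro normal_tail_antimono)
  moreover have "(z + w - z) * (exp (- (3 / 2) - z\<^sup>2 / 2) / sqrt (2 * pi)) =
    exp (- (3 / 2)) / sqrt (2 * pi) * exp (- z\<^sup>2 / 2) / (1 + z)"
    by (simp add: w_def e)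
  ultimately show ?thesis by linarith
qed

text \<open>The density is bounded on the interval between x and y. There t \<ge> x - e, so t^2
  \<ge> z^2 - 2 z e: by squaring t \<ge> z - e when this is informative, and otherwise because the
  right-hand side is not positive.\<close>

lemma normal_tail_shift:
  assumes z: "z = max x 0" and e: "0 \<le> e" and y: "\<bar>y - x\<bar> \<le> e"
  shows "\<bar>normal_tail y - normal_tail x\<bar> \<le> e * exp (- z\<^sup>2 / 2 + z * e)"
proof -
  have B: "exp (- t\<^sup>2 / 2) \<le> exp (- z\<^sup>2 / 2 + z * e)" if "x - e \<le> t" for t
  proof -
    have "z\<^sup>2 - 2 * (z * e) \<le> t\<^sup>2"
    proof (cases "e \<le> z \<and> 0 < x")
      case True
      then have "z - e \<le> t" using that z e by (auto simp: max_def split: if_splits)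
      then have "(z - e)\<^sup>2 \<le> t\<^sup>2" using True by (intro power_mono) auto
      moreover have "(z - e)\<^sup>2 = z\<^sup>2 - 2 * (z * e) + e\<^sup>2" by (simp add: algebra_simps power2_eq_square)
      moreover have "0 \<le> e\<^sup>2" by simp
      ultimately show ?thesis by linarith
    next
      case False
      then have "z * z \<le> z * e" using z e by (intro mult_left_mono) auto
      moreover have "0 \<le> z * e" using z e by simp
      moreover have "0 \<le> t\<^sup>2" by simp
      ultimately show ?thesis unfolding power2_eq_square by linarith
    qed
    then show ?thesis by simp
  qed
  have pos: "0 \<le> exp (- z\<^sup>2 / 2 + z * e)" by simp
  show ?thesis
  proof (cases "y \<le> x")
    case True
    have "normal_tail y - normal_tail x \<le> (x - y) * exp (- z\<^sup>2 / 2 + z * e)"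
      by (rule normal_tail_diff_le[OF True B]) (use y in linarith)
    also have "\<dots> \<le> e * exp (- z\<^sup>2 / 2 + z * e)" using y by (intro mult_right_mono) auto
    finally show ?thesis using normal_tail_antimono[OF True] by simp
  next
    case False
    then have xy: "x \<le> y" by simp
    have "normal_tail x - normal_tail y \<le> (y - x) * exp (- z\<^sup>2 / 2 + z * e)"
      by (rule normal_tail_diff_le[OF xy B]) (use e in linarith)
    also have "\<dots> \<le> e * exp (- z\<^sup>2 / 2 + z * e)" using y by (intro mult_right_mono) auto
    finally show ?thesis using normal_tail_antimono[OF xy] by simp
  qed
qed

text \<open>Division by the Mills lower bound turns an error relative to exp(-z^2/2) into one
  relative to the tail, at the price of a factor 1 + z. The last constant is the reciprocal of the
  one in \<open>normal_tail_lower\<close>.\<close>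

lemma normal_tail_ratio:
  assumes z: "z = max x 0" "z \<le> l" and e: "0 \<le> e" and r: "0 \<le> r"
    and u: "q \<le> normal_tail (x - e) + r * exp (- z\<^sup>2 / 2)"
    and l: "normal_tail (x + e) - r * exp (- z\<^sup>2 / 2) \<le> q"
  shows "\<bar>q / normal_tail x - 1\<bar> \<le> (1 + l) * (e * exp (l * e) + r) * (exp (3 / 2) * sqrt (2 * pi))"
proof -
  define g where "g = exp (- z\<^sup>2 / 2)"
  define k where "k = exp (- (3 / 2)) / sqrt (2 * pi)"
  have k: "0 < k" using pi_gt_zero by (simp add: k_def)
  have ik: "1 / k = exp (3 / 2) * sqrt (2 * pi)" by (simp add: k_def exp_minus field_simps)
  have z0: "0 \<le> z" using z by simp
  have H: "k * g / (1 + z) \<le> normal_tail x" unfolding g_def k_def by (rule normal_tail_lower[OF z(1)])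
  have H0: "0 < k * g / (1 + z)" using k z0 by (simp add: g_def)
  have "\<bar>q - normal_tail x\<bar> \<le> e * exp (- z\<^sup>2 / 2 + z * e) + r * g"
    using normal_tail_shift[OF z(1) e, of "x - e"] normal_tail_shift[OF z(1) e, of "x + e"] u l e
    unfolding g_def by simp
  also have "exp (- z\<^sup>2 / 2 + z * e) = exp (z * e) * g"
    by (simp add: g_def exp_add[symmetric] add.commute)
  also have "e * (exp (z * e) * g) + r * g = (e * exp (z * e) + r) * g" by (simp add: algebra_simps)
  also have "\<dots> \<le> (e * exp (l * e) + r) * g"
    using mult_right_mono[OF z(2) e] e by (intro mult_right_mono add_right_mono mult_left_mono) (simp_all add: g_def)
  finally have D: "\<bar>q - normal_tail x\<bar> \<le> (e * exp (l * e) + r) * g" .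
  have T0: "0 < normal_tail x" using H H0 by linarith
  then have "q / normal_tail x - 1 = (q - normal_tail x) / normal_tail x"
    by (simp add: diff_divide_distrib)
  then have "\<bar>q / normal_tail x - 1\<bar> = \<bar>q - normal_tail x\<bar> / normal_tail x"
    using T0 by (simp add: abs_divide)
  also have "\<dots> \<le> (e * exp (l * e) + r) * g / (k * g / (1 + z))"
    using H H0 D e r by (intro frac_le) (auto simp: g_def)
  also have "\<dots> = (1 + z) * (e * exp (l * e) + r) * (1 / k)"
    by (simp add: g_def)
  also have "\<dots> \<le> (1 + l) * (e * exp (l * e) + r) * (1 / k)"
    using z e r k by (intro mult_right_mono) auto
  finally show ?thesis unfolding ik .
qed

text \<open>On this range the Mills factor is of order sqrt(log n). Shifts \<open>e n\<close> and
  relative errors \<open>r n\<close> that are o(1/sqrt(log n)) thus disappear uniformly, the factor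
  exp(l e) included.\<close>

lemma normal_tail_ratio_uniform:
  fixes P :: "nat \<Rightarrow> real \<Rightarrow> real"
  assumes e: "(\<lambda>n. e n * sqrt (ln (real n))) \<longlonglongrightarrow> 0" "\<forall>\<^sub>F n in sequentially. 0 \<le> e n"
    and r: "(\<lambda>n. r n * sqrt (ln (real n))) \<longlonglongrightarrow> 0" "\<forall>\<^sub>F n in sequentially. 0 \<le> r n"
    and c: "0 \<le> c"
    and P: "\<forall>\<^sub>F n in sequentially. \<forall>x. - A \<le> x \<and> x \<le> c * sqrt (ln (real n)) \<longrightarrow>
      P n x \<le> normal_tail (x - e n) + r n * exp (- (max x 0)\<^sup>2 / 2) \<and>
      normal_tail (x + e n) - r n * exp (- (max x 0)\<^sup>2 / 2) \<le> P n x"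
    and \<epsilon>: "0 < \<epsilon>"
  shows "\<forall>\<^sub>F n in sequentially. \<forall>x. - A \<le> x \<and> x \<le> c * sqrt (ln (real n)) \<longrightarrow>
      \<bar>P n x / normal_tail x - 1\<bar> < \<epsilon>"
proof -
  have ln1: "\<forall>\<^sub>F n in sequentially. 1 \<le> ln (real n)"
    using filterlim_compose[OF ln_at_top filterlim_real_sequentially] by (simp add: filterlim_at_top)
  have to0: "f \<longlonglongrightarrow> 0" if f: "(\<lambda>n. f n * sqrt (ln (real n))) \<longlonglongrightarrow> 0" "\<forall>\<^sub>F n in sequentially. 0 \<le> f n" for f
  proof (rule tendsto_sandwich[OF f(2) _ tendsto_const f(1)])
    show "\<forall>\<^sub>F n in sequentially. f n \<le> f n * sqrt (ln (real n))"
      using f(2) ln1 by eventually_elim (simp add: mult_le_cancel_left1)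
  qed
  define l where "l n = c * sqrt (ln (real n))" for n
  have le: "(\<lambda>n. l n * e n) \<longlonglongrightarrow> 0"
    using tendsto_mult_right_zero[OF e(1), of c] by (simp add: l_def ac_simps)
  have lr: "(\<lambda>n. l n * r n) \<longlonglongrightarrow> 0"
    using tendsto_mult_right_zero[OF r(1), of c] by (simp add: l_def ac_simps)
  define B where "B n = (1 + l n) * (e n * exp (l n * e n) + r n) * (exp (3 / 2) * sqrt (2 * pi))" for n
  have "(\<lambda>n. ((e n + l n * e n) * exp (l n * e n) + (r n + l n * r n)) * (exp (3 / 2) * sqrt (2 * pi)))
    \<longlonglongrightarrow> ((0 + 0) * exp 0 + (0 + 0)) * (exp (3 / 2) * sqrt (2 * pi))"
    by (rule tendsto_mult[OF tendsto_add[OF tendsto_mult[OF tendsto_add[OF to0[OF e] le] tendsto_exp[OF le]]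
      tendsto_add[OF to0[OF r] lr]] tendsto_const])
  then have B: "B \<longlonglongrightarrow> 0"
    unfolding B_def by (simp add: algebra_simps)
  from order_tendstoD(2)[OF B \<epsilon>] ln1 e(2) r(2) P show ?thesis
  proof eventually_elim
    case (elim n)
    show ?case
    proof (intro allI impI)
      fix x assume x: "- A \<le> x \<and> x \<le> c * sqrt (ln (real n))"
      have "max x 0 \<le> l n" using x c elim(2) by (auto simp: l_def)
      moreover have "P n x \<le> normal_tail (x - e n) + r n * exp (- (max x 0)\<^sup>2 / 2)"
        "normal_tail (x + e n) - r n * exp (- (max x 0)\<^sup>2 / 2) \<le> P n x"
        using elim(5) x by auto
      ultimately have "\<bar>P n x / normal_tail x - 1\<bar> \<le> B n"
        unfolding B_def by (intro normal_tail_ratio[OF refl _ elim(3,4)])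
      with elim(1) show "\<bar>P n x / normal_tail x - 1\<bar> < \<epsilon>" by simp
    qed
  qed
qed

text \<open>The weight exponent is z = max x 0, for which z^2/2 - z x = -z^2/2. The exponent of the
  Lindeberg bound differs from this by z^2 (exp(z b) - 1)/2 and by z times the shifts. The first
  tends to 0 because b is a negative power of n while z^2 is at most of order log n, the second by
  the rate of the shifts; eventually their sum is below 1.\<close>

lemma (in prob_space) moderate_tail_approx:
  fixes Y :: "nat \<Rightarrow> nat \<Rightarrow> 'a \<Rightarrow> real" and N :: "nat \<Rightarrow> real measure" and P :: "nat \<Rightarrow> real \<Rightarrow> real"
  assumes Y: "\<forall>\<^sub>F n in sequentially. indep_vars (\<lambda>_. borel) (Y n) {1..n} \<and>
      (\<forall>i\<in>{1..n}. distr M borel (Y n i) = N n) \<and> (AE y in N n. \<bar>y\<bar> \<le> C * real n powr - \<eta>) \<and>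
      (\<integral>y. y \<partial>N n) = 0 \<and> (\<integral>y. y\<^sup>2 \<partial>N n) = 1 / n"
    and \<eta>: "0 < \<eta>" "0 < C" and c: "0 < c"
    and \<delta>: "(\<lambda>n. \<delta> n * sqrt (ln (real n))) \<longlonglongrightarrow> 0" "\<forall>\<^sub>F n in sequentially. 0 \<le> \<delta> n"
    and \<tau>: "\<forall>\<^sub>F n in sequentially. 0 \<le> \<tau> n \<and> \<tau> n \<le> real n powr (- c\<^sup>2 / 2 - 1)"
    and P: "\<forall>\<^sub>F n in sequentially. \<forall>x. - A \<le> x \<and> x \<le> c * sqrt (ln (real n)) \<longrightarrow>
      P n x \<le> \<P>(\<omega> in M. (\<Sum>i\<in>{1..n}. Y n i \<omega>) > x - \<delta> n) + \<tau> n \<and>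
      \<P>(\<omega> in M. (\<Sum>i\<in>{1..n}. Y n i \<omega>) > x + \<delta> n) - \<tau> n \<le> P n x"
    and \<epsilon>: "0 < \<epsilon>"
  shows "\<forall>\<^sub>F n in sequentially. \<forall>x. - A \<le> x \<and> x \<le> c * sqrt (ln (real n)) \<longrightarrow>
      \<bar>P n x / normal_tail x - 1\<bar> < \<epsilon>"
proof -
  \<comment> \<open>The width has to be o(1/sqrt(log n)), while its inverse cube has to be
    negligible against powers of n.\<close>
  define d where "d n = 1 / ln (real n)" for n
  define l where "l n = c * sqrt (ln (real n))" for n
  define b where "b n = C * real n powr - \<eta>" for n
  \<comment> \<open>The total error relative to exp(-z^2/2): the Lindeberg term with every bounded
    exponential replaced by exp 1, plus the share of the exceptional event.\<close>
  define \<rho> where "\<rho> n = 2 / d n ^ 3 * exp 1 * (b n * exp 1 + 12 * exp 2 / sqrt n) + real n powr - 1" for n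
  have ln1: "\<forall>\<^sub>F n in sequentially. 1 \<le> ln (real n)" by real_asymp
  have d0: "(\<lambda>n. 3 * d n * sqrt (ln (real n))) \<longlonglongrightarrow> 0" unfolding d_def by real_asymp
  have e: "(\<lambda>n. (\<delta> n + 3 * d n) * sqrt (ln (real n))) \<longlonglongrightarrow> 0"
    using tendsto_add[OF \<delta>(1) d0] by (simp add: algebra_simps)
  have e0: "\<forall>\<^sub>F n in sequentially. 0 \<le> \<delta> n + 3 * d n"
    using \<delta>(2) ln1 by eventually_elim (simp add: d_def)
  have \<rho>: "(\<lambda>n. \<rho> n * sqrt (ln (real n))) \<longlonglongrightarrow> 0"
  proof -
    have "(\<lambda>n. ln (real n) ^ 3 * real n powr - \<eta> * sqrt (ln (real n))) \<longlonglongrightarrow> 0"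
      using \<eta> by real_asymp
    moreover have "(\<lambda>n. ln (real n) ^ 3 / sqrt (real n) * sqrt (ln (real n))) \<longlonglongrightarrow> 0"
      by real_asymp
    moreover have "(\<lambda>n. real n powr - 1 * sqrt (ln (real n))) \<longlonglongrightarrow> 0"
      by real_asymp
    ultimately have "(\<lambda>n. 2 * exp 1 * C * exp 1 * (ln (real n) ^ 3 * real n powr - \<eta> * sqrt (ln (real n))) +
        2 * exp 1 * (12 * exp 2) * (ln (real n) ^ 3 / sqrt (real n) * sqrt (ln (real n))) +
        real n powr - 1 * sqrt (ln (real n))) \<longlonglongrightarrow> 2 * exp 1 * C * exp 1 * 0 + 2 * exp 1 * (12 * exp 2) * 0 + 0"
      by (intro tendsto_add tendsto_mult_left)
    moreover have "\<rho> n * sqrt (ln (real n)) = 2 * exp 1 * C * exp 1 * (ln (real n) ^ 3 * real n powr - \<eta> * sqrt (ln (real n))) +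
        2 * exp 1 * (12 * exp 2) * (ln (real n) ^ 3 / sqrt (real n) * sqrt (ln (real n))) +
        real n powr - 1 * sqrt (ln (real n))" for n
      unfolding \<rho>_def d_def b_def by (simp add: algebra_simps power_divide)
    ultimately show ?thesis by simp
  qed
  have \<rho>0: "\<forall>\<^sub>F n in sequentially. 0 \<le> \<rho> n"
    using ln1 by eventually_elim (use \<eta> in \<open>simp add: d_def \<rho>_def b_def\<close>)
  have ls: "\<forall>\<^sub>F n in sequentially. l n \<le> sqrt n"
    unfolding l_def using c by real_asymp
  have lb: "\<forall>\<^sub>F n in sequentially. l n * b n \<le> 1"
    unfolding l_def b_def using c \<eta> by real_asymp
  have q1: "(\<lambda>n. (l n)\<^sup>2 * (exp (l n * b n) - 1) / 2) \<longlonglongrightarrow> 0"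
    unfolding l_def b_def using c \<eta> by real_asymp
  have q2: "(\<lambda>n. c * ((\<delta> n + 3 * d n) * sqrt (ln (real n)))) \<longlonglongrightarrow> c * 0"
    by (intro tendsto_mult_left e)
  have "(\<lambda>n. (l n)\<^sup>2 * (exp (l n * b n) - 1) / 2 + l n * (\<delta> n + 3 * d n)) \<longlonglongrightarrow> 0"
    using tendsto_add[OF q1 q2] by (simp add: l_def ac_simps)
  then have q: "\<forall>\<^sub>F n in sequentially. (l n)\<^sup>2 * (exp (l n * b n) - 1) / 2 + l n * (\<delta> n + 3 * d n) < 1"
    by (rule order_tendstoD) simp
  show ?thesis
  proof (rule normal_tail_ratio_uniform[OF e e0 \<rho> \<rho>0 _ _ \<epsilon>])
    show "\<forall>\<^sub>F n in sequentially. \<forall>x. - A \<le> x \<and> x \<le> c * sqrt (ln (real n)) \<longrightarrow>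
      P n x \<le> normal_tail (x - (\<delta> n + 3 * d n)) + \<rho> n * exp (- (max x 0)\<^sup>2 / 2) \<and>
      normal_tail (x + (\<delta> n + 3 * d n)) - \<rho> n * exp (- (max x 0)\<^sup>2 / 2) \<le> P n x"
      using Y P \<tau> ln1 ls lb q \<delta>(2) e0 eventually_gt_at_top[of 0]
    proof eventually_elim
      case (elim n)
      show ?case
      proof (intro allI impI)
        fix x assume x: "- A \<le> x \<and> x \<le> c * sqrt (ln (real n))"
        define z where "z = max x 0"
        have z: "0 \<le> z" "z \<le> l n" using x c elim(4) by (auto simp: z_def l_def)
        have b0: "0 \<le> b n" using \<eta> by (simp add: b_def)
        have d0: "0 < d n" using elim(4) by (simp add: d_def)
        have "exp (z * b n) \<le> exp (l n * b n)" using z b0 by (simp add: mult_right_mono)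
        then have zb: "exp (z * b n) \<le> exp (l n * b n)" "exp (z * b n) \<le> exp 1" "1 \<le> exp (z * b n)"
          using elim(6) z b0 by auto
        have Nn: "N n = distr M borel (Y n 1)" using elim(1,10) by force
        have Y1: "Y n 1 \<in> borel_measurable M" using elim(1,10) unfolding indep_vars_def by auto
        have N: "prob_space (N n)" "sets (N n) = sets borel"
          unfolding Nn by (rule prob_space_distr[OF Y1]) simp
        define E where "E y = 2 / d n ^ 3 * exp (z\<^sup>2 * exp (z * b n) / 2 - z * (y - 3 * d n)) * (b n * exp (z * b n) + 12 * exp 2 / sqrt n)" for y
        have app: "\<P>(\<omega> in M. (\<Sum>i\<in>{1..n}. Y n i \<omega>) > y) \<le> normal_tail (y - 3 * d n) + E y"
          "\<P>(\<omega> in M. (\<Sum>i\<in>{1..n}. Y n i \<omega>) > y) \<ge> normal_tail (y + 3 * d n) - E y" for y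
          unfolding E_def
          by (rule normal_tail_approx[of "{1..n}" n "Y n" "N n"]; use elim N z d0 in \<open>auto simp: b_def\<close>)+
        have E: "E y + \<tau> n \<le> \<rho> n * exp (- z\<^sup>2 / 2)" if y: "x - \<delta> n \<le> y" for y
        proof -
          \<comment> \<open>This holds for negative x too, since then z = 0.\<close>
          have zx: "z * x = z\<^sup>2" by (simp add: z_def power2_eq_square max_def)
          have "z * (x - \<delta> n - 3 * d n) \<le> z * (y - 3 * d n)"
            using y z by (intro mult_left_mono) auto
          then have "z\<^sup>2 * exp (z * b n) / 2 - z * (y - 3 * d n) \<le>
              - z\<^sup>2 / 2 + (z\<^sup>2 * (exp (z * b n) - 1) / 2 + z * (\<delta> n + 3 * d n))"
            using zx by (simp add: field_simps)
          also have "z\<^sup>2 * (exp (z * b n) - 1) / 2 + z * (\<delta> n + 3 * d n) \<le>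
             (l n)\<^sup>2 * (exp (l n * b n) - 1) / 2 + l n * (\<delta> n + 3 * d n)"
            using z zb elim(9) d0 by (intro add_mono divide_right_mono mult_mono power_mono) auto
          also have "\<dots> \<le> 1" using elim(7) by simp
          finally have "exp (z\<^sup>2 * exp (z * b n) / 2 - z * (y - 3 * d n)) \<le> exp 1 * exp (- z\<^sup>2 / 2)"
            by (simp add: exp_add[symmetric])
          then have "E y \<le> 2 / d n ^ 3 * (exp 1 * exp (- z\<^sup>2 / 2)) * (b n * exp 1 + 12 * exp 2 / sqrt n)"
            unfolding E_def using zb b0 d0 by (intro mult_mono add_mono order_refl) auto
          \<comment> \<open>On the range exp(-z^2/2) is at least n to the power -c^2/2; the
            additional factor 1/n in the assumption on \<open>\<tau>\<close> is what remains as
            relative error.\<close>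
          moreover have "\<tau> n \<le> real n powr - 1 * exp (- z\<^sup>2 / 2)"
          proof -
            have "z\<^sup>2 \<le> (l n)\<^sup>2" using z by (intro power_mono)
            also have "\<dots> = c\<^sup>2 * ln n" using elim(4) by (simp add: l_def power_mult_distrib)
            finally have "exp (- (c\<^sup>2 * ln n) / 2) \<le> exp (- z\<^sup>2 / 2)" by simp
            then have "real n powr - 1 * exp (- (c\<^sup>2 * ln n) / 2) \<le> real n powr - 1 * exp (- z\<^sup>2 / 2)"
              by (intro mult_left_mono) auto
            moreover have "real n powr - 1 * exp (- (c\<^sup>2 * ln n) / 2) = real n powr (- c\<^sup>2 / 2 - 1)"
              using elim(10) by (simp add: powr_def exp_add[symmetric] algebra_simps)
            ultimately show ?thesis using elim(3) by linarith
          qed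
          ultimately have "E y + \<tau> n \<le> 2 / d n ^ 3 * (exp 1 * exp (- z\<^sup>2 / 2)) * (b n * exp 1 + 12 * exp 2 / sqrt n) +
              real n powr - 1 * exp (- z\<^sup>2 / 2)"
            by linarith
          also have "\<dots> = \<rho> n * exp (- z\<^sup>2 / 2)"
            unfolding \<rho>_def distrib_right[of _ _ "exp (- z\<^sup>2 / 2)"] by (simp only: mult_ac)
          finally show ?thesis .
        qed
        have "P n x \<le> normal_tail (x - \<delta> n - 3 * d n) + (E (x - \<delta> n) + \<tau> n)"
          using app(1)[of "x - \<delta> n"] elim(2) x by fastforce
        moreover have "normal_tail (x + \<delta> n + 3 * d n) - (E (x + \<delta> n) + \<tau> n) \<le> P n x"
          using app(2)[of "x + \<delta> n"] elim(2) x by fastforce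
        ultimately show "P n x \<le> normal_tail (x - (\<delta> n + 3 * d n)) + \<rho> n * exp (- (max x 0)\<^sup>2 / 2) \<and>
          normal_tail (x + (\<delta> n + 3 * d n)) - \<rho> n * exp (- (max x 0)\<^sup>2 / 2) \<le> P n x"
          using E[of "x - \<delta> n"] E[of "x + \<delta> n"] elim(8) by (simp add: z_def algebra_simps)
      qed
    qed
  qed (use c in simp)
qed

section \<open>Trimmed sums of an ordered sequence\<close>

text \<open>Winsorization between real endpoints. \<open>winsorize\<close> reduces to it at interior
  levels, where the quantiles are finite.\<close>

definition clip :: "real \<Rightarrow> real \<Rightarrow> real \<Rightarrow> real" where
  "clip a b y = (if y \<le> a then a else if y \<le> b then y else b)"

lemma sum_le_card_mult:
  fixes f :: "'i \<Rightarrow> real"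
  assumes "finite J" "\<And>j. j \<in> J \<Longrightarrow> f j \<le> (if Q j then B else 0)"
  shows "sum f J \<le> real (card {j \<in> J. Q j}) * B"
proof -
  have "sum f J \<le> (\<Sum>j\<in>J. if Q j then B else 0)" by (intro sum_mono assms)
  also have "\<dots> = real (card {j \<in> J. Q j}) * B"
    using assms(1) by (subst sum.inter_filter[symmetric]) auto
  finally show ?thesis .
qed

text \<open>In a sorted sequence the entries at most \<open>a\<close> fill an initial segment. If it
  stops short of \<open>k\<close>, the first \<open>k\<close> positions contain exactly the missing
  number of larger entries; otherwise they contain none. The second bound is the analogous overshoot
  of the entries below \<open>a\<close>. One count is weak and the other strict, so that entries
  tied at \<open>a\<close> are never charged.\<close>

lemma card_below_le:
  fixes y :: "nat \<Rightarrow> real"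
  assumes y: "\<And>i j. i \<le> j \<Longrightarrow> j < n \<Longrightarrow> y i \<le> y j" and kn: "k \<le> n"
  shows "real (card {j \<in> {..<k}. a < y j}) \<le> max (real k - real (card {j \<in> {..<n}. y j \<le> a})) 0"
    and "real (card {j \<in> {k..<n}. y j < a}) \<le> max (real (card {j \<in> {..<n}. y j < a}) - real k) 0"
proof -
  show "real (card {j \<in> {..<k}. a < y j}) \<le> max (real k - real (card {j \<in> {..<n}. y j \<le> a})) 0"
  proof (cases "\<exists>i<k. a < y i")
    case True
    then obtain i where i: "i < k" "a < y i" by auto
    have "j < k" if "j < n" "y j \<le> a" for j
      using i y[of i j] that by (cases "i \<le> j") auto
    then have "{j \<in> {..<n}. y j \<le> a} = {..<k} - {j \<in> {..<k}. a < y j}" using kn by fastforce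
    then have "card {j \<in> {..<n}. y j \<le> a} = card {..<k} - card {j \<in> {..<k}. a < y j}"
      by (simp only:) (rule card_Diff_subset; auto)
    moreover have "card {j \<in> {..<k}. a < y j} \<le> card {..<k}" by (intro card_mono) auto
    ultimately show ?thesis by simp
  next
    case False
    then have "{j \<in> {..<k}. a < y j} = {}" by auto
    then show ?thesis by (simp only: card.empty; simp)
  qed
  show "real (card {j \<in> {k..<n}. y j < a}) \<le> max (real (card {j \<in> {..<n}. y j < a}) - real k) 0"
  proof (cases "\<exists>i\<in>{k..<n}. y i < a")
    case True
    then obtain i where i: "k \<le> i" "i < n" "y i < a" by auto
    have "y j < a" if "j < k" for j
      using i y[of j i] that by simp
    then have "{..<k} \<union> {j \<in> {k..<n}. y j < a} \<subseteq> {j \<in> {..<n}. y j < a}"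
      using kn by auto
    then have "card ({..<k} \<union> {j \<in> {k..<n}. y j < a}) \<le> card {j \<in> {..<n}. y j < a}"
      by (intro card_mono) auto
    also have "card ({..<k} \<union> {j \<in> {k..<n}. y j < a}) = card {..<k} + card {j \<in> {k..<n}. y j < a}"
      by (rule card_Un_disjoint) auto
    finally show ?thesis by simp
  next
    case False
    then have "{j \<in> {k..<n}. y j < a} = {}" by auto
    then show ?thesis by (simp only: card.empty; simp)
  qed
qed

lemma card_reflect: "card {j \<in> {..<n}. Q (n - 1 - j)} = card {j \<in> {..<n::nat}. Q j}"
  by (rule bij_betw_same_card[of "\<lambda>j. n - 1 - j"], rule bij_betwI[of _ _ _ "\<lambda>j. n - 1 - j"]) auto

text \<open>Negating and reversing the sequence keeps it sorted and exchanges its two ends.\<close>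

lemma card_above_le:
  fixes y :: "nat \<Rightarrow> real"
  assumes y: "\<And>i j. i \<le> j \<Longrightarrow> j < n \<Longrightarrow> y i \<le> y j" and mn: "m \<le> n"
  shows "real (card {j \<in> {n - m..<n}. y j < b}) \<le> max (real m - real (card {j \<in> {..<n}. b \<le> y j})) 0"
    and "real (card {j \<in> {..<n - m}. b < y j}) \<le> max (real (card {j \<in> {..<n}. b < y j}) - real m) 0"
proof -
  define y' where "y' j = - y (n - 1 - j)" for j
  have y': "y' i \<le> y' j" if "i \<le> j" "j < n" for i j
    using y[of "n - 1 - j" "n - 1 - i"] that by (simp add: y'_def)
  have "card {j \<in> {n - m..<n}. y j < b} = card {j \<in> {..<m}. - b < y' j}"
    using mn by (intro bij_betw_same_card[of "\<lambda>j. n - 1 - j"], intro bij_betwI[of _ _ _ "\<lambda>j. n - 1 - j"])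
      (auto simp: y'_def)
  moreover have "card {j \<in> {..<n - m}. b < y j} = card {j \<in> {m..<n}. y' j < - b}"
    using mn by (intro bij_betw_same_card[of "\<lambda>j. n - 1 - j"], intro bij_betwI[of _ _ _ "\<lambda>j. n - 1 - j"])
      (auto simp: y'_def)
  ultimately show
    "real (card {j \<in> {n - m..<n}. y j < b}) \<le> max (real m - real (card {j \<in> {..<n}. b \<le> y j})) 0"
    "real (card {j \<in> {..<n - m}. b < y j}) \<le> max (real (card {j \<in> {..<n}. b < y j}) - real m) 0"
    using card_below_le[of n y' m "- b", OF y' mn] card_reflect[of n "\<lambda>j. b \<le> y j"] card_reflect[of n "\<lambda>j. b < y j"]
    by (simp_all add: y'_def)
qed

text \<open>The two sums differ only through positions on the wrong side of a cut. Their number is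
  the deviation of a count from its target, and by monotonicity the entry at such a position lies
  between the cut value and the order statistic next to the cut, which bounds its
  contribution.\<close>

lemma trimmed_sum_winsorized:
  fixes y :: "nat \<Rightarrow> real"
  assumes y: "\<And>i j. i \<le> j \<Longrightarrow> j < n \<Longrightarrow> y i \<le> y j" and ab: "a \<le> b"
    and km: "1 \<le> k" "1 \<le> m" "k + m < n"
  shows "\<bar>(\<Sum>j\<in>{k..<n - m}. y j) - ((\<Sum>j<n. clip a b (y j)) - k * a - m * b)\<bar> \<le>
    (max (real k - card {j \<in> {..<n}. y j \<le> a}) 0 + max (real (card {j \<in> {..<n}. y j < a}) - k) 0) *
      (2 * \<bar>a\<bar> + \<bar>y (k - 1)\<bar> + \<bar>y k\<bar>) +
    (max (real m - card {j \<in> {..<n}. b \<le> y j}) 0 + max (real (card {j \<in> {..<n}. b < y j}) - m) 0) *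
      (2 * \<bar>b\<bar> + \<bar>y (n - m - 1)\<bar> + \<bar>y (n - m)\<bar>)"
    (is "\<bar>?R\<bar> \<le> (?D1 + ?D2) * ?A + (?D3 + ?D4) * ?B")
proof -
  define D1 D2 D3 D4 A B where D_def: "D1 = ?D1" "D2 = ?D2" "D3 = ?D3" "D4 = ?D4" and AB_def: "A = ?A" "B = ?B"
  have D1: "real (card {j \<in> {..<k}. a < y j}) \<le> D1" and D2: "real (card {j \<in> {k..<n}. y j < a}) \<le> D2"
    unfolding D_def by (rule card_below_le; use y km in auto)+
  have D3: "real (card {j \<in> {n - m..<n}. y j < b}) \<le> D3" and D4: "real (card {j \<in> {..<n - m}. b < y j}) \<le> D4"
    unfolding D_def by (rule card_above_le; use y km in auto)+
  have D0: "0 \<le> D1" "0 \<le> D2" "0 \<le> D3" "0 \<le> D4" "0 \<le> A" "0 \<le> B" by (auto simp: D_def AB_def)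
  have A: "\<bar>a\<bar> + \<bar>y (k - 1)\<bar> \<le> A" "\<bar>a\<bar> + \<bar>y k\<bar> \<le> A" by (simp_all add: AB_def)
  have B: "\<bar>b\<bar> + \<bar>y (n - m - 1)\<bar> \<le> B" "\<bar>b\<bar> + \<bar>y (n - m)\<bar> \<le> B" by (simp_all add: AB_def)
  \<comment> \<open>\<open>L\<close> and \<open>U\<close> collect the amounts by which clipped
    entries in the trimmed blocks miss \<open>a\<close> and \<open>b\<close>, and \<open>C\<close>
    is the change that clipping makes inside the window. \<open>L\<close> and \<open>U\<close> are
    nonnegative; \<open>C\<close> may have either sign and is estimated from both sides.\<close>
  define L where "L = (\<Sum>j<k. clip a b (y j) - a)"
  define C where "C = (\<Sum>j\<in>{k..<n - m}. y j - clip a b (y j))"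
  define U where "U = (\<Sum>j\<in>{n - m..<n}. b - clip a b (y j))"
  have "(\<Sum>j<n. clip a b (y j)) = (\<Sum>j<k. clip a b (y j)) + (\<Sum>j\<in>{k..<n - m}. clip a b (y j)) +
      (\<Sum>j\<in>{n - m..<n}. clip a b (y j))"
    using km sum.atLeastLessThan_concat[of 0 k "n - m" "\<lambda>j. clip a b (y j)"]
      sum.atLeastLessThan_concat[of 0 "n - m" n "\<lambda>j. clip a b (y j)"] by (simp add: lessThan_atLeast0)
  then have R: "?R = C - L + U"
    unfolding L_def C_def U_def using km by (simp add: sum_subtractf)
  have L0: "0 \<le> L" "0 \<le> U"
    unfolding L_def U_def using ab by (auto intro!: sum_nonneg simp: clip_def)
  have "L \<le> real (card {j \<in> {..<k}. a < y j}) * (\<bar>a\<bar> + \<bar>y (k - 1)\<bar>)"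
    unfolding L_def
  proof (rule sum_le_card_mult)
    fix j assume "j \<in> {..<k}"
    then have "y j \<le> y (k - 1)" using km by (intro y) auto
    with ab show "clip a b (y j) - a \<le> (if a < y j then \<bar>a\<bar> + \<bar>y (k - 1)\<bar> else 0)"
      by (auto simp: clip_def)
  qed simp
  also have "\<dots> \<le> D1 * A"
    using D0 D1 A by (intro mult_mono) auto
  finally have L: "L \<le> D1 * A" .
  have "U \<le> real (card {j \<in> {n - m..<n}. y j < b}) * (\<bar>b\<bar> + \<bar>y (n - m)\<bar>)"
    unfolding U_def
  proof (rule sum_le_card_mult)
    fix j assume "j \<in> {n - m..<n}"
    with y[of "n - m" j] km ab show "b - clip a b (y j) \<le> (if y j < b then \<bar>b\<bar> + \<bar>y (n - m)\<bar> else 0)"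
      by (auto simp: clip_def)
  qed simp
  also have "\<dots> \<le> D3 * B"
    using D0 D3 B by (intro mult_mono) auto
  finally have U: "U \<le> D3 * B" .
  have "C \<le> real (card {j \<in> {k..<n - m}. b < y j}) * (\<bar>b\<bar> + \<bar>y (n - m - 1)\<bar>)"
    unfolding C_def
  proof (rule sum_le_card_mult)
    fix j assume "j \<in> {k..<n - m}"
    then have "y j \<le> y (n - m - 1)" using km by (intro y) auto
    with ab show "y j - clip a b (y j) \<le> (if b < y j then \<bar>b\<bar> + \<bar>y (n - m - 1)\<bar> else 0)"
      by (auto simp: clip_def)
  qed simp
  also have "\<dots> \<le> real (card {j \<in> {..<n - m}. b < y j}) * B"
    using B by (intro mult_mono of_nat_mono card_mono) auto
  also have "\<dots> \<le> D4 * B"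
    using D0 D4 by (intro mult_right_mono)
  finally have C1: "C \<le> D4 * B" .
  have "- C = (\<Sum>j\<in>{k..<n - m}. clip a b (y j) - y j)" unfolding C_def by (simp add: sum_negf[symmetric])
  also have "\<dots> \<le> real (card {j \<in> {k..<n - m}. y j < a}) * (\<bar>a\<bar> + \<bar>y k\<bar>)"
  proof (rule sum_le_card_mult)
    fix j assume "j \<in> {k..<n - m}"
    then have "y k \<le> y j" using km by (intro y) auto
    with ab show "clip a b (y j) - y j \<le> (if y j < a then \<bar>a\<bar> + \<bar>y k\<bar> else 0)"
      by (auto simp: clip_def)
  qed simp
  also have "\<dots> \<le> real (card {j \<in> {k..<n}. y j < a}) * A"
    using A by (intro mult_mono of_nat_mono card_mono) auto
  also have "\<dots> \<le> D2 * A"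
    using D0 D2 by (intro mult_right_mono)
  finally have C2: "- C \<le> D2 * A" .
  have n: "0 \<le> D1 * A" "0 \<le> D2 * A" "0 \<le> D3 * B" "0 \<le> D4 * B" by (intro mult_nonneg_nonneg D0)+
  have "\<bar>C - L + U\<bar> \<le> (D1 + D2) * A + (D3 + D4) * B"
    unfolding distrib_right using L0 L U C1 C2 n by linarith
  then show ?thesis unfolding R D_def AB_def .
qed

text \<open>If the entry is not positive, all entries before it are at least as large in absolute
  value; if it is positive, all entries after it are. The rank conditions guarantee \<open>k\<close>
  entries on either side, so moments or counts of the whole sample control a single order
  statistic.\<close>

lemma order_stat_extreme:
  fixes y :: "nat \<Rightarrow> real"
  assumes y: "\<And>i j. i \<le> j \<Longrightarrow> j < n \<Longrightarrow> y i \<le> y j" and j: "j < n" "k \<le> j + 1" "k + j \<le> n"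
  obtains J where "J \<subseteq> {..<n}" "k \<le> card J" "\<And>i. i \<in> J \<Longrightarrow> \<bar>y j\<bar> \<le> \<bar>y i\<bar>"
proof (cases "y j \<le> 0")
  case True
  show ?thesis
  proof (rule that[of "{..j}"])
    fix i assume "i \<in> {..j}"
    then have "y i \<le> y j" using y[of i j] j(1) by simp
    with True show "\<bar>y j\<bar> \<le> \<bar>y i\<bar>" by simp
  qed (use j in auto)
next
  case False
  show ?thesis
  proof (rule that[of "{j..<n}"])
    fix i assume "i \<in> {j..<n}"
    then have "y j \<le> y i" using y[of j i] by simp
    with False show "\<bar>y j\<bar> \<le> \<bar>y i\<bar>" by simp
  qed (use j in auto)
qed

lemma sum_order_stat:
  "(\<Sum>i\<in>{1..n}. f (order_stat x n i)) = (\<Sum>i\<in>{1..n}. f (x i))"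
proof -
  define ys where "ys = sort (map x [1..<Suc n])"
  have len: "length ys = n" by (simp add: ys_def)
  have o: "order_stat x n i = ys ! (i - 1)" for i
    by (simp only: order_stat_def ys_def)
  have "(\<Sum>i\<in>{1..n}. f (order_stat x n i)) = (\<Sum>i<n. f (ys ! i))"
    by (rule sum.reindex_bij_witness[of _ Suc "\<lambda>i. i - 1"])
      (auto simp: o)
  also have "\<dots> = sum_list (map f ys)"
    using len by (simp add: sum_list_sum_nth atLeast0LessThan)
  also have "\<dots> = sum_list (map f (map x [1..<Suc n]))"
    unfolding ys_def by (metis mset_map mset_sort sum_mset_sum_list)
  also have "\<dots> = (\<Sum>i\<in>{1..n}. f (x i))"
    by (simp add: comp_def interv_sum_list_conv_sum_set_nat atLeastLessThanSuc_atLeastAtMost del: upt_Suc)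
  finally show ?thesis .
qed

lemma order_stat_mono: "1 \<le> i \<Longrightarrow> i \<le> j \<Longrightarrow> j \<le> n \<Longrightarrow> order_stat x n i \<le> order_stat x n j"
  unfolding order_stat_def by (intro sorted_nth_mono) auto

section \<open>Exponential moments of counts\<close>

text \<open>Since exp s \<ge> 1 + s + s^2/2, it suffices that the product of the two quadratics is
  at least 1, and all its terms beyond the 1 are nonnegative.\<close>

lemma exp_minus_le_one_minus_square: "0 \<le> s \<Longrightarrow> exp (- s) \<le> 1 - s + (s::real)\<^sup>2"
proof -
  assume s: "0 \<le> s"
  have "1 + s + s\<^sup>2 / 2 \<le> exp s" by (rule exp_lower_Taylor_quadratic[OF s])
  moreover have "1 \<le> (1 - s + s\<^sup>2) * (1 + s + s\<^sup>2 / 2)"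
  proof -
    have "(1 - s + s\<^sup>2) * (1 + s + s\<^sup>2 / 2) = 1 + s\<^sup>2 / 2 + s ^ 3 / 2 + (s\<^sup>2)\<^sup>2 / 2"
      by (simp add: field_simps power2_eq_square power3_eq_cube)
    then show ?thesis using s by simp
  qed
  moreover have "0 \<le> 1 - s + s\<^sup>2"
  proof -
    have "1 - s + s\<^sup>2 = (s - 1 / 2)\<^sup>2 + 3 / 4" by (simp add: algebra_simps power2_eq_square)
    then show ?thesis by simp
  qed
  ultimately have "1 \<le> (1 - s + s\<^sup>2) * exp s"
    by (meson mult_left_mono order_trans)
  then show "exp (- s) \<le> 1 - s + s\<^sup>2"
    by (simp add: exp_minus field_simps)
qed

text \<open>The function y^r exp(-y) is largest at y = r; accordingly ln t \<le> t - 1 is used at t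
  = y/r, and a factor exp(-r) is given away.\<close>

lemma powr_le_exp:
  assumes "0 \<le> y" "0 < r"
  shows "y powr r \<le> r powr r * exp (y::real)"
proof (cases "y = 0")
  case False
  have "ln (y / r) \<le> y / r - 1" using False assms by (intro ln_le_minus_one) auto
  then have "r * ln (y / r) \<le> r * (y / r - 1)" using assms by (intro mult_left_mono) auto
  then have "r * ln y \<le> r * ln r + y" using False assms by (simp add: ln_div algebra_simps)
  then have "exp (r * ln y) \<le> exp (r * ln r + y)" by simp
  then show ?thesis using False assms by (simp add: powr_def exp_add)
qed simp

text \<open>Young's inequality for y^2 and u^2 with the conjugate exponents p/(p - 2) and p/2,
  without the constants: the threshold on u is where the two right-hand terms are equal.\<close>

lemma square_mult_le_powr:
  fixes y u p :: real
  assumes "0 \<le> y" "0 \<le> u" "2 < p"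
  shows "(y * u)\<^sup>2 \<le> y powr (2 * p / (p - 2)) + u powr p"
proof (cases "y = 0 \<or> u = 0")
  case False
  then have pos: "0 < y" "0 < u" using assms by auto
  have h: "(z * z powr q)\<^sup>2 = z powr (2 * (1 + q))" if "0 < z" for z q :: real
  proof -
    have "z * z powr q = z powr (1 + q)" using that by (simp add: powr_add)
    then show ?thesis using that by (simp add: powr_power mult.commute)
  qed
  show ?thesis
  proof (cases "u \<le> y powr (2 / (p - 2))")
    case True
    then have "(y * u)\<^sup>2 \<le> (y * y powr (2 / (p - 2)))\<^sup>2" using pos by (intro power_mono mult_left_mono) auto
    also have "\<dots> = y powr (2 * (1 + 2 / (p - 2)))"
      by (rule h[OF pos(1)])
    also have "2 * (1 + 2 / (p - 2)) = 2 * p / (p - 2)" using assms by (simp add: field_simps)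
    finally show ?thesis by (rule order_trans) simp
  next
    case False
    then have "(y powr (2 / (p - 2))) powr ((p - 2) / 2) \<le> u powr ((p - 2) / 2)"
      using assms by (intro powr_mono2) auto
    moreover have "2 / (p - 2) * ((p - 2) / 2) = 1" using assms by simp
    ultimately have "y \<le> u powr ((p - 2) / 2)" using pos by (simp only: powr_powr powr_one)
    then have "(y * u)\<^sup>2 \<le> (u powr ((p - 2) / 2) * u)\<^sup>2" using pos by (intro power_mono mult_right_mono) auto
    also have "\<dots> = u powr (2 * (1 + (p - 2) / 2))"
      using h[OF pos(2)] by (simp add: mult.commute)
    also have "2 * (1 + (p - 2) / 2) = p" by (simp add: field_simps)
    finally show ?thesis by (rule order_trans) simp
  qed
qed auto

context prob_space
begin

text \<open>Counts of Poisson type satisfy such a quadratic bound only for bounded s, hence the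
  range up to 1. The condition is one-sided: upper and lower deviations of a count are treated as
  two variables. In the applications \<kappa> is the target value of the count.\<close>

definition subexponential :: "('a \<Rightarrow> real) \<Rightarrow> real \<Rightarrow> bool" where
  "subexponential D \<kappa> \<longleftrightarrow> D \<in> borel_measurable M \<and>
    (\<forall>s. 0 \<le> s \<and> s \<le> 1 \<longrightarrow> integrable M (\<lambda>\<omega>. exp (s * D \<omega>)) \<and> expectation (\<lambda>\<omega>. exp (s * D \<omega>)) \<le> exp (\<kappa> * s\<^sup>2))"

lemma subexponential_chernoff:
  assumes D: "subexponential D \<kappa>" and s: "0 < s" "s \<le> 1"
  shows "\<P>(\<omega> in M. D \<omega> \<ge> t) \<le> exp (\<kappa> * s\<^sup>2 - s * t)"
proof -
  have [measurable]: "D \<in> borel_measurable M" using D unfolding subexponential_def by blast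
  have i: "integrable M (\<lambda>\<omega>. exp (s * D \<omega>))" and e: "expectation (\<lambda>\<omega>. exp (s * D \<omega>)) \<le> exp (\<kappa> * s\<^sup>2)"
    using D s unfolding subexponential_def by auto
  have "\<P>(\<omega> in M. D \<omega> \<ge> t) = \<P>(\<omega> in M. exp (s * D \<omega>) \<ge> exp (s * t))"
    using s by simp
  also have "\<dots> \<le> expectation (\<lambda>\<omega>. exp (s * D \<omega>)) / exp (s * t)"
    by (rule integral_Markov_inequality_measure[where A = "{}"]) (use i in auto)
  also have "\<dots> \<le> exp (\<kappa> * s\<^sup>2) / exp (s * t)"
    by (intro divide_right_mono e) simp
  finally show ?thesis by (simp add: exp_diff)
qed

text \<open>For t = 2 L sqrt(\<kappa> g) the Chernoff exponent is minimised at s = t/(2 \<kappa>) =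
  L sqrt(g/\<kappa>), with value -L^2 g. The third condition on L says that this s is at most
  1.\<close>

lemma subexponential_tail:
  assumes D: "subexponential D \<kappa>" and L: "0 < L" "0 < g" "L\<^sup>2 * g \<le> \<kappa>"
  shows "\<P>(\<omega> in M. D \<omega> \<ge> 2 * L * sqrt (\<kappa> * g)) \<le> exp (- (L\<^sup>2 * g))"
proof -
  have k: "0 < \<kappa>" using L by (meson less_le_trans mult_pos_pos zero_less_power)
  define s where "s = L * sqrt (g / \<kappa>)"
  have s0: "0 < s" using L k by (simp add: s_def)
  have s2: "s\<^sup>2 = L\<^sup>2 * g / \<kappa>" using L k by (simp add: s_def power_mult_distrib)
  then have "s\<^sup>2 \<le> 1" using L k by simp
  then have s1: "s \<le> 1" using s0 by (simp add: power_le_one_iff)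
  have "sqrt (g / \<kappa>) * sqrt (\<kappa> * g) = g"
    using L k by (simp add: real_sqrt_mult[symmetric])
  then have st: "s * (2 * L * sqrt (\<kappa> * g)) = 2 * (L\<^sup>2 * g)"
    by (simp add: s_def power2_eq_square mult.left_commute mult.assoc)
  have "\<kappa> * s\<^sup>2 = L\<^sup>2 * g" using s2 k by simp
  with st have "\<kappa> * s\<^sup>2 - s * (2 * L * sqrt (\<kappa> * g)) = - (L\<^sup>2 * g)" by simp
  with subexponential_chernoff[OF D s0 s1, of "2 * L * sqrt (\<kappa> * g)"] show ?thesis by (simp only:)
qed

text \<open>The choice s = 1/sqrt \<kappa> is admissible for \<kappa> \<ge> 1 and makes \<kappa> s^2
  = 1. Passing to the positive part adds at most 1.\<close>

lemma subexponential_exp_moment: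
  assumes D: "subexponential D \<kappa>" and k: "1 \<le> \<kappa>"
  shows "integrable M (\<lambda>\<omega>. exp (max (D \<omega>) 0 / sqrt \<kappa>))"
    "expectation (\<lambda>\<omega>. exp (max (D \<omega>) 0 / sqrt \<kappa>)) \<le> 1 + exp 1"
proof -
  have [measurable]: "D \<in> borel_measurable M" using D unfolding subexponential_def by blast
  define s where "s = 1 / sqrt \<kappa>"
  have s: "0 \<le> s" "s \<le> 1" "\<kappa> * s\<^sup>2 = 1" using k by (auto simp: s_def power_divide real_le_rsqrt)
  have i: "integrable M (\<lambda>\<omega>. exp (s * D \<omega>))" and e: "expectation (\<lambda>\<omega>. exp (s * D \<omega>)) \<le> exp 1"
    using D s unfolding subexponential_def by force+
  have le: "exp (max (D \<omega>) 0 / sqrt \<kappa>) \<le> 1 + exp (s * D \<omega>)" for \<omega>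
    by (auto simp: max_def s_def)
  show i2: "integrable M (\<lambda>\<omega>. exp (max (D \<omega>) 0 / sqrt \<kappa>))"
    by (rule Bochner_Integration.integrable_bound[where f = "\<lambda>\<omega>. 1 + exp (s * D \<omega>)"])
      (use i le in \<open>auto intro!: AE_I2 simp: abs_of_pos add_pos_pos\<close>)
  have "expectation (\<lambda>\<omega>. exp (max (D \<omega>) 0 / sqrt \<kappa>)) \<le> expectation (\<lambda>\<omega>. 1 + exp (s * D \<omega>))"
    using i i2 le by (intro integral_mono) auto
  also have "\<dots> \<le> 1 + exp 1" using i e by (simp add: prob_space)
  finally show "expectation (\<lambda>\<omega>. exp (max (D \<omega>) 0 / sqrt \<kappa>)) \<le> 1 + exp 1" .
qed

text \<open>The count deviation and the order statistics are dependent, so the mean square of the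
  product does not factor. After division of D by sqrt \<kappa> and of A by \<alpha> to the power
  -1/p, Young's inequality separates them: D has exponential moments and can afford the high power
  r, while A only needs its p-th moment.\<close>

lemma subexponential_product_moment:
  assumes D: "subexponential D \<kappa>" and k: "1 \<le> \<kappa>" and p: "2 < p" and \<alpha>: "0 < \<alpha>"
    and A: "A \<in> borel_measurable M" "\<And>\<omega>. \<omega> \<in> space M \<Longrightarrow> 0 \<le> A \<omega>"
      "integrable M (\<lambda>\<omega>. A \<omega> powr p)" "expectation (\<lambda>\<omega>. A \<omega> powr p) \<le> B / \<alpha>"
  defines "r \<equiv> 2 * p / (p - 2)"
  shows "integrable M (\<lambda>\<omega>. (max (D \<omega>) 0 * A \<omega>)\<^sup>2)"
    "expectation (\<lambda>\<omega>. (max (D \<omega>) 0 * A \<omega>)\<^sup>2) \<le> \<kappa> * \<alpha> powr (- 2 / p) * (r powr r * (1 + exp 1) + B)"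
proof -
  have [measurable]: "D \<in> borel_measurable M" using D unfolding subexponential_def by blast
  note A(1)[measurable]
  have r0: "0 < r" using p by (simp add: r_def)
  define c where "c = \<kappa> * \<alpha> powr (- 2 / p)"
  have c0: "0 < c" using k \<alpha> by (simp add: c_def)
  define U where "U \<omega> = c * (r powr r * exp (max (D \<omega>) 0 / sqrt \<kappa>) + \<alpha> * A \<omega> powr p)" for \<omega>
  have le: "(max (D \<omega>) 0 * A \<omega>)\<^sup>2 \<le> U \<omega>" if \<omega>: "\<omega> \<in> space M" for \<omega>
  proof -
    define y where "y = max (D \<omega>) 0 / sqrt \<kappa>"
    define u where "u = \<alpha> powr (1 / p) * A \<omega>"
    have y: "0 \<le> y" "max (D \<omega>) 0 = sqrt \<kappa> * y" using k by (auto simp: y_def)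
    have u: "0 \<le> u" "A \<omega> = \<alpha> powr (- 1 / p) * u" "u powr p = \<alpha> * A \<omega> powr p"
      using \<alpha> p A(2)[OF \<omega>] by (auto simp: u_def powr_mult powr_powr powr_add[symmetric] simp flip: mult.assoc)
    have "(\<alpha> powr (- 1 / p))\<^sup>2 = \<alpha> powr (- 2 / p)"
      using \<alpha> by (simp add: powr_power)
    then have "(max (D \<omega>) 0 * A \<omega>)\<^sup>2 = c * (y * u)\<^sup>2"
      unfolding y(2) u(2) using k by (simp add: c_def power_mult_distrib)
    also have "\<dots> \<le> c * (y powr r + u powr p)"
      using square_mult_le_powr[OF y(1) u(1) p] c0 unfolding r_def by (intro mult_left_mono) auto
    also have "\<dots> \<le> c * (r powr r * exp y + u powr p)"
      using powr_le_exp[OF y(1) r0] c0 by (intro mult_left_mono add_right_mono) auto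
    finally show ?thesis unfolding U_def u(3) y_def .
  qed
  have U: "integrable M U"
    unfolding U_def using subexponential_exp_moment(1)[OF D k] A(3) by auto
  show i: "integrable M (\<lambda>\<omega>. (max (D \<omega>) 0 * A \<omega>)\<^sup>2)"
    by (rule Bochner_Integration.integrable_bound[OF U]) (use le in \<open>auto intro!: AE_I2 order_trans[OF le abs_ge_self]\<close>)
  have "expectation (\<lambda>\<omega>. (max (D \<omega>) 0 * A \<omega>)\<^sup>2) \<le> expectation U"
    using i U le by (intro integral_mono) auto
  also have "\<dots> = c * (r powr r * expectation (\<lambda>\<omega>. exp (max (D \<omega>) 0 / sqrt \<kappa>)) + \<alpha> * expectation (\<lambda>\<omega>. A \<omega> powr p))"
    unfolding U_def using subexponential_exp_moment(1)[OF D k] A(3) by simp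
  also have "\<dots> \<le> c * (r powr r * (1 + exp 1) + \<alpha> * (B / \<alpha>))"
    using subexponential_exp_moment(2)[OF D k] A(4) c0 \<alpha> by (intro mult_left_mono add_mono) auto
  finally show "expectation (\<lambda>\<omega>. (max (D \<omega>) 0 * A \<omega>)\<^sup>2) \<le> \<kappa> * \<alpha> powr (- 2 / p) * (r powr r * (1 + exp 1) + B)"
    using \<alpha> by (simp add: c_def)
qed

end

section \<open>An i.i.d. sample and the number of its members in a Borel set\<close>

locale iid_sample = prob_space M for M :: "'a measure" +
  fixes X :: "nat \<Rightarrow> 'a \<Rightarrow> real"
  assumes indep: "indep_vars (\<lambda>_. borel) X {1..}"
    and ident: "\<And>i. i \<ge> 1 \<Longrightarrow> distr M borel (X i) = distr M borel (X 1)"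
begin

abbreviation law :: "real measure" where "law \<equiv> distr M borel (X 1)"

lemma X_measurable: "1 \<le> i \<Longrightarrow> X i \<in> borel_measurable M"
  using indep unfolding indep_vars_def by auto

lemma prob_space_law: "prob_space law"
  by (rule prob_space_distr) (simp add: X_measurable)

sublocale law: prob_space law
  by (rule prob_space_law)

lemma expectation_eq_law:
  fixes f :: "real \<Rightarrow> real"
  assumes "1 \<le> i" "f \<in> borel_measurable borel"
  shows "expectation (\<lambda>\<omega>. f (X i \<omega>)) = (\<integral>x. f x \<partial>law)"
    "integrable M (\<lambda>\<omega>. f (X i \<omega>)) \<longleftrightarrow> integrable law f"
  using assms X_measurable[of i] ident[of i]
    integral_distr[of "X i" M borel f] integrable_distr_eq[of "X i" M borel f] by simp_all

lemma indep_transformed: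
  assumes "\<And>i. f i \<in> borel_measurable borel" "J \<subseteq> {1..}"
  shows "indep_vars (\<lambda>_. borel) (\<lambda>i \<omega>. f i (X i \<omega>) :: real) J"
  by (rule indep_vars_compose2[OF indep_vars_subset[OF indep assms(2)]]) (simp add: assms(1))

definition hits :: "nat \<Rightarrow> real set \<Rightarrow> 'a \<Rightarrow> real" where
  "hits n B \<omega> = (\<Sum>i\<in>{1..n}. indicator B (X i \<omega>))"

lemma hits_measurable[measurable]: "B \<in> sets borel \<Longrightarrow> hits n B \<in> borel_measurable M"
  unfolding hits_def[abs_def] using X_measurable by (intro borel_measurable_sum) auto

text \<open>The generating function is that of a binomial count; the estimate 1 + t \<le> exp t
  replaces it by the Poisson one.\<close>

lemma exp_hits:
  assumes B: "B \<in> sets borel"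
  shows "integrable M (\<lambda>\<omega>. exp (s * hits n B \<omega>))"
    "expectation (\<lambda>\<omega>. exp (s * hits n B \<omega>)) \<le> exp (real n * measure law B * (exp s - 1))"
proof -
  define f where "f x = exp (s * indicator B x)" for x :: real
  have f[measurable]: "f \<in> borel_measurable borel" unfolding f_def using B by measurable
  have e: "exp (s * hits n B \<omega>) = (\<Prod>i\<in>{1..n}. f (X i \<omega>))" for \<omega>
    unfolding hits_def f_def sum_distrib_left by (rule exp_sum) simp
  have iI: "integrable law (indicator B :: real \<Rightarrow> real)"
    using B by (intro law.integrable_const_bound[where B = 1]) auto
  have fe: "f x = 1 + (exp s - 1) * indicator B x" for x by (simp add: f_def indicator_def)
  have il: "integrable law f" unfolding fe[abs_def]
    by (intro Bochner_Integration.integrable_add law.integrable_const integrable_mult_right iI)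
  have ef: "(\<integral>x. f x \<partial>law) = 1 + (exp s - 1) * measure law B"
  proof -
    have "(\<integral>x. f x \<partial>law) = (\<integral>x. 1 \<partial>law) + (\<integral>x. (exp s - 1) * indicator B x \<partial>law)"
      unfolding fe by (intro Bochner_Integration.integral_add law.integrable_const integrable_mult_right iI)
    then show ?thesis using law.prob_space by simp
  qed
  have ind: "indep_vars (\<lambda>_. borel) (\<lambda>i \<omega>. f (X i \<omega>)) {1..n}"
    by (rule indep_transformed) auto
  have iX: "integrable M (\<lambda>\<omega>. f (X i \<omega>))" if "i \<in> {1..n}" for i
    using expectation_eq_law(2)[of i f] that il by simp
  show "integrable M (\<lambda>\<omega>. exp (s * hits n B \<omega>))"
    unfolding e by (rule indep_vars_integrable[OF _ ind iX]) auto
  have "expectation (\<lambda>\<omega>. exp (s * hits n B \<omega>)) = (\<Prod>i\<in>{1..n}. expectation (\<lambda>\<omega>. f (X i \<omega>)))"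
    unfolding e by (rule indep_vars_lebesgue_integral[OF _ ind iX]) auto
  also have "\<dots> = (1 + (exp s - 1) * measure law B) ^ n"
    using expectation_eq_law(1)[of _ f] ef by simp
  also have "\<dots> \<le> exp ((exp s - 1) * measure law B) ^ n"
  proof (intro power_mono exp_ge_add_one_self)
    \<comment> \<open>Monotonicity of the power needs a nonnegative base, also for negative
      \<open>s\<close>. The base is the mean of a positive function.\<close>
    have "0 \<le> (\<integral>x. f x \<partial>law)" by (intro integral_nonneg_AE AE_I2) (simp add: f_def)
    then show "0 \<le> 1 + (exp s - 1) * measure law B" unfolding ef .
  qed
  finally show "expectation (\<lambda>\<omega>. exp (s * hits n B \<omega>)) \<le> exp (real n * measure law B * (exp s - 1))"
    by (simp add: exp_of_nat_mult[symmetric] ac_simps)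
qed

text \<open>Only an inequality between the mean of the count and \<kappa> is required, because an
  atom of the law at a quantile may keep the mean away from the target. For s \<ge> 0 the Poisson
  exponent increases with the mean, so \<kappa> may replace it, and exp s - 1 - s \<le> s^2 on
  [0, 1].\<close>

lemma subexponential_hits_upper:
  assumes B: "B \<in> sets borel" and q: "real n * measure law B \<le> \<kappa>"
  shows "subexponential (\<lambda>\<omega>. hits n B \<omega> - \<kappa>) \<kappa>"
  unfolding subexponential_def
proof (intro conjI allI impI)
  have k0: "0 \<le> \<kappa>" using q by (rule order_trans[rotated]) simp
  fix s :: real assume s: "0 \<le> s \<and> s \<le> 1"
  have e: "exp (s * (hits n B \<omega> - \<kappa>)) = exp (s * hits n B \<omega>) * exp (- (s * \<kappa>))" for \<omega>
    by (simp add: exp_add[symmetric] algebra_simps)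
  show "integrable M (\<lambda>\<omega>. exp (s * (hits n B \<omega> - \<kappa>)))"
    unfolding e using exp_hits(1)[OF B] by simp
  have "expectation (\<lambda>\<omega>. exp (s * (hits n B \<omega> - \<kappa>))) \<le> exp (real n * measure law B * (exp s - 1)) * exp (- (s * \<kappa>))"
    unfolding e using exp_hits(2)[OF B] by simp
  also have "\<dots> \<le> exp (\<kappa> * (exp s - 1)) * exp (- (s * \<kappa>))"
    using q s by (simp add: mult_right_mono)
  also have "\<dots> = exp (\<kappa> * (exp s - 1 - s))" by (simp add: exp_add[symmetric] algebra_simps)
  also have "\<dots> \<le> exp (\<kappa> * s\<^sup>2)"
    using exp_bound[of s] s k0 by (simp add: mult_left_mono)
  finally show "expectation (\<lambda>\<omega>. exp (s * (hits n B \<omega> - \<kappa>))) \<le> exp (\<kappa> * s\<^sup>2)" .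
qed (use B in measurable)

text \<open>Here exp(-s) - 1 is not positive, so the Poisson exponent decreases with the mean and
  the opposite inequality for the mean is the right one.\<close>

lemma subexponential_hits_lower:
  assumes B: "B \<in> sets borel" and q: "\<kappa> \<le> real n * measure law B" and k0: "0 \<le> \<kappa>"
  shows "subexponential (\<lambda>\<omega>. \<kappa> - hits n B \<omega>) \<kappa>"
  unfolding subexponential_def
proof (intro conjI allI impI)
  fix s :: real assume s: "0 \<le> s \<and> s \<le> 1"
  have e: "exp (s * (\<kappa> - hits n B \<omega>)) = exp ((- s) * hits n B \<omega>) * exp (s * \<kappa>)" for \<omega>
    by (simp add: exp_add[symmetric] algebra_simps)
  show "integrable M (\<lambda>\<omega>. exp (s * (\<kappa> - hits n B \<omega>)))"
    unfolding e using exp_hits(1)[OF B, of "- s"] by simp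
  have "expectation (\<lambda>\<omega>. exp (s * (\<kappa> - hits n B \<omega>))) \<le> exp (real n * measure law B * (exp (- s) - 1)) * exp (s * \<kappa>)"
    unfolding e integral_mult_left_zero by (intro mult_right_mono exp_hits(2)[OF B]) simp
  also have "\<dots> \<le> exp (\<kappa> * (exp (- s) - 1)) * exp (s * \<kappa>)"
    using q s by (simp add: mult_right_mono_neg)
  also have "\<dots> = exp (\<kappa> * (exp (- s) - 1 + s))" by (simp add: exp_add[symmetric] algebra_simps)
  also have "\<dots> \<le> exp (\<kappa> * s\<^sup>2)"
    using exp_minus_le_one_minus_square[of s] s k0 by (simp add: mult_left_mono)
  finally show "expectation (\<lambda>\<omega>. exp (s * (\<kappa> - hits n B \<omega>))) \<le> exp (\<kappa> * s\<^sup>2)" .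
qed (use B in measurable)

end

section \<open>Order statistics of a sample\<close>

lemma card_order_stat: "card {j \<in> {..<n}. Q (order_stat x n (Suc j))} = card {i \<in> {1..n}. Q (x i)}"
proof -
  have c: "card {i \<in> I. R i} = (\<Sum>i\<in>I. if R i then 1 else 0 :: nat)" if "finite I" for I :: "nat set" and R
    using that by (simp add: sum.If_cases Int_def conj_commute)
  have "card {j \<in> {..<n}. Q (order_stat x n (Suc j))} = (\<Sum>i\<in>{1..n}. if Q (order_stat x n i) then 1 else 0)"
    unfolding c[OF finite_lessThan]
    by (rule sum.reindex_bij_witness[of _ "\<lambda>i. i - 1" Suc]) auto
  also have "\<dots> = card {i \<in> {1..n}. Q (x i)}"
    unfolding c[OF finite_atLeastAtMost] by (rule sum_order_stat[of "\<lambda>v. if Q v then 1 else 0"])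
  finally show ?thesis .
qed

lemma order_stat_le_iff:
  assumes i: "1 \<le> i" "i \<le> n"
  shows "order_stat x n i \<le> t \<longleftrightarrow> i \<le> card {j \<in> {1..n}. x j \<le> t}"
proof -
  define J where "J = {j \<in> {..<n}. order_stat x n (Suc j) \<le> t}"
  have J: "card {j \<in> {1..n}. x j \<le> t} = card J"
    unfolding J_def by (rule card_order_stat[symmetric])
  show ?thesis
  proof
    assume t: "order_stat x n i \<le> t"
    have "order_stat x n (Suc j) \<le> t" if "j < i" for j
      using order_stat_mono[of "Suc j" i n x] that i t by simp
    then have "{..<i} \<subseteq> J" using i by (auto simp: J_def)
    then have "card {..<i} \<le> card J" by (intro card_mono) (auto simp: J_def)
    then show "i \<le> card {j \<in> {1..n}. x j \<le> t}" unfolding J by simp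
  next
    assume le: "i \<le> card {j \<in> {1..n}. x j \<le> t}"
    show "order_stat x n i \<le> t"
    proof (rule ccontr)
      assume nt: "\<not> order_stat x n i \<le> t"
      have "j < i - 1" if "j \<in> J" for j
      proof (rule ccontr)
        assume "\<not> j < i - 1"
        then have "order_stat x n i \<le> order_stat x n (Suc j)"
          using that i by (intro order_stat_mono) (auto simp: J_def)
        then show False using that nt by (auto simp: J_def)
      qed
      then have "card J \<le> card {..<i - 1}" by (intro card_mono) auto
      then show False using le[unfolded J] i by simp
    qed
  qed
qed

text \<open>Measurability is not read off from sorting: the i-th smallest value is at most
  \<open>t\<close> exactly when a count, which is a finite sum of measurable functions, reaches
  \<open>i\<close>.\<close>

lemma order_stat_measurable:
  assumes i: "1 \<le> i" "i \<le> n" and X: "\<And>j. 1 \<le> j \<Longrightarrow> X j \<in> borel_measurable M"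
  shows "(\<lambda>\<omega>. order_stat (\<lambda>j. X j \<omega>) n i) \<in> borel_measurable M"
proof (rule borel_measurable_iff_le[THEN iffD2], rule allI)
  fix t
  define C where "C \<omega> = (\<Sum>j\<in>{1..n}. if X j \<omega> \<le> t then 1 else 0 :: real)" for \<omega>
  have C: "C \<omega> = real (card {j \<in> {1..n}. X j \<omega> \<le> t})" for \<omega>
    by (simp add: C_def sum.If_cases Int_def conj_commute)
  have [measurable]: "C \<in> borel_measurable M"
    unfolding C_def[abs_def]
  proof (rule borel_measurable_sum)
    fix j assume "j \<in> {1..n}"
    then have [measurable]: "X j \<in> borel_measurable M" by (intro X) auto
    show "(\<lambda>\<omega>. if X j \<omega> \<le> t then 1 else 0) \<in> borel_measurable M" by measurable
  qed
  have "{\<omega> \<in> space M. order_stat (\<lambda>j. X j \<omega>) n i \<le> t} = {\<omega> \<in> space M. real i \<le> C \<omega>}"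
    unfolding C order_stat_le_iff[OF i] by simp
  also have "\<dots> \<in> sets M" by measurable
  finally show "{\<omega> \<in> space M. order_stat (\<lambda>j. X j \<omega>) n i \<le> t} \<in> sets M" .
qed

context iid_sample
begin

definition ostat :: "nat \<Rightarrow> nat \<Rightarrow> 'a \<Rightarrow> real" where
  "ostat n i \<omega> = order_stat (\<lambda>j. X j \<omega>) n i"

lemma ostat_measurable: "1 \<le> i \<Longrightarrow> i \<le> n \<Longrightarrow> ostat n i \<in> borel_measurable M"
  unfolding ostat_def[abs_def] by (rule order_stat_measurable) (auto simp: X_measurable)

lemma hits_card: "hits n B \<omega> = real (card {j \<in> {..<n}. ostat n (Suc j) \<omega> \<in> B})"
proof -
  have "hits n B \<omega> = real (card {i \<in> {1..n}. X i \<omega> \<in> B})"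
    by (simp add: hits_def indicator_def sum.If_cases Int_def conj_commute)
  then show ?thesis unfolding ostat_def card_order_stat[of n "\<lambda>v. v \<in> B"] .
qed

definition remainder :: "nat \<Rightarrow> nat \<Rightarrow> nat \<Rightarrow> real \<Rightarrow> real \<Rightarrow> 'a \<Rightarrow> real" where
  "remainder n k m a b \<omega> = (\<Sum>i\<in>{k + 1..n - m}. ostat n i \<omega>) -
    ((\<Sum>i\<in>{1..n}. clip a b (X i \<omega>)) - real k * a - real m * b)"

lemma remainder_measurable: "remainder n k m a b \<in> borel_measurable M"
proof -
  have [measurable]: "clip a b \<in> borel_measurable borel"
    unfolding clip_def[abs_def] by measurable
  have "(\<lambda>\<omega>. \<Sum>i\<in>{k + 1..n - m}. ostat n i \<omega>) \<in> borel_measurable M"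
    by (rule borel_measurable_sum) (auto intro: ostat_measurable)
  moreover have "(\<lambda>\<omega>. \<Sum>i\<in>{1..n}. clip a b (X i \<omega>)) \<in> borel_measurable M"
  proof (rule borel_measurable_sum)
    fix i assume "i \<in> {1..n}"
    then have [measurable]: "X i \<in> borel_measurable M" by (intro X_measurable) auto
    show "(\<lambda>\<omega>. clip a b (X i \<omega>)) \<in> borel_measurable M" by measurable
  qed
  ultimately show ?thesis
    unfolding remainder_def[abs_def] by (intro borel_measurable_diff borel_measurable_const)
qed

lemma remainder_bound:
  assumes ab: "a \<le> b" and km: "1 \<le> k" "1 \<le> m" "k + m < n"
  shows "\<bar>remainder n k m a b \<omega>\<bar> \<le>
    (max (real k - hits n {..a} \<omega>) 0 + max (hits n {..<a} \<omega> - real k) 0) *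
      (2 * \<bar>a\<bar> + \<bar>ostat n k \<omega>\<bar> + \<bar>ostat n (k + 1) \<omega>\<bar>) +
    (max (real m - hits n {b..} \<omega>) 0 + max (hits n {b<..} \<omega> - real m) 0) *
      (2 * \<bar>b\<bar> + \<bar>ostat n (n - m) \<omega>\<bar> + \<bar>ostat n (n - m + 1) \<omega>\<bar>)"
proof -
  define y where "y j = ostat n (Suc j) \<omega>" for j
  have mono: "y i \<le> y j" if "i \<le> j" "j < n" for i j
    unfolding y_def ostat_def using that by (intro order_stat_mono) auto
  have 1: "(\<Sum>j\<in>{k..<n - m}. y j) = (\<Sum>i\<in>{k + 1..n - m}. ostat n i \<omega>)"
    unfolding y_def by (rule sum.reindex_bij_witness[of _ "\<lambda>i. i - 1" Suc]) auto
  have "(\<Sum>j<n. clip a b (y j)) = (\<Sum>i\<in>{1..n}. clip a b (ostat n i \<omega>))"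
    unfolding y_def by (rule sum.reindex_bij_witness[of _ "\<lambda>i. i - 1" Suc]) auto
  also have "\<dots> = (\<Sum>i\<in>{1..n}. clip a b (X i \<omega>))"
    unfolding ostat_def by (rule sum_order_stat)
  finally have 2: "(\<Sum>j<n. clip a b (y j)) = (\<Sum>i\<in>{1..n}. clip a b (X i \<omega>))" .
  \<comment> \<open>Positions start at 0 and ranks at 1: the positions k - 1, k, n - m - 1, n - m
    next to the cuts carry ranks one higher.\<close>
  have 3: "y (k - 1) = ostat n k \<omega>" "y k = ostat n (k + 1) \<omega>" "y (n - m - 1) = ostat n (n - m) \<omega>"
    "y (n - m) = ostat n (n - m + 1) \<omega>"
    unfolding y_def using km Suc_diff_Suc[of m n] by simp_all
  have 4: "hits n {..a} \<omega> = card {j \<in> {..<n}. y j \<le> a}" "hits n {..<a} \<omega> = card {j \<in> {..<n}. y j < a}"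
    "hits n {b..} \<omega> = card {j \<in> {..<n}. b \<le> y j}" "hits n {b<..} \<omega> = card {j \<in> {..<n}. b < y j}"
    unfolding hits_card y_def by simp_all
  have "\<bar>(\<Sum>j\<in>{k..<n - m}. y j) - ((\<Sum>j<n. clip a b (y j)) - k * a - m * b)\<bar> \<le>
    (max (real k - card {j \<in> {..<n}. y j \<le> a}) 0 + max (real (card {j \<in> {..<n}. y j < a}) - k) 0) *
      (2 * \<bar>a\<bar> + \<bar>y (k - 1)\<bar> + \<bar>y k\<bar>) +
    (max (real m - card {j \<in> {..<n}. b \<le> y j}) 0 + max (real (card {j \<in> {..<n}. b < y j}) - m) 0) *
      (2 * \<bar>b\<bar> + \<bar>y (n - m - 1)\<bar> + \<bar>y (n - m)\<bar>)"
    by (rule trimmed_sum_winsorized[OF mono ab km])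
  then show ?thesis unfolding remainder_def 1[symmetric] 2[symmetric] 4 3 .
qed

lemma ostat_extreme:
  assumes j: "1 \<le> j" "k \<le> j" "k + j \<le> n + 1" "j \<le> n"
  obtains J where "J \<subseteq> {..<n}" "k \<le> card J" "\<And>i. i \<in> J \<Longrightarrow> \<bar>ostat n j \<omega>\<bar> \<le> \<bar>ostat n (Suc i) \<omega>\<bar>"
proof -
  have mono: "ostat n (Suc i) \<omega> \<le> ostat n (Suc l) \<omega>" if "i \<le> l" "l < n" for i l
    unfolding ostat_def using that by (intro order_stat_mono) auto
  have "Suc (j - 1) = j" using j by simp
  obtain J where "J \<subseteq> {..<n}" "k \<le> card J" "\<And>i. i \<in> J \<Longrightarrow> \<bar>ostat n (Suc (j - 1)) \<omega>\<bar> \<le> \<bar>ostat n (Suc i) \<omega>\<bar>"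
    by (rule order_stat_extreme[of n "\<lambda>i. ostat n (Suc i) \<omega>" "j - 1" k, OF mono]) (use j in auto)
  with \<open>Suc (j - 1) = j\<close> show thesis by (intro that) auto
qed

text \<open>A pathwise Markov inequality: at least \<open>k\<close> sample members are as large in
  absolute value as this order statistic, and each contributes its p-th power to the sum.\<close>

lemma ostat_powr_le:
  assumes j: "1 \<le> k" "k \<le> j" "k + j \<le> n + 1" "j \<le> n" and p: "0 < p"
  shows "real k * \<bar>ostat n j \<omega>\<bar> powr p \<le> (\<Sum>i\<in>{1..n}. \<bar>X i \<omega>\<bar> powr p)"
proof -
  obtain J where J: "J \<subseteq> {..<n}" "k \<le> card J" "\<And>i. i \<in> J \<Longrightarrow> \<bar>ostat n j \<omega>\<bar> \<le> \<bar>ostat n (Suc i) \<omega>\<bar>"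
    using ostat_extreme[of j k n \<omega>] j by auto
  have "real k * \<bar>ostat n j \<omega>\<bar> powr p \<le> real (card J) * \<bar>ostat n j \<omega>\<bar> powr p"
    using J by (intro mult_right_mono) auto
  also have "\<dots> = (\<Sum>i\<in>J. \<bar>ostat n j \<omega>\<bar> powr p)" by simp
  also have "\<dots> \<le> (\<Sum>i\<in>J. \<bar>ostat n (Suc i) \<omega>\<bar> powr p)"
    using p by (intro sum_mono powr_mono2 J) auto
  also have "\<dots> \<le> (\<Sum>i<n. \<bar>ostat n (Suc i) \<omega>\<bar> powr p)"
    using J by (intro sum_mono2) auto
  also have "\<dots> = (\<Sum>i\<in>{1..n}. \<bar>ostat n i \<omega>\<bar> powr p)"
    by (rule sum.reindex_bij_witness[of _ "\<lambda>i. i - 1" Suc]) auto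
  also have "\<dots> = (\<Sum>i\<in>{1..n}. \<bar>X i \<omega>\<bar> powr p)"
    unfolding ostat_def by (rule sum_order_stat)
  finally show ?thesis .
qed

text \<open>Used in contrapositive form: if fewer than \<open>k\<close> members exceed
  \<open>y\<close> in absolute value, then neither does the order statistic.\<close>

lemma ostat_large_hits:
  assumes j: "1 \<le> k" "k \<le> j" "k + j \<le> n + 1" "j \<le> n" and y: "y < \<bar>ostat n j \<omega>\<bar>"
  shows "real k \<le> hits n {x. y < \<bar>x\<bar>} \<omega>"
proof -
  obtain J where J: "J \<subseteq> {..<n}" "k \<le> card J" "\<And>i. i \<in> J \<Longrightarrow> \<bar>ostat n j \<omega>\<bar> \<le> \<bar>ostat n (Suc i) \<omega>\<bar>"
    using ostat_extreme[of j k n \<omega>] j by auto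
  have "card J \<le> card {i \<in> {..<n}. ostat n (Suc i) \<omega> \<in> {x. y < \<bar>x\<bar>}}"
    using J y by (intro card_mono) (auto intro: less_le_trans)
  then show ?thesis using J(2) unfolding hits_card by simp
qed

definition pmom :: "real \<Rightarrow> real" where
  "pmom p = (\<integral>x. \<bar>x\<bar> powr p \<partial>law)"

lemma pmom_nonneg: "0 \<le> pmom p"
  unfolding pmom_def by (intro integral_nonneg_AE AE_I2) simp

lemma expectation_sum_powr:
  assumes "integrable law (\<lambda>x. \<bar>x\<bar> powr p)"
  shows "integrable M (\<lambda>\<omega>. \<Sum>i\<in>{1..n}. \<bar>X i \<omega>\<bar> powr p)"
    "expectation (\<lambda>\<omega>. \<Sum>i\<in>{1..n}. \<bar>X i \<omega>\<bar> powr p) = real n * pmom p"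
proof -
  have i: "integrable M (\<lambda>\<omega>. \<bar>X i \<omega>\<bar> powr p)" "expectation (\<lambda>\<omega>. \<bar>X i \<omega>\<bar> powr p) = pmom p" if "i \<in> {1..n}" for i
    using expectation_eq_law[of i "\<lambda>x. \<bar>x\<bar> powr p"] that assms by (auto simp: pmom_def)
  show "integrable M (\<lambda>\<omega>. \<Sum>i\<in>{1..n}. \<bar>X i \<omega>\<bar> powr p)"
    by (intro Bochner_Integration.integrable_sum i)
  have "expectation (\<lambda>\<omega>. \<Sum>i\<in>{1..n}. \<bar>X i \<omega>\<bar> powr p) = (\<Sum>i\<in>{1..n}. expectation (\<lambda>\<omega>. \<bar>X i \<omega>\<bar> powr p))"
    by (intro Bochner_Integration.integral_sum i)
  also have "\<dots> = (\<Sum>i\<in>{1..n}. pmom p)" by (intro sum.cong i refl)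
  finally show "expectation (\<lambda>\<omega>. \<Sum>i\<in>{1..n}. \<bar>X i \<omega>\<bar> powr p) = real n * pmom p" by simp
qed

lemma law_markov:
  assumes "integrable law (\<lambda>x. \<bar>x\<bar> powr p)" "0 < p" "0 < y" "B \<in> sets borel" "\<And>x. x \<in> B \<Longrightarrow> y \<le> \<bar>x\<bar>"
  shows "measure law B * y powr p \<le> pmom p"
proof -
  have "measure law B * y powr p = (\<integral>x. indicator B x * y powr p \<partial>law)"
    using assms(4) by simp
  also have "\<dots> \<le> (\<integral>x. \<bar>x\<bar> powr p \<partial>law)"
  proof (rule integral_mono)
    show "integrable law (\<lambda>x. indicator B x * y powr p)"
      using assms(4) by (intro integrable_mult_left law.integrable_const_bound[where B = 1]) auto
    fix x show "indicator B x * y powr p \<le> \<bar>x\<bar> powr p"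
      using assms(2,3) assms(5)[of x] by (auto simp: indicator_def intro: powr_mono2)
  qed (rule assms)
  finally show ?thesis by (simp add: pmom_def)
qed

text \<open>The size factor at the cut between the ranks \<open>j\<close> and \<open>j + 1\<close>
  with cut value \<open>a\<close>: it multiplies the count deviations in the bound for the
  remainder.\<close>

definition edge :: "nat \<Rightarrow> nat \<Rightarrow> real \<Rightarrow> 'a \<Rightarrow> real" where
  "edge n j a \<omega> = 2 * \<bar>a\<bar> + \<bar>ostat n j \<omega>\<bar> + \<bar>ostat n (j + 1) \<omega>\<bar>"

lemma edge_measurable: "1 \<le> j \<Longrightarrow> j + 1 \<le> n \<Longrightarrow> edge n j a \<in> borel_measurable M"
  unfolding edge_def[abs_def] by (intro borel_measurable_add borel_measurable_abs borel_measurable_const ostat_measurable) auto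

text \<open>The edge is at most 4 times the largest of three quantities, and the p-th power of each
  has mean at most \<open>pmom p\<close> divided by k/n; hence the constants 4 and 3.\<close>

lemma edge_moment:
  assumes i: "integrable law (\<lambda>x. \<bar>x\<bar> powr p)" and p: "2 < p"
    and j: "1 \<le> k" "k \<le> j" "k + j \<le> n" and a: "real k * \<bar>a\<bar> powr p \<le> real n * pmom p"
  shows "integrable M (\<lambda>\<omega>. edge n j a \<omega> powr p)"
    "expectation (\<lambda>\<omega>. edge n j a \<omega> powr p) \<le> 3 * 4 powr p * pmom p / (real k / real n)"
proof -
  have n: "0 < n" using j by simp
  define U where "U \<omega> = 4 powr p * (real n * pmom p + 2 * (\<Sum>i\<in>{1..n}. \<bar>X i \<omega>\<bar> powr p)) / real k" for \<omega>
  have le: "edge n j a \<omega> powr p \<le> U \<omega>" for \<omega>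
  proof -
    define m where "m = max \<bar>a\<bar> (max \<bar>ostat n j \<omega>\<bar> \<bar>ostat n (j + 1) \<omega>\<bar>)"
    have m0: "0 \<le> m" by (simp add: m_def)
    have "edge n j a \<omega> \<le> 4 * m" unfolding edge_def m_def by linarith
    then have "edge n j a \<omega> powr p \<le> (4 * m) powr p"
      using p by (intro powr_mono2) (auto simp: edge_def)
    also have "\<dots> = 4 powr p * m powr p" using m0 by (simp add: powr_mult)
    also have "m powr p \<le> \<bar>a\<bar> powr p + \<bar>ostat n j \<omega>\<bar> powr p + \<bar>ostat n (j + 1) \<omega>\<bar> powr p"
      unfolding m_def max_def by auto
    also have "\<dots> \<le> (real n * pmom p + 2 * (\<Sum>i\<in>{1..n}. \<bar>X i \<omega>\<bar> powr p)) / real k"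
    proof -
      have "real k * (\<bar>a\<bar> powr p + \<bar>ostat n j \<omega>\<bar> powr p + \<bar>ostat n (j + 1) \<omega>\<bar> powr p) \<le>
          real n * pmom p + 2 * (\<Sum>i\<in>{1..n}. \<bar>X i \<omega>\<bar> powr p)"
        using a ostat_powr_le[of k j n p \<omega>] ostat_powr_le[of k "j + 1" n p \<omega>] j p
        by (simp add: distrib_left)
      then show ?thesis using j by (simp add: field_simps)
    qed
    finally show ?thesis unfolding U_def by (simp add: mult_left_mono)
  qed
  have iU: "integrable M U"
    unfolding U_def using expectation_sum_powr(1)[OF i, of n] by auto
  have [measurable]: "edge n j a \<in> borel_measurable M"
    using j by (intro edge_measurable) auto
  show ie: "integrable M (\<lambda>\<omega>. edge n j a \<omega> powr p)"
    by (rule Bochner_Integration.integrable_bound[OF iU]) (auto intro!: AE_I2 order_trans[OF le abs_ge_self])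
  have "expectation (\<lambda>\<omega>. edge n j a \<omega> powr p) \<le> expectation U"
    using ie iU le by (intro integral_mono) auto
  also have "\<dots> = 4 powr p * (real n * pmom p + 2 * (real n * pmom p)) / real k"
    unfolding U_def using expectation_sum_powr[OF i, of n] by (simp add: prob_space)
  also have "\<dots> = 3 * 4 powr p * pmom p / (real k / real n)" by simp
  finally show "expectation (\<lambda>\<omega>. edge n j a \<omega> powr p) \<le> 3 * 4 powr p * pmom p / (real k / real n)" .
qed

end

section \<open>The remainder of the winsorized sum\<close>

context iid_sample
begin

text \<open>Markov's inequality on the half-line that starts at \<open>a\<close> and points away
  from 0: it has mass at least k/n, and every point of it is at least as large as \<open>a\<close>
  in absolute value.\<close>

lemma quantile_powr_le:
  assumes i: "integrable law (\<lambda>x. \<bar>x\<bar> powr p)" and p: "2 < p"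
    and k: "2 * k \<le> n" "real k \<le> real n * measure law {..a}" "real k \<le> real n * measure law {a..}"
  shows "real k * \<bar>a\<bar> powr p \<le> real n * pmom p"
proof (cases "a = 0")
  case True
  then show ?thesis using pmom_nonneg[of p] by simp
next
  case False
  obtain B where B: "B \<in> sets borel" "\<And>x. x \<in> B \<Longrightarrow> \<bar>a\<bar> \<le> \<bar>x\<bar>" "real k \<le> real n * measure law B"
  proof (cases "a \<le> 0")
    case True
    then show thesis using k by (intro that[of "{..a}"]) auto
  next
    case False
    then show thesis using k by (intro that[of "{a..}"]) auto
  qed
  have "measure law B * \<bar>a\<bar> powr p \<le> pmom p"
    using False p by (intro law_markov[OF i _ _ B(1)] B(2)) auto
  then have "real n * (measure law B * \<bar>a\<bar> powr p) \<le> real n * pmom p"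
    by (intro mult_left_mono) auto
  moreover have "real k * \<bar>a\<bar> powr p \<le> real n * measure law B * \<bar>a\<bar> powr p"
    using B(3) by (intro mult_right_mono) auto
  ultimately show ?thesis by simp
qed

lemma cut_moment:
  assumes i: "integrable law (\<lambda>x. \<bar>x\<bar> powr p)" and p: "2 < p"
    and j: "1 \<le> k" "k \<le> j" "k + j \<le> n" and a: "real k * \<bar>a\<bar> powr p \<le> real n * pmom p"
    and D: "subexponential D (real k)" "subexponential D' (real k)"
  defines "r \<equiv> 2 * p / (p - 2)"
  shows "integrable M (\<lambda>\<omega>. ((max (D \<omega>) 0 + max (D' \<omega>) 0) * edge n j a \<omega>)\<^sup>2)"
    "expectation (\<lambda>\<omega>. ((max (D \<omega>) 0 + max (D' \<omega>) 0) * edge n j a \<omega>)\<^sup>2) \<le>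
      4 * (real k * (real k / real n) powr (- 2 / p) * (r powr r * (1 + exp 1) + 3 * 4 powr p * pmom p))"
proof -
  have [measurable]: "D \<in> borel_measurable M" "D' \<in> borel_measurable M"
    using D unfolding subexponential_def by auto
  have e[measurable]: "edge n j a \<in> borel_measurable M" using j by (intro edge_measurable) auto
  have e0: "0 \<le> edge n j a \<omega>" for \<omega> by (simp add: edge_def)
  have \<alpha>: "0 < real k / real n" and k1: "1 \<le> real k" using j by auto
  note pm = subexponential_product_moment[OF _ k1 p \<alpha> e e0 edge_moment[OF i p j a], folded r_def]
  define F where "F G \<omega> = (max (G \<omega>) 0 * edge n j a \<omega>)\<^sup>2" for G :: "'a \<Rightarrow> real" and \<omega>
  define S where "S \<omega> = ((max (D \<omega>) 0 + max (D' \<omega>) 0) * edge n j a \<omega>)\<^sup>2" for \<omega>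
  have [measurable]: "S \<in> borel_measurable M" unfolding S_def[abs_def] by measurable
  have le: "S \<omega> \<le> 2 * F D \<omega> + 2 * F D' \<omega>" for \<omega>
    unfolding F_def S_def distrib_right
    using sum_squares_bound[of "max (D \<omega>) 0 * edge n j a \<omega>" "max (D' \<omega>) 0 * edge n j a \<omega>"]
    by (simp add: power2_sum)
  have S0: "0 \<le> S \<omega>" for \<omega> by (simp add: S_def)
  have iF: "integrable M (F D)" "integrable M (F D')"
    unfolding F_def using pm(1)[OF D(1)] pm(1)[OF D(2)] by auto
  have eF: "expectation (F G) \<le> real k * (real k / real n) powr (- 2 / p) * (r powr r * (1 + exp 1) + 3 * 4 powr p * pmom p)"
    if "subexponential G (real k)" for G
    unfolding F_def using pm(2)[OF that] .
  have iS: "integrable M S"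
    by (rule Bochner_Integration.integrable_bound[of _ "\<lambda>\<omega>. 2 * F D \<omega> + 2 * F D' \<omega>"])
      (use iF in \<open>auto simp: abs_of_nonneg[of "S _"] S0 intro!: AE_I2 order_trans[OF le abs_ge_self]\<close>)
  have "expectation S \<le> expectation (\<lambda>\<omega>. 2 * F D \<omega> + 2 * F D' \<omega>)"
    using iS iF le by (intro integral_mono) auto
  also have "\<dots> = 2 * expectation (F D) + 2 * expectation (F D')" using iF by simp
  finally show "expectation (\<lambda>\<omega>. ((max (D \<omega>) 0 + max (D' \<omega>) 0) * edge n j a \<omega>)\<^sup>2) \<le>
      4 * (real k * (real k / real n) powr (- 2 / p) * (r powr r * (1 + exp 1) + 3 * 4 powr p * pmom p))"
    using eF[OF D(1)] eF[OF D(2)] unfolding S_def by linarith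
  show "integrable M (\<lambda>\<omega>. ((max (D \<omega>) 0 + max (D' \<omega>) 0) * edge n j a \<omega>)\<^sup>2)"
    using iS unfolding S_def .
qed

text \<open>The level \<open>y\<close> is chosen so that the expected number of members beyond it is
  at most k/4. That \<open>k\<close> of them lie beyond it is then a deviation of 3k/4, with
  probability at most exp(-k/2) by Chernoff at s = 1. Otherwise the edge is at most 4 y, and each of
  the two count deviations is below 2 L sqrt(k g) unless its own tail event occurs; this gives 16 =
  2 * 2 * 4. The summand 1 next to \<open>pmom p\<close> keeps \<open>y\<close> positive.\<close>

lemma cut_tail:
  assumes i: "integrable law (\<lambda>x. \<bar>x\<bar> powr p)" and p: "2 < p"
    and j: "1 \<le> k" "k \<le> j" "k + j \<le> n" and a: "real k * \<bar>a\<bar> powr p \<le> real n * pmom p"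
    and D: "subexponential D (real k)" "subexponential D' (real k)"
    and L: "0 < L" "0 < g" "L\<^sup>2 * g \<le> real k"
  shows "\<P>(\<omega> in M. (max (D \<omega>) 0 + max (D' \<omega>) 0) * edge n j a \<omega> >
      16 * L * sqrt (real k * g) * (4 * (pmom p + 1) / (real k / real n)) powr (1 / p)) \<le>
    2 * exp (- (L\<^sup>2 * g)) + exp (- (real k / 2))"
proof -
  have [measurable]: "D \<in> borel_measurable M" "D' \<in> borel_measurable M"
    using D unfolding subexponential_def by auto
  have [measurable]: "edge n j a \<in> borel_measurable M" using j by (intro edge_measurable) auto
  have n: "0 < real n" "0 < real k" using j by auto
  define y where "y = (4 * (pmom p + 1) / (real k / real n)) powr (1 / p)"
  define B where "B = {x. y < \<bar>x\<bar>}"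
  have B[measurable]: "B \<in> sets borel" unfolding B_def by measurable
  have pm: "0 \<le> pmom p" by (rule pmom_nonneg)
  have y0: "0 < y" unfolding y_def using n pm by simp
  have yp: "y powr p = 4 * (pmom p + 1) / (real k / real n)"
    unfolding y_def using n pm p by (simp add: powr_powr)
  have ay: "\<bar>a\<bar> \<le> y"
  proof -
    have "\<bar>a\<bar> powr p \<le> real n * pmom p / real k" using a n by (simp add: field_simps)
    also have "\<dots> \<le> y powr p"
    proof -
      have "real n * pmom p \<le> real n * (4 * (pmom p + 1))" using pm n by (intro mult_left_mono) auto
      then show ?thesis unfolding yp using n by (simp add: divide_right_mono mult.commute)
    qed
    finally have "\<not> y powr p < \<bar>a\<bar> powr p" by simp
    then show ?thesis using powr_less_mono2[of p y "\<bar>a\<bar>"] p y0 by force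
  qed
  have "measure law B * y powr p \<le> pmom p"
    using p y0 by (intro law_markov[OF i _ _ B]) (auto simp: B_def)
  then have "measure law B * (4 * (pmom p + 1)) * real n \<le> pmom p * real k"
    unfolding yp using n by (simp add: field_simps)
  also have "\<dots> \<le> (pmom p + 1) * real k" by (intro mult_right_mono) auto
  finally have "(pmom p + 1) * (4 * (real n * measure law B)) \<le> (pmom p + 1) * real k"
    by (simp only: mult_ac)
  then have q: "real n * measure law B \<le> real k / 4"
    using pm by simp
  have "\<P>(\<omega> in M. hits n B \<omega> - real k / 4 \<ge> 3 * real k / 4) \<le> exp (real k / 4 * 1\<^sup>2 - 1 * (3 * real k / 4))"
    by (rule subexponential_chernoff[OF subexponential_hits_upper[OF B q]]) auto
  then have pB: "\<P>(\<omega> in M. hits n B \<omega> - real k / 4 \<ge> 3 * real k / 4) \<le> exp (- (real k / 2))" by simp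
  define d where "d = 2 * L * sqrt (real k * g)"
  have d0: "0 \<le> d" using L n by (simp add: d_def)
  have pD: "\<P>(\<omega> in M. D \<omega> \<ge> d) \<le> exp (- (L\<^sup>2 * g))" "\<P>(\<omega> in M. D' \<omega> \<ge> d) \<le> exp (- (L\<^sup>2 * g))"
    unfolding d_def using subexponential_tail[OF D(1) L] subexponential_tail[OF D(2) L] by auto
  define E1 where "E1 = {\<omega> \<in> space M. D \<omega> \<ge> d}"
  define E2 where "E2 = {\<omega> \<in> space M. D' \<omega> \<ge> d}"
  define E3 where "E3 = {\<omega> \<in> space M. hits n B \<omega> - real k / 4 \<ge> 3 * real k / 4}"
  have Es[measurable]: "E1 \<in> sets M" "E2 \<in> sets M" "E3 \<in> sets M" unfolding E1_def E2_def E3_def by measurable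
  have "{\<omega> \<in> space M. (max (D \<omega>) 0 + max (D' \<omega>) 0) * edge n j a \<omega> > 16 * L * sqrt (real k * g) * y} \<subseteq> E1 \<union> E2 \<union> E3"
  proof (rule subsetI, rule ccontr)
    fix \<omega> assume \<omega>: "\<omega> \<in> {\<omega> \<in> space M. (max (D \<omega>) 0 + max (D' \<omega>) 0) * edge n j a \<omega> > 16 * L * sqrt (real k * g) * y}"
      and nE: "\<omega> \<notin> E1 \<union> E2 \<union> E3"
    have "D \<omega> < d" "D' \<omega> < d" "hits n B \<omega> < real k"
      using \<omega> nE by (auto simp: E1_def E2_def E3_def)
    then have "\<bar>ostat n j \<omega>\<bar> \<le> y" "\<bar>ostat n (j + 1) \<omega>\<bar> \<le> y"
      using ostat_large_hits[of k j n y \<omega>] ostat_large_hits[of k "j + 1" n y \<omega>] j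
      by (fastforce simp: B_def not_le)+
    then have "edge n j a \<omega> \<le> 4 * y" using ay by (simp add: edge_def)
    moreover have "max (D \<omega>) 0 + max (D' \<omega>) 0 \<le> 2 * d"
      using \<open>D \<omega> < d\<close> \<open>D' \<omega> < d\<close> d0 by simp
    ultimately have "(max (D \<omega>) 0 + max (D' \<omega>) 0) * edge n j a \<omega> \<le> 2 * d * (4 * y)"
      using d0 by (intro mult_mono) (auto simp: edge_def)
    also have "\<dots> = 16 * L * sqrt (real k * g) * y" by (simp add: d_def)
    finally show False using \<omega> by auto
  qed
  then have "\<P>(\<omega> in M. (max (D \<omega>) 0 + max (D' \<omega>) 0) * edge n j a \<omega> > 16 * L * sqrt (real k * g) * y) \<le> prob (E1 \<union> E2 \<union> E3)"
    by (intro finite_measure_mono) auto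
  also have "\<dots> \<le> prob (E1 \<union> E2) + prob E3" by (rule measure_Un_le) auto
  also have "prob (E1 \<union> E2) \<le> prob E1 + prob E2" by (rule measure_Un_le) auto
  finally show ?thesis
    using pD pB unfolding E1_def E2_def E3_def y_def by simp
qed

text \<open>The quantile property of \<open>a\<close> and \<open>b\<close> expressed through masses.
  If the law has atoms at these points there need not be equality, so open and closed half-lines are
  bounded from opposite sides.\<close>

definition trim_point :: "nat \<Rightarrow> nat \<Rightarrow> nat \<Rightarrow> real \<Rightarrow> real \<Rightarrow> bool" where
  "trim_point n k m a b \<longleftrightarrow> a \<le> b \<and> 1 \<le> k \<and> 1 \<le> m \<and> k + m < n \<and> 2 * k \<le> n \<and> 2 * m \<le> n \<and>
    real n * measure law {..<a} \<le> real k \<and> real k \<le> real n * measure law {..a} \<and>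
    real n * measure law {b<..} \<le> real m \<and> real m \<le> real n * measure law {b..}"

lemma trim_point_subexponential:
  assumes "trim_point n k m a b"
  shows "subexponential (\<lambda>\<omega>. real k - hits n {..a} \<omega>) (real k)"
    "subexponential (\<lambda>\<omega>. hits n {..<a} \<omega> - real k) (real k)"
    "subexponential (\<lambda>\<omega>. real m - hits n {b..} \<omega>) (real m)"
    "subexponential (\<lambda>\<omega>. hits n {b<..} \<omega> - real m) (real m)"
  using assms unfolding trim_point_def
  by (auto intro!: subexponential_hits_upper subexponential_hits_lower)

lemma trim_point_powr:
  assumes "trim_point n k m a b" "integrable law (\<lambda>x. \<bar>x\<bar> powr p)" "2 < p"
  shows "real k * \<bar>a\<bar> powr p \<le> real n * pmom p" "real m * \<bar>b\<bar> powr p \<le> real n * pmom p"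
proof -
  have n: "1 \<le> k" "2 * k \<le> n" "1 \<le> m" "2 * m \<le> n" using assms(1) unfolding trim_point_def by auto
  have "measure law {a..} = 1 - measure law {..<a}"
    using law.prob_compl[of "{..<a}"] by (simp add: Compl_eq_Diff_UNIV[symmetric])
  \<comment> \<open>When at most half of the sample is trimmed on this side, the mass at or above
    \<open>a\<close>, at least 1 - k/n, is still at least k/n.\<close>
  moreover have "real n - real k \<ge> real k" using n by linarith
  ultimately have "real k \<le> real n * measure law {a..}"
    using assms(1) unfolding trim_point_def by (simp add: right_diff_distrib)
  then show "real k * \<bar>a\<bar> powr p \<le> real n * pmom p"
    using quantile_powr_le[OF assms(2,3), of k n a] assms(1) unfolding trim_point_def by auto
  have "measure law {..b} = 1 - measure law {b<..}"
    using law.prob_compl[of "{b<..}"] by (simp add: Compl_eq_Diff_UNIV[symmetric])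
  moreover have "real n - real m \<ge> real m" using n by linarith
  ultimately have "real m \<le> real n * measure law {..b}"
    using assms(1) unfolding trim_point_def by (simp add: right_diff_distrib)
  then show "real m * \<bar>b\<bar> powr p \<le> real n * pmom p"
    using quantile_powr_le[OF assms(2,3), of m n b] assms(1) unfolding trim_point_def by auto
qed

lemma remainder_le_cuts:
  assumes "trim_point n k m a b"
  shows "\<bar>remainder n k m a b \<omega>\<bar> \<le>
    (max (real k - hits n {..a} \<omega>) 0 + max (hits n {..<a} \<omega> - real k) 0) * edge n k a \<omega> +
    (max (real m - hits n {b..} \<omega>) 0 + max (hits n {b<..} \<omega> - real m) 0) * edge n (n - m) b \<omega>"
  using remainder_bound[of a b k m n \<omega>] assms unfolding trim_point_def edge_def by auto

lemma remainder_moment: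
  assumes t: "trim_point n k m a b" and i: "integrable law (\<lambda>x. \<bar>x\<bar> powr p)" and p: "2 < p"
  defines "r \<equiv> 2 * p / (p - 2)"
  shows "integrable M (\<lambda>\<omega>. (remainder n k m a b \<omega>)\<^sup>2)"
    "expectation (\<lambda>\<omega>. (remainder n k m a b \<omega>)\<^sup>2) \<le> 8 * (r powr r * (1 + exp 1) + 3 * 4 powr p * pmom p) *
      (real k * (real k / real n) powr (- 2 / p) + real m * (real m / real n) powr (- 2 / p))"
proof -
  have km: "1 \<le> k" "1 \<le> m" "k + m < n" "2 * k \<le> n" "2 * m \<le> n" using t unfolding trim_point_def by auto
  note sub = trim_point_subexponential[OF t] and pw = trim_point_powr[OF t i p]
  define K where "K = r powr r * (1 + exp 1) + 3 * 4 powr p * pmom p"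
  define A where "A \<omega> = (max (real k - hits n {..a} \<omega>) 0 + max (hits n {..<a} \<omega> - real k) 0) * edge n k a \<omega>" for \<omega>
  define B where "B \<omega> = (max (real m - hits n {b..} \<omega>) 0 + max (hits n {b<..} \<omega> - real m) 0) * edge n (n - m) b \<omega>" for \<omega>
  have A: "integrable M (\<lambda>\<omega>. (A \<omega>)\<^sup>2)" "expectation (\<lambda>\<omega>. (A \<omega>)\<^sup>2) \<le> 4 * (real k * (real k / real n) powr (- 2 / p) * K)"
    unfolding A_def K_def r_def using cut_moment[OF i p _ _ _ pw(1) sub(1,2), of k] km by auto
  have B: "integrable M (\<lambda>\<omega>. (B \<omega>)\<^sup>2)" "expectation (\<lambda>\<omega>. (B \<omega>)\<^sup>2) \<le> 4 * (real m * (real m / real n) powr (- 2 / p) * K)"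
    unfolding B_def K_def r_def using cut_moment[OF i p _ _ _ pw(2) sub(3,4), of "n - m"] km by auto
  have le: "(remainder n k m a b \<omega>)\<^sup>2 \<le> 2 * (A \<omega>)\<^sup>2 + 2 * (B \<omega>)\<^sup>2" for \<omega>
  proof -
    have "(remainder n k m a b \<omega>)\<^sup>2 \<le> (A \<omega> + B \<omega>)\<^sup>2"
      using remainder_le_cuts[OF t, of \<omega>] unfolding A_def B_def
      by (simp only: abs_le_square_iff[symmetric]) (rule order_trans[OF _ abs_ge_self])
    also have "\<dots> \<le> 2 * (A \<omega>)\<^sup>2 + 2 * (B \<omega>)\<^sup>2"
      using sum_squares_bound[of "A \<omega>" "B \<omega>"] by (simp add: power2_sum)
    finally show ?thesis .
  qed
  note [measurable] = remainder_measurable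
  show ir: "integrable M (\<lambda>\<omega>. (remainder n k m a b \<omega>)\<^sup>2)"
    by (rule Bochner_Integration.integrable_bound[of _ "\<lambda>\<omega>. 2 * (A \<omega>)\<^sup>2 + 2 * (B \<omega>)\<^sup>2"])
      (use A B in \<open>auto intro!: AE_I2 le\<close>)
  have "expectation (\<lambda>\<omega>. (remainder n k m a b \<omega>)\<^sup>2) \<le> expectation (\<lambda>\<omega>. 2 * (A \<omega>)\<^sup>2 + 2 * (B \<omega>)\<^sup>2)"
    using ir A B le by (intro integral_mono) auto
  also have "\<dots> = 2 * expectation (\<lambda>\<omega>. (A \<omega>)\<^sup>2) + 2 * expectation (\<lambda>\<omega>. (B \<omega>)\<^sup>2)" using A B by simp
  also have "\<dots> \<le> 8 * K * (real k * (real k / real n) powr (- 2 / p) + real m * (real m / real n) powr (- 2 / p))"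
    using A B by (simp add: algebra_simps)
  finally show "expectation (\<lambda>\<omega>. (remainder n k m a b \<omega>)\<^sup>2) \<le> 8 * (r powr r * (1 + exp 1) + 3 * 4 powr p * pmom p) *
      (real k * (real k / real n) powr (- 2 / p) + real m * (real m / real n) powr (- 2 / p))"
    unfolding K_def .
qed

lemma remainder_tail:
  assumes t: "trim_point n k m a b" and i: "integrable law (\<lambda>x. \<bar>x\<bar> powr p)" and p: "2 < p"
    and L: "0 < L" "0 < g" "L\<^sup>2 * g \<le> real k" "L\<^sup>2 * g \<le> real m"
  shows "\<P>(\<omega> in M. \<bar>remainder n k m a b \<omega>\<bar> >
      16 * L * sqrt (real k * g) * (4 * (pmom p + 1) / (real k / real n)) powr (1 / p) +
      16 * L * sqrt (real m * g) * (4 * (pmom p + 1) / (real m / real n)) powr (1 / p)) \<le>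
    4 * exp (- (L\<^sup>2 * g)) + exp (- (real k / 2)) + exp (- (real m / 2))" (is "prob {\<omega> \<in> space M. _ > ?x + ?y} \<le> _")
proof -
  have km: "1 \<le> k" "1 \<le> m" "k + m < n" "2 * k \<le> n" "2 * m \<le> n" using t unfolding trim_point_def by auto
  note sub = trim_point_subexponential[OF t] and pw = trim_point_powr[OF t i p]
  define A where "A \<omega> = (max (real k - hits n {..a} \<omega>) 0 + max (hits n {..<a} \<omega> - real k) 0) * edge n k a \<omega>" for \<omega>
  define B where "B \<omega> = (max (real m - hits n {b..} \<omega>) 0 + max (hits n {b<..} \<omega> - real m) 0) * edge n (n - m) b \<omega>" for \<omega>
  have A: "\<P>(\<omega> in M. A \<omega> > ?x) \<le> 2 * exp (- (L\<^sup>2 * g)) + exp (- (real k / 2))"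
    unfolding A_def using km L by (intro cut_tail[OF i p _ _ _ pw(1) sub(1,2)]) auto
  have B: "\<P>(\<omega> in M. B \<omega> > ?y) \<le> 2 * exp (- (L\<^sup>2 * g)) + exp (- (real m / 2))"
    unfolding B_def using km L by (intro cut_tail[OF i p _ _ _ pw(2) sub(3,4)]) auto
  have [measurable]: "edge n k a \<in> borel_measurable M" "edge n (n - m) b \<in> borel_measurable M"
    using km by (auto intro!: edge_measurable)
  have [measurable]: "A \<in> borel_measurable M" "B \<in> borel_measurable M"
    unfolding A_def[abs_def] B_def[abs_def] by measurable
  have "\<P>(\<omega> in M. \<bar>remainder n k m a b \<omega>\<bar> > ?x + ?y) \<le> prob ({\<omega> \<in> space M. A \<omega> > ?x} \<union> {\<omega> \<in> space M. B \<omega> > ?y})"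
  proof (rule finite_measure_mono)
    show "{\<omega> \<in> space M. \<bar>remainder n k m a b \<omega>\<bar> > ?x + ?y} \<subseteq> {\<omega> \<in> space M. A \<omega> > ?x} \<union> {\<omega> \<in> space M. B \<omega> > ?y}"
    proof
      fix \<omega> assume "\<omega> \<in> {\<omega> \<in> space M. \<bar>remainder n k m a b \<omega>\<bar> > ?x + ?y}"
      moreover have "\<bar>remainder n k m a b \<omega>\<bar> \<le> A \<omega> + B \<omega>"
        unfolding A_def B_def by (rule remainder_le_cuts[OF t])
      ultimately have "\<omega> \<in> space M" "?x + ?y < A \<omega> + B \<omega>" by auto
      then show "\<omega> \<in> {\<omega> \<in> space M. A \<omega> > ?x} \<union> {\<omega> \<in> space M. B \<omega> > ?y}"
        by (cases "A \<omega> > ?x") auto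
    qed
  qed measurable
  also have "\<dots> \<le> \<P>(\<omega> in M. A \<omega> > ?x) + \<P>(\<omega> in M. B \<omega> > ?y)"
    by (rule measure_Un_le) measurable
  finally show ?thesis using A B by linarith
qed

end

section \<open>Quantiles\<close>

context cdf_distribution
begin

lemma superlevel_eq: "0 < u \<Longrightarrow> u < 1 \<Longrightarrow> {x. u \<le> C x} = {I u..}"
  unfolding set_eq_iff mem_Collect_eq atLeast_iff by (intro allI pseudoinverse)

text \<open>At interior levels the superlevel set is a closed half-line, so the infimum is the real
  pseudo-inverse \<open>I\<close>. This makes the representation of \<open>M\<close> as the image of
  Lebesgue measure under \<open>I\<close> available for \<open>quantile\<close>.\<close>

lemma quantile_eq: "0 < u \<Longrightarrow> u < 1 \<Longrightarrow> quantile C u = ereal (I u)"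
proof -
  assume u: "0 < u" "u < 1"
  have "quantile C u = (INF x\<in>{I u..}. ereal x)"
    using u superlevel_eq[OF u] by (simp add: quantile_def)
  also have "\<dots> = ereal (I u)" by (intro INF_eqI) auto
  finally show ?thesis .
qed

lemma quantile_cdf_ge: "0 < u \<Longrightarrow> u < 1 \<Longrightarrow> u \<le> measure M {..I u}"
  using pseudoinverse[of u "I u"] by (simp add: cdf_def)

lemma quantile_left_le: "0 < u \<Longrightarrow> u < 1 \<Longrightarrow> measure M {..<I u} \<le> u"
proof (rule tendsto_upperbound[OF cdf_at_left])
  assume u: "0 < u" "u < 1"
  have "C x \<le> u" if "x < I u" for x
    using pseudoinverse[OF u, of x] that by simp
  then show "\<forall>\<^sub>F x in at_left (I u). C x \<le> u"
    by (intro eventually_at_leftI[of "I u - 1"]) auto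
qed simp

lemma quantile_tails:
  assumes "0 < u" "u < 1"
  shows "measure M {I u<..} \<le> 1 - u" "1 - u \<le> measure M {I u..}"
proof -
  have "measure M {I u<..} = 1 - measure M {..I u}" "measure M {I u..} = 1 - measure M {..<I u}"
    using prob_compl[of "{..I u}"] prob_compl[of "{..<I u}"] by (simp_all add: Compl_eq_Diff_UNIV[symmetric])
  then show "measure M {I u<..} \<le> 1 - u" "1 - u \<le> measure M {I u..}"
    using quantile_cdf_ge[OF assms] quantile_left_le[OF assms] by auto
qed

lemma quantile_mono: "0 < u \<Longrightarrow> u \<le> v \<Longrightarrow> v < 1 \<Longrightarrow> I u \<le> I v"
  using mono_I unfolding mono_on_def by auto

lemma winsorize_eq_clip:
  assumes "0 < \<alpha>" "\<alpha> < 1" "0 < \<beta>" "\<beta> < 1"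
  shows "winsorize C \<alpha> \<beta> x = clip (I \<alpha>) (I (1 - \<beta>)) x"
  using assms by (simp add: winsorize_def quantile_eq clip_def)

lemma clip_measurable: "clip a b \<in> borel_measurable borel"
  unfolding clip_def[abs_def] by measurable

lemma clip_bounded: "\<bar>clip a b x\<bar> \<le> max \<bar>a\<bar> \<bar>b\<bar>"
  by (auto simp: clip_def)

lemma integrable_clip: "integrable M (clip a b)"
proof (rule integrable_const_bound[where B = "max \<bar>a\<bar> \<bar>b\<bar>"])
  show "AE x in M. norm (clip a b x) \<le> max \<bar>a\<bar> \<bar>b\<bar>" using clip_bounded by simp
  show "clip a b \<in> borel_measurable M" using clip_measurable by simp
qed

text \<open>Lebesgue measure on (0, 1) is carried to \<open>M\<close> by \<open>I\<close>, so the
  mean of the clipped variable is the integral of \<open>clip a b (I u)\<close>. This integrand is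
  the quantile itself between \<alpha> and 1 - \<beta> and constant outside.\<close>

lemma quantile_integral:
  assumes \<alpha>: "0 < \<alpha>" and \<beta>: "0 < \<beta>" and ab: "\<alpha> \<le> 1 - \<beta>"
  defines "a \<equiv> I \<alpha>" and "b \<equiv> I (1 - \<beta>)"
  shows "(LBINT s:{\<alpha>..1 - \<beta>}. real_of_ereal (quantile C s)) =
    (\<integral>x. clip a b x \<partial>M) - \<alpha> * a - \<beta> * b"
proof -
  let ?R = "restrict_space lborel {0<..<1::real}"
  have le: "a \<le> b" unfolding a_def b_def using assms by (intro quantile_mono) auto
  define f where "f u = indicator {0<..<1} u * clip a b (I u)" for u :: real
  have mI: "I \<in> measurable ?R borel"
    unfolding measurable_cong_sets[OF sets_restrict_space_cong[OF sets_lborel] refl] by (rule measurable_CI)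
  have "integrable (distr ?R borel I) (clip a b)"
    unfolding distr_I_eq_M by (rule integrable_clip)
  then have "integrable ?R (\<lambda>u. clip a b (I u))"
    using integrable_distr_eq[OF mI, of "clip a b"] clip_measurable by simp
  then have fi: "integrable lborel f"
    using integrable_restrict_space[of "{0<..<1}" lborel "\<lambda>u. clip a b (I u)"] by (simp add: f_def[abs_def])
  have "(\<integral>x. clip a b x \<partial>M) = (\<integral>x. clip a b x \<partial>distr ?R borel I)" by (simp only: distr_I_eq_M)
  also have "\<dots> = (\<integral>u. clip a b (I u) \<partial>?R)"
    by (rule integral_distr[OF mI]) (use clip_measurable in simp)
  also have "\<dots> = integral\<^sup>L lborel f"
    by (subst integral_restrict_space) (simp_all add: f_def[abs_def])
  finally have F: "(\<integral>x. clip a b x \<partial>M) = integral\<^sup>L lborel f" .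
  \<comment> \<open>The constant pieces below \<alpha> and above 1 - \<beta>. The level intervals
    are disjoint and cover (0, 1), so the decomposition below holds at every point and not only
    almost everywhere.\<close>
  define A where "A u = indicator {0<..<\<alpha>} u * a" for u
  define B where "B u = indicator {1 - \<beta><..<1} u * b" for u
  have iAB: "integrable lborel A" "integrable lborel B"
    unfolding A_def[abs_def] B_def[abs_def] using \<alpha> \<beta> by (auto intro!: integrable_mult_left integrable_real_indicator)
  have eq: "indicator {\<alpha>..1 - \<beta>} u *\<^sub>R real_of_ereal (quantile C u) = f u - A u - B u" for u
  proof -
    consider "u \<le> 0" | "1 \<le> u" | "0 < u" "u < \<alpha>" | "\<alpha> \<le> u" "u \<le> 1 - \<beta>" | "1 - \<beta> < u" "u < 1" by linarith
    then show ?thesis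
    proof cases
      case 3
      then have "I u \<le> a" unfolding a_def using assms by (intro quantile_mono) auto
      then show ?thesis using 3 assms by (simp add: f_def A_def B_def clip_def)
    next
      case 4
      then have u: "a \<le> I u" "I u \<le> b" unfolding a_def b_def using assms by (intro quantile_mono; simp)+
      have "quantile C u = ereal (I u)" using 4 assms by (intro quantile_eq) auto
      then show ?thesis using 4 assms u by (auto simp: f_def A_def B_def clip_def)
    next
      case 5
      then have "b \<le> I u" unfolding b_def using assms by (intro quantile_mono) auto
      then show ?thesis using 5 assms le by (auto simp: f_def A_def B_def clip_def)
    qed (use assms in \<open>auto simp: f_def A_def B_def\<close>)
  qed
  have "(LBINT s:{\<alpha>..1 - \<beta>}. real_of_ereal (quantile C s)) = (\<integral>u. f u - A u - B u \<partial>lborel)"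
    unfolding set_lebesgue_integral_def eq ..
  also have "\<dots> = integral\<^sup>L lborel f - integral\<^sup>L lborel A - integral\<^sup>L lborel B"
    using fi iAB by simp
  also have "integral\<^sup>L lborel A = \<alpha> * a" using \<alpha> by (simp add: A_def[abs_def])
  also have "integral\<^sup>L lborel B = \<beta> * b" using \<beta> by (simp add: B_def[abs_def])
  finally show ?thesis by (simp add: F)
qed

end

context iid_sample
begin

lemma law_real_distribution: "real_distribution law"
  by (rule real_distribution_distr) (simp add: X_measurable)

sublocale law: cdf_distribution law
  unfolding cdf_distribution_def by (rule law_real_distribution)

definition qt :: "real \<Rightarrow> real" where "qt u = law.I u"

lemma trim_point_quantiles:
  assumes km: "1 \<le> k n" "1 \<le> m n" "k n + m n < n" "2 * k n \<le> n" "2 * m n \<le> n"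
  shows "trim_point n (k n) (m n) (qt (trim_frac k n)) (qt (1 - trim_frac m n))"
proof -
  define \<alpha> \<beta> where "\<alpha> = trim_frac k n" and "\<beta> = trim_frac m n"
  have n: "0 < real n" using km by simp
  have a: "0 < \<alpha>" "\<alpha> < 1" "0 < \<beta>" "\<beta> < 1" "\<alpha> \<le> 1 - \<beta>"
    using km n by (auto simp: \<alpha>_def \<beta>_def trim_frac_def field_simps)
  have nk: "real (k n) = real n * \<alpha>" "real (m n) = real n * \<beta>" using n by (auto simp: \<alpha>_def \<beta>_def trim_frac_def)
  have "qt \<alpha> \<le> qt (1 - \<beta>)" unfolding qt_def using a by (intro law.quantile_mono) auto
  moreover have "measure law {..<qt \<alpha>} \<le> \<alpha>" "\<alpha> \<le> measure law {..qt \<alpha>}"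
    unfolding qt_def using a by (intro law.quantile_left_le law.quantile_cdf_ge; simp)+
  moreover have "measure law {qt (1 - \<beta>)<..} \<le> \<beta>" "\<beta> \<le> measure law {qt (1 - \<beta>)..}"
    unfolding qt_def using law.quantile_tails[of "1 - \<beta>"] a by simp_all
  ultimately show ?thesis
    unfolding trim_point_def nk \<alpha>_def[symmetric] \<beta>_def[symmetric] using km n by (auto intro!: mult_left_mono)
qed

end

section \<open>Moments beyond the quantiles\<close>

lemma powr_truncation_le:
  fixes x t :: real
  assumes "0 < t" "0 < q" "q < p"
  shows "\<bar>x\<bar> powr q \<le> t powr q + \<bar>x\<bar> powr p * t powr (q - p)"
proof (cases "\<bar>x\<bar> \<le> t")
  case True
  then have "\<bar>x\<bar> powr q \<le> t powr q" using assms by (intro powr_mono2) auto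
  then show ?thesis by (rule order_trans) simp
next
  case False
  then have "\<bar>x\<bar> powr q = \<bar>x\<bar> powr p * \<bar>x\<bar> powr (q - p)"
    using assms by (simp add: powr_add[symmetric])
  also have "\<dots> \<le> \<bar>x\<bar> powr p * t powr (q - p)"
    using False assms by (intro mult_left_mono powr_mono2') auto
  finally show ?thesis by (rule order_trans) simp
qed

context iid_sample
begin

lemma law_integrable_bound:
  fixes f g :: "real \<Rightarrow> real"
  assumes "integrable law f" "g \<in> borel_measurable borel" "\<And>x. \<bar>g x\<bar> \<le> f x"
  shows "integrable law g"
  by (rule Bochner_Integration.integrable_bound[OF assms(1)])
    (use assms in \<open>auto intro!: AE_I2 order_trans[OF assms(3) abs_ge_self]\<close>)

lemma integrable_powr_smaller:
  assumes i: "integrable law (\<lambda>x. \<bar>x\<bar> powr p)" and q: "0 < q" "q < p"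
  shows "integrable law (\<lambda>x. \<bar>x\<bar> powr q)"
proof (rule Bochner_Integration.integrable_bound)
  show "integrable law (\<lambda>x. 1 + \<bar>x\<bar> powr p)"
    by (intro Bochner_Integration.integrable_add law.integrable_const i)
  have "\<bar>x\<bar> powr q \<le> 1 + \<bar>x\<bar> powr p" for x :: real
    using powr_truncation_le[of 1 q p x] q by simp
  then show "AE x in law. norm (\<bar>x\<bar> powr q) \<le> norm (1 + \<bar>x\<bar> powr p)" by simp
qed simp

text \<open>The truncation level t = \<alpha> to the power -1/p balances the two contributions: both
  t^q \<alpha> and t^(q - p) become \<alpha> to the power 1 - q/p.\<close>

lemma tail_powr_moment:
  assumes i: "integrable law (\<lambda>x. \<bar>x\<bar> powr p)" and q: "0 < q" "q < p"
    and B: "B \<in> sets borel" "measure law B \<le> \<alpha>" and \<alpha>: "0 < \<alpha>"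
  shows "(\<integral>x. \<bar>x\<bar> powr q * indicator B x \<partial>law) \<le> (1 + pmom p) * \<alpha> powr (1 - q / p)"
proof -
  define t where "t = \<alpha> powr (- 1 / p)"
  have t: "0 < t" using \<alpha> by (simp add: t_def)
  have iB: "integrable law (indicator B :: real \<Rightarrow> real)"
    using B by (intro law.integrable_const_bound[where B = 1]) auto
  have "(\<integral>x. \<bar>x\<bar> powr q * indicator B x \<partial>law) \<le> (\<integral>x. t powr q * indicator B x + \<bar>x\<bar> powr p * t powr (q - p) \<partial>law)"
  proof (rule integral_mono)
    show "integrable law (\<lambda>x. \<bar>x\<bar> powr q * indicator B x)"
      using integrable_powr_smaller[OF i q] B by (intro integrable_real_mult_indicator) auto
    show "integrable law (\<lambda>x. t powr q * indicator B x + \<bar>x\<bar> powr p * t powr (q - p))"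
      using iB i by auto
    fix x
    show "\<bar>x\<bar> powr q * indicator B x \<le> t powr q * indicator B x + \<bar>x\<bar> powr p * t powr (q - p)"
      using powr_truncation_le[OF t q, of x] by (auto simp: indicator_def)
  qed
  also have "\<dots> = t powr q * measure law B + pmom p * t powr (q - p)"
    using iB i B by (simp add: pmom_def)
  also have "\<dots> \<le> t powr q * \<alpha> + pmom p * t powr (q - p)"
    using B by (intro add_right_mono mult_left_mono) auto
  also have "t powr q * \<alpha> = \<alpha> powr (- 1 / p * q + 1)"
    using \<alpha> by (simp only: t_def powr_powr powr_add powr_one)
  also have "- 1 / p * q + 1 = 1 - q / p" by simp
  also have "t powr (q - p) = \<alpha> powr (1 - q / p)"
  proof -
    have "- 1 / p * (q - p) = 1 - q / p" using q by (simp add: field_simps)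
    then show ?thesis by (simp only: t_def powr_powr)
  qed
  finally show ?thesis by (simp add: algebra_simps)
qed

lemma integrable_moments:
  assumes i: "integrable law (\<lambda>x. \<bar>x\<bar> powr p)" and p: "2 < p"
  shows "integrable law (\<lambda>x. x)" "integrable law (\<lambda>x. x\<^sup>2)"
proof -
  have "integrable law (\<lambda>x. \<bar>x\<bar> powr 1)" "integrable law (\<lambda>x. \<bar>x\<bar> powr 2)"
    using p by (intro integrable_powr_smaller[OF i]; simp)+
  then have *: "integrable law (\<lambda>x. \<bar>x\<bar>)" "integrable law (\<lambda>x. \<bar>x\<bar>\<^sup>2)"
    by (simp_all add: powr_numeral)
  then show "integrable law (\<lambda>x. x\<^sup>2)" by simp
  show "integrable law (\<lambda>x. x)"
    using *(1) integrable_abs_cancel[of law "\<lambda>x. x"] by simp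
qed

definition pnorm :: "real \<Rightarrow> real" where
  "pnorm p = pmom p powr (1 / p)"

lemma pnorm_nonneg: "0 \<le> pnorm p"
  by (simp add: pnorm_def)

lemma trim_point_abs_le:
  assumes t: "trim_point n k m a b" and i: "integrable law (\<lambda>x. \<bar>x\<bar> powr p)" and p: "2 < p"
  shows "\<bar>a\<bar> \<le> pnorm p * (real k / real n) powr (- 1 / p)" "\<bar>b\<bar> \<le> pnorm p * (real m / real n) powr (- 1 / p)"
proof -
  have *: "\<bar>c\<bar> \<le> pnorm p * (real j / real n) powr (- 1 / p)"
    if c: "real j * \<bar>c\<bar> powr p \<le> real n * pmom p" and j: "1 \<le> j" "j < n" for c j
  proof -
    have pos: "0 < real j" "0 < real n" using j by auto
    have "\<bar>c\<bar> = (\<bar>c\<bar> powr p) powr (1 / p)" using p by (simp add: powr_powr)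
    also have "\<dots> \<le> (pmom p * (real j / real n) powr - 1) powr (1 / p)"
      using c pos p by (intro powr_mono2) (auto simp: field_simps powr_minus)
    also have "\<dots> = pnorm p * (real j / real n) powr (- 1 / p)"
    proof -
      have e: "((real j / real n) powr - 1) powr (1 / p) = (real j / real n) powr (- 1 / p)"
        unfolding powr_powr by simp
      show ?thesis unfolding e[symmetric] pnorm_def by (rule powr_mult)
    qed
    finally show ?thesis .
  qed
  have km: "1 \<le> k" "k < n" "1 \<le> m" "m < n" using t by (auto simp: trim_point_def)
  note pw = trim_point_powr[OF t i p]
  show "\<bar>a\<bar> \<le> pnorm p * (real k / real n) powr (- 1 / p)" "\<bar>b\<bar> \<le> pnorm p * (real m / real n) powr (- 1 / p)"
    by (rule *[OF pw(1) km(1,2)] *[OF pw(2) km(3,4)])+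
qed

text \<open>The estimates for one tail \<open>B\<close> and its cut value \<open>c\<close>, applied
  once to each end. On the tail |x| + |c| dominates what clipping removes; every factor |c| counts
  as \<alpha> to the power -1/p and the mass of the tail as \<alpha>.\<close>

lemma cut_moments:
  assumes i: "integrable law (\<lambda>x. \<bar>x\<bar> powr p)" and p: "2 < p"
    and B: "B \<in> sets borel" "measure law B \<le> \<alpha>" and \<alpha>: "0 < \<alpha>" and c: "\<bar>c\<bar> \<le> pnorm p * \<alpha> powr (- 1 / p)"
  shows "integrable law (\<lambda>x. (\<bar>x\<bar> + \<bar>c\<bar>) * indicator B x)"
    "integrable law (\<lambda>x. (\<bar>x\<bar> + \<bar>c\<bar>)\<^sup>2 * indicator B x)"
    "(\<integral>x. (\<bar>x\<bar> + \<bar>c\<bar>) * indicator B x \<partial>law) \<le> (1 + pmom p + pnorm p) * \<alpha> powr (1 - 1 / p)"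
    "(\<integral>x. (\<bar>x\<bar> + \<bar>c\<bar>)\<^sup>2 * indicator B x \<partial>law) \<le> 2 * (1 + pmom p + (pnorm p)\<^sup>2) * \<alpha> powr (1 - 2 / p)"
    "\<bar>c\<bar> * (\<integral>x. (\<bar>x\<bar> + \<bar>c\<bar>) * indicator B x \<partial>law) \<le> pnorm p * (1 + pmom p + pnorm p) * \<alpha> powr (1 - 2 / p)"
    "\<bar>\<alpha> * c\<bar> \<le> pnorm p * \<alpha> powr (1 - 1 / p)"
proof -
  note mom = integrable_moments[OF i p]
  have iB: "integrable law (indicator B :: real \<Rightarrow> real)"
    using B by (intro law.integrable_const_bound[where B = 1]) auto
  have i1: "integrable law (\<lambda>x. \<bar>x\<bar> * indicator B x)" and i2: "integrable law (\<lambda>x. x\<^sup>2 * indicator B x)"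
    using mom B by (auto intro!: integrable_real_mult_indicator)
  show I1: "integrable law (\<lambda>x. (\<bar>x\<bar> + \<bar>c\<bar>) * indicator B x)"
    unfolding distrib_right by (intro Bochner_Integration.integrable_add i1 integrable_mult_right iB)
  have I2b: "integrable law (\<lambda>x. 2 * (x\<^sup>2 * indicator B x) + 2 * (c\<^sup>2 * indicator B x))"
    by (intro Bochner_Integration.integrable_add i2 integrable_mult_right iB)
  have le2: "(\<bar>x\<bar> + \<bar>c\<bar>)\<^sup>2 * indicator B x \<le> 2 * (x\<^sup>2 * indicator B x) + 2 * (c\<^sup>2 * indicator B x)" for x
    using sum_squares_bound[of "\<bar>x\<bar>" "\<bar>c\<bar>"] by (auto simp: indicator_def power2_sum)
  show I2: "integrable law (\<lambda>x. (\<bar>x\<bar> + \<bar>c\<bar>)\<^sup>2 * indicator B x)"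
  proof (rule Bochner_Integration.integrable_bound[OF I2b])
    show "(\<lambda>x. (\<bar>x\<bar> + \<bar>c\<bar>)\<^sup>2 * indicator B x) \<in> borel_measurable law" using B by measurable
    show "AE x in law. norm ((\<bar>x\<bar> + \<bar>c\<bar>)\<^sup>2 * indicator B x) \<le> norm (2 * (x\<^sup>2 * indicator B x) + 2 * (c\<^sup>2 * indicator B x))"
      using le2 by (intro AE_I2) (auto intro: order_trans[OF _ abs_ge_self] simp: abs_mult)
  qed
  have mB: "(\<integral>x. indicator B x \<partial>law) \<le> \<alpha>" using B by simp
  have pw1: "\<alpha> powr (- 1 / p) * \<alpha> = \<alpha> powr (1 - 1 / p)" using \<alpha> by (simp add: powr_mult_base powr_diff powr_minus field_simps)
  have pw2: "\<alpha> powr (- 1 / p) * \<alpha> powr (1 - 1 / p) = \<alpha> powr (1 - 2 / p)"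
    using \<alpha> by (simp add: powr_add[symmetric])
  have ca: "\<bar>c\<bar> * \<alpha> \<le> pnorm p * \<alpha> powr (1 - 1 / p)"
    using mult_right_mono[OF c, of \<alpha>] \<alpha> by (simp only: mult.assoc pw1)
  then show "\<bar>\<alpha> * c\<bar> \<le> pnorm p * \<alpha> powr (1 - 1 / p)" using \<alpha> by (simp add: abs_mult mult.commute)
  have "(\<integral>x. (\<bar>x\<bar> + \<bar>c\<bar>) * indicator B x \<partial>law) = (\<integral>x. \<bar>x\<bar> * indicator B x \<partial>law) + \<bar>c\<bar> * (\<integral>x. indicator B x \<partial>law)"
    unfolding distrib_right using i1 iB by simp
  also have "\<dots> \<le> (1 + pmom p) * \<alpha> powr (1 - 1 / p) + \<bar>c\<bar> * \<alpha>"
    using tail_powr_moment[OF i _ _ B \<alpha>, of 1] p mB by (intro add_mono mult_left_mono) auto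
  also have "\<dots> \<le> (1 + pmom p + pnorm p) * \<alpha> powr (1 - 1 / p)"
    using ca by (simp add: algebra_simps)
  finally show m1: "(\<integral>x. (\<bar>x\<bar> + \<bar>c\<bar>) * indicator B x \<partial>law) \<le> (1 + pmom p + pnorm p) * \<alpha> powr (1 - 1 / p)" .
  have "\<bar>c\<bar> * (\<integral>x. (\<bar>x\<bar> + \<bar>c\<bar>) * indicator B x \<partial>law) \<le>
      (pnorm p * \<alpha> powr (- 1 / p)) * ((1 + pmom p + pnorm p) * \<alpha> powr (1 - 1 / p))"
    using pnorm_nonneg by (intro mult_mono c m1 integral_nonneg_AE AE_I2) auto
  also have "\<dots> = pnorm p * (1 + pmom p + pnorm p) * (\<alpha> powr (- 1 / p) * \<alpha> powr (1 - 1 / p))"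
    by (simp only: mult_ac)
  finally show "\<bar>c\<bar> * (\<integral>x. (\<bar>x\<bar> + \<bar>c\<bar>) * indicator B x \<partial>law) \<le> pnorm p * (1 + pmom p + pnorm p) * \<alpha> powr (1 - 2 / p)"
    unfolding pw2 .
  have c2: "c\<^sup>2 * \<alpha> \<le> (pnorm p)\<^sup>2 * \<alpha> powr (1 - 2 / p)"
  proof -
    have "c\<^sup>2 * \<alpha> = \<bar>c\<bar> * (\<bar>c\<bar> * \<alpha>)" by (simp add: power2_eq_square mult.assoc[symmetric])
    also have "\<dots> \<le> (pnorm p * \<alpha> powr (- 1 / p)) * (pnorm p * \<alpha> powr (1 - 1 / p))"
      using \<alpha> pnorm_nonneg by (intro mult_mono c ca) auto
    also have "\<dots> = (pnorm p)\<^sup>2 * (\<alpha> powr (- 1 / p) * \<alpha> powr (1 - 1 / p))" by (simp only: power2_eq_square mult_ac)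
    finally show ?thesis unfolding pw2 .
  qed
  have "(\<integral>x. (\<bar>x\<bar> + \<bar>c\<bar>)\<^sup>2 * indicator B x \<partial>law) \<le> (\<integral>x. 2 * (x\<^sup>2 * indicator B x) + 2 * (c\<^sup>2 * indicator B x) \<partial>law)"
    by (rule integral_mono[OF I2 I2b le2])
  also have "\<dots> = 2 * (\<integral>x. \<bar>x\<bar> powr 2 * indicator B x \<partial>law) + 2 * (c\<^sup>2 * (\<integral>x. indicator B x \<partial>law))"
    using i2 iB by (simp add: powr_numeral)
  also have "\<dots> \<le> 2 * ((1 + pmom p) * \<alpha> powr (1 - 2 / p)) + 2 * (c\<^sup>2 * \<alpha>)"
    using tail_powr_moment[OF i _ _ B \<alpha>, of 2] p mB by (intro add_mono mult_left_mono) auto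
  also have "\<dots> \<le> 2 * (1 + pmom p + (pnorm p)\<^sup>2) * \<alpha> powr (1 - 2 / p)"
    using c2 by (simp add: algebra_simps)
  finally show "(\<integral>x. (\<bar>x\<bar> + \<bar>c\<bar>)\<^sup>2 * indicator B x \<partial>law) \<le> 2 * (1 + pmom p + (pnorm p)\<^sup>2) * \<alpha> powr (1 - 2 / p)" .
qed

text \<open>The function \<open>g\<close> vanishes between the cuts and beyond a cut it is at most
  |x| plus the absolute value of the cut, so every integral splits into two one-sided ones.\<close>

lemma clip_mean_error:
  assumes t: "trim_point n k m a b" and i: "integrable law (\<lambda>x. \<bar>x\<bar> powr p)" and p: "2 < p"
  defines "\<alpha> \<equiv> real k / real n" and "\<beta> \<equiv> real m / real n"
  defines "g \<equiv> \<lambda>x. x - clip a b x"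
  shows "\<bar>\<integral>x. g x \<partial>law\<bar> \<le> (1 + pmom p + pnorm p) * (\<alpha> powr (1 - 1 / p) + \<beta> powr (1 - 1 / p))"
    "integrable law (\<lambda>x. (g x)\<^sup>2)"
    "(\<integral>x. (g x)\<^sup>2 \<partial>law) \<le> 2 * (1 + pmom p + (pnorm p)\<^sup>2) * (\<alpha> powr (1 - 2 / p) + \<beta> powr (1 - 2 / p))"
    "integrable law (\<lambda>x. clip a b x * g x)"
    "\<bar>\<integral>x. clip a b x * g x \<partial>law\<bar> \<le> pnorm p * (1 + pmom p + pnorm p) * (\<alpha> powr (1 - 2 / p) + \<beta> powr (1 - 2 / p))"
    "\<bar>\<alpha> * a + \<beta> * b\<bar> \<le> pnorm p * (\<alpha> powr (1 - 1 / p) + \<beta> powr (1 - 1 / p))"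
proof -
  have km: "0 < \<alpha>" "0 < \<beta>" "a \<le> b" and mB: "measure law {..<a} \<le> \<alpha>" "measure law {b<..} \<le> \<beta>"
    using t unfolding trim_point_def \<alpha>_def \<beta>_def by (auto simp: field_simps)
  note ab = trim_point_abs_le[OF t i p, folded \<alpha>_def \<beta>_def]
  define A1 where "A1 x = (\<bar>x\<bar> + \<bar>a\<bar>) * indicator {..<a} x" for x
  define B1 where "B1 x = (\<bar>x\<bar> + \<bar>b\<bar>) * indicator {b<..} x" for x
  define A2 where "A2 x = (\<bar>x\<bar> + \<bar>a\<bar>)\<^sup>2 * indicator {..<a} x" for x
  define B2 where "B2 x = (\<bar>x\<bar> + \<bar>b\<bar>)\<^sup>2 * indicator {b<..} x" for x
  have sB: "{..<a} \<in> sets borel" "{b<..} \<in> sets borel" by simp_all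
  note A = cut_moments[OF i p sB(1) mB(1) km(1) ab(1), folded A1_def A2_def]
  note B = cut_moments[OF i p sB(2) mB(2) km(2) ab(2), folded B1_def B2_def]
  note [measurable] = law.clip_measurable
  have gm[measurable]: "g \<in> borel_measurable borel" unfolding g_def by measurable
  have le1: "\<bar>g x\<bar> \<le> A1 x + B1 x" for x
    using km(3) by (auto simp: g_def clip_def A1_def B1_def indicator_def)
  have le2: "(g x)\<^sup>2 \<le> A2 x + B2 x" for x
  proof -
    have "(g x)\<^sup>2 \<le> (A1 x + B1 x)\<^sup>2" using power_mono[OF le1[of x], of 2] by simp
    also have "\<dots> = A2 x + B2 x" using km(3) by (auto simp: A1_def B1_def A2_def B2_def indicator_def)
    finally show ?thesis .
  qed
  have le3: "\<bar>clip a b x * g x\<bar> \<le> \<bar>a\<bar> * A1 x + \<bar>b\<bar> * B1 x" for x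
  proof -
    \<comment> \<open>Wherever \<open>g\<close> does not vanish the clipped value is the cut itself,
      so the product is linear in \<open>g\<close>.\<close>
    have "clip a b x * g x = (if x < a then a * g x else if b < x then b * g x else 0)"
      using km(3) by (auto simp: clip_def g_def)
    then show ?thesis using le1[of x] km(3) by (auto simp: abs_mult A1_def B1_def mult_left_mono indicator_def)
  qed
  have i1: "integrable law (\<lambda>x. A1 x + B1 x)" and i2: "integrable law (\<lambda>x. A2 x + B2 x)"
    and i3: "integrable law (\<lambda>x. \<bar>a\<bar> * A1 x + \<bar>b\<bar> * B1 x)"
    using A(1,2) B(1,2) by (auto simp: A1_def[abs_def] A2_def[abs_def] B1_def[abs_def] B2_def[abs_def])
  have ig: "integrable law g"
    by (rule law_integrable_bound[OF i1 gm le1])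
  have ig2: "integrable law (\<lambda>x. (g x)\<^sup>2)"
    by (rule law_integrable_bound[OF i2]) (use le2 in simp_all)
  have ig3: "integrable law (\<lambda>x. clip a b x * g x)"
    by (rule law_integrable_bound[OF i3 _ le3]) measurable
  have a0: "0 \<le> \<bar>a\<bar>" "0 \<le> \<bar>b\<bar>" by simp_all
  have "\<bar>\<integral>x. g x \<partial>law\<bar> \<le> (\<integral>x. \<bar>g x\<bar> \<partial>law)" by (rule integral_abs_bound)
  also have "\<dots> \<le> (\<integral>x. A1 x + B1 x \<partial>law)" using ig i1 le1 by (intro integral_mono) auto
  also have "\<dots> = (\<integral>x. A1 x \<partial>law) + (\<integral>x. B1 x \<partial>law)" using A(1) B(1) by simp
  also have "\<dots> \<le> (1 + pmom p + pnorm p) * (\<alpha> powr (1 - 1 / p) + \<beta> powr (1 - 1 / p))"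
    unfolding distrib_left[of _ "\<alpha> powr (1 - 1 / p)"] by (intro add_mono A B)
  finally show "\<bar>\<integral>x. g x \<partial>law\<bar> \<le> (1 + pmom p + pnorm p) * (\<alpha> powr (1 - 1 / p) + \<beta> powr (1 - 1 / p))" .
  show "integrable law (\<lambda>x. (g x)\<^sup>2)" by (rule ig2)
  have "(\<integral>x. (g x)\<^sup>2 \<partial>law) \<le> (\<integral>x. A2 x + B2 x \<partial>law)" by (rule integral_mono[OF ig2 i2 le2])
  also have "\<dots> = (\<integral>x. A2 x \<partial>law) + (\<integral>x. B2 x \<partial>law)" using A(2) B(2) by simp
  also have "\<dots> \<le> 2 * (1 + pmom p + (pnorm p)\<^sup>2) * (\<alpha> powr (1 - 2 / p) + \<beta> powr (1 - 2 / p))"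
    unfolding distrib_left[of _ "\<alpha> powr (1 - 2 / p)"] by (intro add_mono A B)
  finally show "(\<integral>x. (g x)\<^sup>2 \<partial>law) \<le> 2 * (1 + pmom p + (pnorm p)\<^sup>2) * (\<alpha> powr (1 - 2 / p) + \<beta> powr (1 - 2 / p))" .
  show "integrable law (\<lambda>x. clip a b x * g x)" by (rule ig3)
  have "\<bar>\<integral>x. clip a b x * g x \<partial>law\<bar> \<le> (\<integral>x. \<bar>clip a b x * g x\<bar> \<partial>law)" by (rule integral_abs_bound)
  also have "\<dots> \<le> (\<integral>x. \<bar>a\<bar> * A1 x + \<bar>b\<bar> * B1 x \<partial>law)" using ig3 i3 le3 by (intro integral_mono) auto
  also have "\<dots> = \<bar>a\<bar> * (\<integral>x. A1 x \<partial>law) + \<bar>b\<bar> * (\<integral>x. B1 x \<partial>law)" using A(1) B(1) by simp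
  also have "\<dots> \<le> pnorm p * (1 + pmom p + pnorm p) * (\<alpha> powr (1 - 2 / p) + \<beta> powr (1 - 2 / p))"
    unfolding distrib_left[of _ "\<alpha> powr (1 - 2 / p)"] by (intro add_mono A B)
  finally show "\<bar>\<integral>x. clip a b x * g x \<partial>law\<bar> \<le> pnorm p * (1 + pmom p + pnorm p) * (\<alpha> powr (1 - 2 / p) + \<beta> powr (1 - 2 / p))" .
  show "\<bar>\<alpha> * a + \<beta> * b\<bar> \<le> pnorm p * (\<alpha> powr (1 - 1 / p) + \<beta> powr (1 - 1 / p))"
    unfolding distrib_left[of _ "\<alpha> powr (1 - 1 / p)"] by (rule order_trans[OF abs_triangle_ineq]) (intro add_mono A B)
qed

definition lvar :: "(real \<Rightarrow> real) \<Rightarrow> real" where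
  "lvar f = (\<integral>x. (f x)\<^sup>2 \<partial>law) - (\<integral>x. f x \<partial>law)\<^sup>2"

text \<open>With x = W + g the variances differ by 2 E(W g) + E g^2 + G^2 - 2 \<mu> G, where G is
  the mean of \<open>g\<close>. The first two terms and G^2 are of order \<open>s2\<close>; G is of
  order \<open>s1\<close>, which is at most \<open>s2\<close> because the fractions do not exceed
  1.\<close>

lemma clip_variance_error:
  assumes t: "trim_point n k m a b" and i: "integrable law (\<lambda>x. \<bar>x\<bar> powr p)" and p: "2 < p"
  defines "\<alpha> \<equiv> real k / real n" and "\<beta> \<equiv> real m / real n"
  defines "K \<equiv> 4 * (1 + pmom p + (pnorm p)\<^sup>2) + (2 * pnorm p + 2 * \<bar>\<integral>x. x \<partial>law\<bar>) * (1 + pmom p + pnorm p)"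
  shows "\<bar>lvar (\<lambda>x. x) - lvar (clip a b)\<bar> \<le> K * (\<alpha> powr (1 - 2 / p) + \<beta> powr (1 - 2 / p))"
proof -
  define W where "W = clip a b"
  define g where "g x = x - W x" for x
  define s1 where "s1 = \<alpha> powr (1 - 1 / p) + \<beta> powr (1 - 1 / p)"
  define s2 where "s2 = \<alpha> powr (1 - 2 / p) + \<beta> powr (1 - 2 / p)"
  note E = clip_mean_error[OF t i p, folded \<alpha>_def \<beta>_def W_def, folded g_def s1_def s2_def]
  have km: "0 < \<alpha>" "\<alpha> \<le> 1" "0 < \<beta>" "\<beta> \<le> 1"
    using t unfolding trim_point_def \<alpha>_def \<beta>_def by auto
  have s12: "s1 \<le> s2" unfolding s1_def s2_def using km p by (intro add_mono powr_mono') (auto simp: divide_right_mono)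
  have s0: "0 \<le> s2" by (simp add: s2_def)
  note mom = integrable_moments[OF i p]
  have iW: "integrable law W" unfolding W_def by (rule law.integrable_clip)
  have ig: "integrable law g" unfolding g_def using mom iW by simp
  have iW2: "integrable law (\<lambda>x. (W x)\<^sup>2)"
  proof -
    have "(\<lambda>x. (W x)\<^sup>2) = (\<lambda>x. x\<^sup>2 - 2 * (W x * g x) - (g x)\<^sup>2)"
      by (simp add: g_def fun_eq_iff power2_eq_square algebra_simps)
    then show ?thesis by (simp only:) (intro Bochner_Integration.integrable_diff integrable_mult_right mom E)
  qed
  have m2: "(\<integral>x. x\<^sup>2 \<partial>law) = (\<integral>x. (W x)\<^sup>2 \<partial>law) + 2 * (\<integral>x. W x * g x \<partial>law) + (\<integral>x. (g x)\<^sup>2 \<partial>law)"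
  proof -
    have "(\<integral>x. x\<^sup>2 \<partial>law) = (\<integral>x. (W x)\<^sup>2 + 2 * (W x * g x) + (g x)\<^sup>2 \<partial>law)"
      by (intro Bochner_Integration.integral_cong) (auto simp: g_def power2_eq_square algebra_simps)
    then show ?thesis using iW2 E(2,4) by simp
  qed
  have m1: "(\<integral>x. W x \<partial>law) = (\<integral>x. x \<partial>law) - (\<integral>x. g x \<partial>law)"
    unfolding g_def using mom iW by simp
  define G where "G = (\<integral>x. g x \<partial>law)"
  define \<mu> where "\<mu> = (\<integral>x. x \<partial>law)"
  have G2: "G\<^sup>2 \<le> (\<integral>x. (g x)\<^sup>2 \<partial>law)"
  proof -
    have "0 \<le> (\<integral>x. (g x - G)\<^sup>2 \<partial>law)" by (intro integral_nonneg_AE AE_I2) simp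
    also have "\<dots> = (\<integral>x. (g x)\<^sup>2 \<partial>law) - G\<^sup>2"
      unfolding G_def using law.variance_eq[OF ig E(2)] .
    finally show ?thesis by simp
  qed
  have "lvar (\<lambda>x. x) - lvar W = 2 * (\<integral>x. W x * g x \<partial>law) + (\<integral>x. (g x)\<^sup>2 \<partial>law) + G\<^sup>2 - 2 * \<mu> * G"
    unfolding lvar_def m2 m1 G_def[symmetric] \<mu>_def[symmetric] by (simp add: power2_eq_square algebra_simps)
  have "\<bar>lvar (\<lambda>x. x) - lvar W\<bar> \<le> 2 * \<bar>\<integral>x. W x * g x \<partial>law\<bar> + 2 * (\<integral>x. (g x)\<^sup>2 \<partial>law) + 2 * \<bar>\<mu>\<bar> * \<bar>G\<bar>"
  proof -
    have "\<bar>2 * w + q + v - 2 * \<mu> * G\<bar> \<le> 2 * \<bar>w\<bar> + 2 * q + 2 * \<bar>\<mu>\<bar> * \<bar>G\<bar>" if "0 \<le> v" "v \<le> q" for w q v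
    proof -
      have "\<bar>2 * w + q + v - 2 * \<mu> * G\<bar> \<le> 2 * \<bar>w\<bar> + \<bar>q\<bar> + \<bar>v\<bar> + \<bar>2 * \<mu> * G\<bar>" by linarith
      also have "\<bar>2 * \<mu> * G\<bar> = 2 * \<bar>\<mu>\<bar> * \<bar>G\<bar>" by (simp add: abs_mult)
      finally show ?thesis using that by simp
    qed
    from this[OF zero_le_power2 G2] show ?thesis
      using \<open>lvar (\<lambda>x. x) - lvar W = _\<close> by (simp only:)
  qed
  also have "\<dots> \<le> 2 * (pnorm p * (1 + pmom p + pnorm p) * s2) + 2 * (2 * (1 + pmom p + (pnorm p)\<^sup>2) * s2) +
      2 * \<bar>\<mu>\<bar> * ((1 + pmom p + pnorm p) * s2)"
  proof (intro add_mono mult_left_mono)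
    show "\<bar>G\<bar> \<le> (1 + pmom p + pnorm p) * s2"
      unfolding G_def using E(1) mult_left_mono[OF s12, of "1 + pmom p + pnorm p"] pmom_nonneg[of p] pnorm_nonneg[of p]
      by linarith
  qed (use E in auto)
  also have "\<dots> = K * s2" unfolding K_def \<mu>_def by (simp add: algebra_simps)
  finally show ?thesis unfolding W_def s2_def .
qed

end

section \<open>Mean and variance of the trimmed mean\<close>

context prob_space
begin

lemma integrable_mult_of_squares:
  fixes u v :: "'a \<Rightarrow> real"
  assumes [measurable]: "u \<in> borel_measurable M" "v \<in> borel_measurable M"
    and i: "integrable M (\<lambda>\<omega>. (u \<omega>)\<^sup>2)" "integrable M (\<lambda>\<omega>. (v \<omega>)\<^sup>2)"
  shows "integrable M (\<lambda>\<omega>. u \<omega> * v \<omega>)"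
proof (rule Bochner_Integration.integrable_bound)
  show "integrable M (\<lambda>\<omega>. (u \<omega>)\<^sup>2 + (v \<omega>)\<^sup>2)" using i by simp
  have "\<bar>x * y\<bar> \<le> x\<^sup>2 + y\<^sup>2" for x y :: real
  proof -
    have "2 * \<bar>x * y\<bar> \<le> x\<^sup>2 + y\<^sup>2"
      using sum_squares_bound[of "\<bar>x\<bar>" "\<bar>y\<bar>"] by (simp add: abs_mult mult.assoc)
    then show ?thesis using abs_ge_zero[of "x * y"] by linarith
  qed
  then show "AE \<omega> in M. norm (u \<omega> * v \<omega>) \<le> norm ((u \<omega>)\<^sup>2 + (v \<omega>)\<^sup>2)"
    by (intro AE_I2) simp
qed measurable

lemma integrable_of_square:
  fixes u :: "'a \<Rightarrow> real"
  assumes "u \<in> borel_measurable M" "integrable M (\<lambda>\<omega>. (u \<omega>)\<^sup>2)"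
  shows "integrable M u"
  using integrable_mult_of_squares[OF assms(1), of "\<lambda>_. 1"] assms by simp

lemma cauchy_schwarz_expectation:
  fixes u v :: "'a \<Rightarrow> real"
  assumes m: "u \<in> borel_measurable M" "v \<in> borel_measurable M"
    and i: "integrable M (\<lambda>\<omega>. (u \<omega>)\<^sup>2)" "integrable M (\<lambda>\<omega>. (v \<omega>)\<^sup>2)"
  shows "\<bar>expectation (\<lambda>\<omega>. u \<omega> * v \<omega>)\<bar> \<le> sqrt (expectation (\<lambda>\<omega>. (u \<omega>)\<^sup>2)) * sqrt (expectation (\<lambda>\<omega>. (v \<omega>)\<^sup>2))"
proof -
  define A B C where "A = expectation (\<lambda>\<omega>. (u \<omega>)\<^sup>2)" and "B = expectation (\<lambda>\<omega>. u \<omega> * v \<omega>)"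
    and "C = expectation (\<lambda>\<omega>. (v \<omega>)\<^sup>2)"
  have iuv: "integrable M (\<lambda>\<omega>. u \<omega> * v \<omega>)" by (rule integrable_mult_of_squares[OF m i])
  have q: "0 \<le> A + 2 * t * B + t\<^sup>2 * C" for t
  proof -
    have "0 \<le> expectation (\<lambda>\<omega>. (u \<omega> + t * v \<omega>)\<^sup>2)" by (intro integral_nonneg_AE AE_I2) simp
    also have "\<dots> = expectation (\<lambda>\<omega>. (u \<omega>)\<^sup>2 + 2 * t * (u \<omega> * v \<omega>) + t\<^sup>2 * (v \<omega>)\<^sup>2)"
      by (intro Bochner_Integration.integral_cong) (auto simp: power2_eq_square algebra_simps)
    also have "\<dots> = A + 2 * t * B + t\<^sup>2 * C"
      unfolding A_def B_def C_def using i iuv by simp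
    finally show ?thesis .
  qed
  have C0: "0 \<le> C" unfolding C_def by (intro integral_nonneg_AE AE_I2) simp
  have "B\<^sup>2 \<le> A * C"
  proof (cases "C = 0")
    case True
    have "B = 0"
    proof (rule ccontr)
      assume "B \<noteq> 0"
      \<comment> \<open>For C = 0 the quadratic is affine in t; at this t its value is A - (A + 1) =
        -1.\<close>
      then have "2 * (- (A + 1) / (2 * B)) * B = - (A + 1)" by simp
      with q[of "- (A + 1) / (2 * B)"] True show False by simp
    qed
    then show ?thesis using True by simp
  next
    case False
    then have "0 < C" using C0 by simp
    have "0 \<le> (A + 2 * (- B / C) * B + (- B / C)\<^sup>2 * C) * C"
      using q[of "- B / C"] C0 by (intro mult_nonneg_nonneg)
    also have "\<dots> = A * C - B\<^sup>2" using \<open>0 < C\<close> by (simp add: power2_eq_square field_simps)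
    finally show ?thesis by simp
  qed
  then have "sqrt (B\<^sup>2) \<le> sqrt (A * C)" by (rule real_sqrt_le_mono)
  then show ?thesis unfolding A_def B_def C_def by (simp add: real_sqrt_mult)
qed

text \<open>The triangle inequality in L^2 for \<open>u\<close> and the centred \<open>v\<close>.
  Centring only lowers the second moment of \<open>v\<close>, so the bound may be stated with
  \<open>v\<close> itself.\<close>

lemma sd_perturbation:
  fixes u v :: "'a \<Rightarrow> real"
  assumes m: "u \<in> borel_measurable M" "v \<in> borel_measurable M"
    and i: "integrable M (\<lambda>\<omega>. (u \<omega>)\<^sup>2)" "integrable M (\<lambda>\<omega>. (v \<omega>)\<^sup>2)" and u0: "expectation u = 0"
  shows "\<bar>sqrt (variance (\<lambda>\<omega>. u \<omega> + v \<omega>)) - sqrt (expectation (\<lambda>\<omega>. (u \<omega>)\<^sup>2))\<bar> \<le> sqrt (expectation (\<lambda>\<omega>. (v \<omega>)\<^sup>2))"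
    "\<bar>expectation v\<bar> \<le> sqrt (expectation (\<lambda>\<omega>. (v \<omega>)\<^sup>2))"
proof -
  note iu = integrable_of_square[OF m(1) i(1)] and iv = integrable_of_square[OF m(2) i(2)]
  define e where "e = expectation v"
  define w where "w \<omega> = v \<omega> - e" for \<omega>
  have mw: "w \<in> borel_measurable M" unfolding w_def using m by measurable
  have iw: "integrable M (\<lambda>\<omega>. (w \<omega>)\<^sup>2)"
    unfolding w_def power2_diff using i iv by auto
  show "\<bar>expectation v\<bar> \<le> sqrt (expectation (\<lambda>\<omega>. (v \<omega>)\<^sup>2))"
    using cauchy_schwarz_expectation[OF m(2) _ i(2), of "\<lambda>_. 1"] by (simp add: prob_space)
  have "expectation (\<lambda>\<omega>. (w \<omega>)\<^sup>2) = expectation (\<lambda>\<omega>. (v \<omega>)\<^sup>2) - e\<^sup>2"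
    unfolding w_def e_def by (rule variance_eq[OF iv i(2)])
  then have wv: "expectation (\<lambda>\<omega>. (w \<omega>)\<^sup>2) \<le> expectation (\<lambda>\<omega>. (v \<omega>)\<^sup>2)" by simp
  define A C where "A = sqrt (expectation (\<lambda>\<omega>. (u \<omega>)\<^sup>2))" and "C = sqrt (expectation (\<lambda>\<omega>. (w \<omega>)\<^sup>2))"
  have A: "0 \<le> A" "A\<^sup>2 = expectation (\<lambda>\<omega>. (u \<omega>)\<^sup>2)" and C: "0 \<le> C" "C\<^sup>2 = expectation (\<lambda>\<omega>. (w \<omega>)\<^sup>2)"
    unfolding A_def C_def by (auto intro!: integral_nonneg_AE)
  define V where "V = variance (\<lambda>\<omega>. u \<omega> + v \<omega>)"
  have "expectation (\<lambda>\<omega>. u \<omega> + v \<omega>) = e" using iu iv u0 by (simp add: e_def)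
  then have "V = expectation (\<lambda>\<omega>. (u \<omega>)\<^sup>2 + 2 * (u \<omega> * w \<omega>) + (w \<omega>)\<^sup>2)"
    unfolding V_def by (intro Bochner_Integration.integral_cong) (auto simp: w_def power2_eq_square algebra_simps)
  also have "\<dots> = A\<^sup>2 + 2 * expectation (\<lambda>\<omega>. u \<omega> * w \<omega>) + C\<^sup>2"
    using i iw integrable_mult_of_squares[OF m(1) mw i(1) iw] A C by simp
  finally have V: "V = A\<^sup>2 + 2 * expectation (\<lambda>\<omega>. u \<omega> * w \<omega>) + C\<^sup>2" .
  have cs: "\<bar>expectation (\<lambda>\<omega>. u \<omega> * w \<omega>)\<bar> \<le> A * C"
    unfolding A_def C_def by (rule cauchy_schwarz_expectation[OF m(1) mw i(1) iw])
  have "V \<le> (A + C)\<^sup>2" "(A - C)\<^sup>2 \<le> V" using V cs by (auto simp: power2_eq_square algebra_simps)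
  then have "sqrt V \<le> A + C" "\<bar>A - C\<bar> \<le> sqrt V"
    using A C real_sqrt_le_mono[of V "(A + C)\<^sup>2"] real_sqrt_le_mono[of "(A - C)\<^sup>2" V] by auto
  then have "\<bar>sqrt V - A\<bar> \<le> C" by linarith
  also have "C \<le> sqrt (expectation (\<lambda>\<omega>. (v \<omega>)\<^sup>2))" unfolding C_def by (rule real_sqrt_le_mono[OF wv])
  finally show "\<bar>sqrt (variance (\<lambda>\<omega>. u \<omega> + v \<omega>)) - sqrt (expectation (\<lambda>\<omega>. (u \<omega>)\<^sup>2))\<bar> \<le> sqrt (expectation (\<lambda>\<omega>. (v \<omega>)\<^sup>2))"
    unfolding V_def A_def .
qed

text \<open>The claims form one conjunction because the induction step needs all of them: the cross
  term vanishes through the zero means, and the product formula needs integrability of the partial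
  sum.\<close>

lemma indep_sum_second_moment:
  fixes Z :: "'i \<Rightarrow> 'a \<Rightarrow> real"
  assumes "finite I" "indep_vars (\<lambda>_. borel) Z I" and B: "\<And>i \<omega>. i \<in> I \<Longrightarrow> \<bar>Z i \<omega>\<bar> \<le> B"
    and "\<And>i. i \<in> I \<Longrightarrow> expectation (Z i) = 0" "\<And>i. i \<in> I \<Longrightarrow> expectation (\<lambda>\<omega>. (Z i \<omega>)\<^sup>2) = v"
  shows "integrable M (\<lambda>\<omega>. (\<Sum>i\<in>I. Z i \<omega>)\<^sup>2) \<and> expectation (\<lambda>\<omega>. \<Sum>i\<in>I. Z i \<omega>) = 0 \<and>
    expectation (\<lambda>\<omega>. (\<Sum>i\<in>I. Z i \<omega>)\<^sup>2) = real (card I) * v"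
  using assms
proof (induction I rule: finite_induct)
  case empty
  then show ?case by simp
next
  case (insert i I)
  have Zm: "Z j \<in> borel_measurable M" if "j \<in> insert i I" for j
    using insert.prems(1) that unfolding indep_vars_def by auto
  define S where "S \<omega> = (\<Sum>j\<in>I. Z j \<omega>)" for \<omega>
  have IH: "integrable M (\<lambda>\<omega>. (S \<omega>)\<^sup>2)" "expectation S = 0" "expectation (\<lambda>\<omega>. (S \<omega>)\<^sup>2) = real (card I) * v"
    unfolding S_def[abs_def] using insert.IH[OF indep_vars_subset[OF insert.prems(1)]] insert.prems by auto
  have Sm: "S \<in> borel_measurable M" unfolding S_def[abs_def] using Zm by (intro borel_measurable_sum) auto
  note iS = integrable_of_square[OF Sm IH(1)]
  have iZ: "integrable M (Z i)" by (rule integrable_const_bound[where B = B]) (use insert.prems Zm in auto)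
  have iZ2: "integrable M (\<lambda>\<omega>. (Z i \<omega>)\<^sup>2)"
  proof (rule integrable_const_bound[where B = "B\<^sup>2"])
    show "AE x in M. norm ((Z i x)\<^sup>2) \<le> B\<^sup>2"
      using insert.prems(2)[of i] power_mono[of "\<bar>Z i _\<bar>" B 2] by (intro AE_I2) auto
    show "(\<lambda>\<omega>. (Z i \<omega>)\<^sup>2) \<in> borel_measurable M" using Zm by measurable
  qed
  have ind: "indep_var borel (Z i) borel S"
    unfolding S_def[abs_def] by (rule indep_vars_sum) (use insert in auto)
  have prod: "integrable M (\<lambda>\<omega>. Z i \<omega> * S \<omega>)" "expectation (\<lambda>\<omega>. Z i \<omega> * S \<omega>) = 0"
    using indep_var_integrable[OF ind iZ iS] indep_var_lebesgue_integral[OF ind iZ iS] IH by auto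
  have sum: "(\<Sum>j\<in>insert i I. Z j \<omega>) = Z i \<omega> + S \<omega>" for \<omega> using insert.hyps by (simp add: S_def)
  have sq: "(\<Sum>j\<in>insert i I. Z j \<omega>)\<^sup>2 = (Z i \<omega>)\<^sup>2 + 2 * (Z i \<omega> * S \<omega>) + (S \<omega>)\<^sup>2" for \<omega>
    unfolding sum by (simp add: power2_sum)
  show ?case
    unfolding sq unfolding sum using prod iZ2 IH iZ iS insert.prems(3,4) insert.hyps by (simp add: distrib_right)
qed

end

context iid_sample
begin

definition centered :: "real \<Rightarrow> real \<Rightarrow> real \<Rightarrow> real" where
  "centered a b x = clip a b x - (\<integral>y. clip a b y \<partial>law)"

lemma centered_measurable[measurable]: "centered a b \<in> borel_measurable borel"
  unfolding centered_def[abs_def] using law.clip_measurable by measurable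

lemma clip_mean_bounded: "\<bar>\<integral>y. clip a b y \<partial>law\<bar> \<le> max \<bar>a\<bar> \<bar>b\<bar>"
proof -
  have "\<bar>\<integral>y. clip a b y \<partial>law\<bar> \<le> (\<integral>y. \<bar>clip a b y\<bar> \<partial>law)" by (rule integral_abs_bound)
  also have "\<dots> \<le> max \<bar>a\<bar> \<bar>b\<bar>"
    using law.integrable_clip law.clip_bounded by (intro law.integral_le_const) auto
  finally show ?thesis .
qed

lemma centered_bounded: "\<bar>centered a b x\<bar> \<le> 2 * max \<bar>a\<bar> \<bar>b\<bar>"
proof -
  have "\<bar>centered a b x\<bar> \<le> \<bar>clip a b x\<bar> + \<bar>\<integral>y. clip a b y \<partial>law\<bar>"
    unfolding centered_def by (rule abs_triangle_ineq4)
  also have "\<dots> \<le> max \<bar>a\<bar> \<bar>b\<bar> + max \<bar>a\<bar> \<bar>b\<bar>"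
    by (rule add_mono[OF law.clip_bounded clip_mean_bounded])
  finally show ?thesis by simp
qed

lemma centered_moments:
  "integrable law (centered a b)" "(\<integral>x. centered a b x \<partial>law) = 0"
  "integrable law (\<lambda>x. (centered a b x)\<^sup>2)" "(\<integral>x. (centered a b x)\<^sup>2 \<partial>law) = lvar (clip a b)"
proof -
  note ic = law.integrable_clip[of a b]
  show "integrable law (centered a b)"
    unfolding centered_def[abs_def] by (intro Bochner_Integration.integrable_diff ic law.integrable_const)
  show "(\<integral>x. centered a b x \<partial>law) = 0"
    unfolding centered_def using Bochner_Integration.integral_diff[OF ic law.integrable_const] law.prob_space by simp
  have sq: "integrable law (\<lambda>x. (f x)\<^sup>2)"
    if f: "f \<in> borel_measurable borel" and B: "\<And>x. \<bar>f x\<bar> \<le> B" for f :: "real \<Rightarrow> real" and B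
  proof (rule law_integrable_bound[OF law.integrable_const])
    show "(\<lambda>x. (f x)\<^sup>2) \<in> borel_measurable borel" using f by measurable
    show "\<bar>(f x)\<^sup>2\<bar> \<le> B\<^sup>2" for x using power_mono[OF B, of x 2] by simp
  qed
  have ic2: "integrable law (\<lambda>x. (clip a b x)\<^sup>2)"
    by (rule sq[OF law.clip_measurable law.clip_bounded])
  show "integrable law (\<lambda>x. (centered a b x)\<^sup>2)"
    by (rule sq[OF centered_measurable centered_bounded])
  show "(\<integral>x. (centered a b x)\<^sup>2 \<partial>law) = lvar (clip a b)"
    unfolding centered_def lvar_def by (rule law.variance_eq[OF ic ic2])
qed

lemma winsorized_sd_eq:
  assumes km: "1 \<le> k n" "1 \<le> m n" "k n + m n < n"
  shows "winsorized_sd M X k m n = sqrt (lvar (clip (qt (trim_frac k n)) (qt (1 - trim_frac m n))))"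
proof -
  define a b where "a = qt (trim_frac k n)" and "b = qt (1 - trim_frac m n)"
  have \<alpha>: "0 < trim_frac k n" "trim_frac k n < 1" "0 < trim_frac m n" "trim_frac m n < 1"
    using km unfolding trim_frac_def by auto
  have w: "winsorize (cdf law) (trim_frac k n) (trim_frac m n) = clip a b"
    unfolding a_def b_def qt_def using law.winsorize_eq_clip[OF \<alpha>] by (rule ext)
  have "variance (\<lambda>\<omega>. clip a b (X 1 \<omega>)) = expectation (\<lambda>\<omega>. (centered a b (X 1 \<omega>))\<^sup>2)"
    unfolding centered_def using expectation_eq_law(1)[of 1 "clip a b"] law.clip_measurable by simp
  also have "\<dots> = lvar (clip a b)"
    using expectation_eq_law(1)[of 1 "\<lambda>x. (centered a b x)\<^sup>2"] centered_moments(4) by simp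
  finally show ?thesis unfolding winsorized_sd_def w a_def b_def by simp
qed

text \<open>By the formula for the quantile integral, n times the centre is the mean of the
  winsorized sum minus k a + m b. The deterministic end terms thus cancel, leaving a centred i.i.d.
  sum and the remainder.\<close>

lemma trimmed_mean_decomposition:
  assumes km: "1 \<le> k n" "1 \<le> m n" "k n + m n < n" "2 * k n \<le> n" "2 * m n \<le> n"
  defines "a \<equiv> qt (trim_frac k n)" and "b \<equiv> qt (1 - trim_frac m n)"
  shows "real n * (trimmed_mean X k m n \<omega> - trimmed_center (cdf law) k m n) =
      (\<Sum>i\<in>{1..n}. centered a b (X i \<omega>)) + remainder n (k n) (m n) a b \<omega>"
    "trimmed_center (cdf law) k m n = (\<integral>x. clip a b x \<partial>law) - trim_frac k n * a - trim_frac m n * b"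
proof -
  have n: "0 < real n" using km by simp
  have \<alpha>: "0 < trim_frac k n" "0 < trim_frac m n" "trim_frac k n \<le> 1 - trim_frac m n"
    using km n unfolding trim_frac_def by (auto simp: field_simps)
  show mu: "trimmed_center (cdf law) k m n = (\<integral>x. clip a b x \<partial>law) - trim_frac k n * a - trim_frac m n * b"
    unfolding trimmed_center_def a_def b_def qt_def by (rule law.quantile_integral[OF \<alpha>])
  have "real n * trimmed_mean X k m n \<omega> = (\<Sum>i\<in>{k n + 1..n - m n}. ostat n i \<omega>)"
    using n by (simp add: trimmed_mean_def ostat_def)
  moreover have "real n * trim_frac k n = real (k n)" "real n * trim_frac m n = real (m n)"
    using n by (simp_all add: trim_frac_def)
  ultimately show "real n * (trimmed_mean X k m n \<omega> - trimmed_center (cdf law) k m n) =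
      (\<Sum>i\<in>{1..n}. centered a b (X i \<omega>)) + remainder n (k n) (m n) a b \<omega>"
    unfolding mu remainder_def centered_def sum_subtractf
    by (simp add: right_diff_distrib mult.assoc[symmetric])
qed

lemma trimmed_mean_measurable: "trimmed_mean X k m n \<in> borel_measurable M"
proof -
  have "(\<lambda>\<omega>. \<Sum>i\<in>{k n + 1..n - m n}. ostat n i \<omega>) \<in> borel_measurable M"
    by (rule borel_measurable_sum) (auto intro: ostat_measurable)
  then show ?thesis
    unfolding trimmed_mean_def[abs_def] ostat_def by (rule borel_measurable_divide) simp
qed

text \<open>The variable sqrt n (T - \<mu>) is u + v, where u is a centred sum with standard
  deviation exactly the winsorized one and v is the remainder over sqrt n. The mean is that of v,
  the standard deviation moves by at most the root mean square of v, and \<rho> bounds the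
  latter.\<close>

lemma trimmed_mean_moments:
  assumes km: "1 \<le> k n" "1 \<le> m n" "k n + m n < n" "2 * k n \<le> n" "2 * m n \<le> n"
    and i: "integrable law (\<lambda>x. \<bar>x\<bar> powr p)" and p: "2 < p"
  defines "r \<equiv> 2 * p / (p - 2)"
  defines "\<rho> \<equiv> sqrt (8 * (r powr r * (1 + exp 1) + 3 * 4 powr p * pmom p) *
      (trim_frac k n powr (1 - 2 / p) + trim_frac m n powr (1 - 2 / p)))"
  shows "\<bar>sqrt (real n) * (expectation (trimmed_mean X k m n) - trimmed_center (cdf law) k m n)\<bar> \<le> \<rho>"
    "\<bar>sqrt (real n * variance (trimmed_mean X k m n)) - winsorized_sd M X k m n\<bar> \<le> \<rho>"
proof -
  define a b where "a = qt (trim_frac k n)" and "b = qt (1 - trim_frac m n)"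
  define T where "T = trimmed_mean X k m n"
  define \<mu> where "\<mu> = trimmed_center (cdf law) k m n"
  have n: "0 < real n" using km by simp
  have tp: "trim_point n (k n) (m n) a b" unfolding a_def b_def by (rule trim_point_quantiles[of k n m]) (use km in auto)
  define Z where "Z i \<omega> = centered a b (X i \<omega>)" for i \<omega>
  define u where "u \<omega> = (\<Sum>i\<in>{1..n}. Z i \<omega>) / sqrt n" for \<omega>
  define v where "v \<omega> = remainder n (k n) (m n) a b \<omega> / sqrt n" for \<omega>
  have Tm: "T \<in> borel_measurable M" unfolding T_def by (rule trimmed_mean_measurable)
  have uv: "sqrt n * (T \<omega> - \<mu>) = u \<omega> + v \<omega>" for \<omega>
  proof -
    have "sqrt n * (T \<omega> - \<mu>) = real n * (T \<omega> - \<mu>) / sqrt n"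
      using n by (simp add: field_simps flip: power2_eq_square)
    also have "\<dots> = u \<omega> + v \<omega>"
      unfolding T_def \<mu>_def a_def b_def u_def v_def Z_def trimmed_mean_decomposition(1)[of k n m, OF km] by (simp add: add_divide_distrib)
    finally show ?thesis .
  qed
  have S: "integrable M (\<lambda>\<omega>. (\<Sum>i\<in>{1..n}. Z i \<omega>)\<^sup>2) \<and> expectation (\<lambda>\<omega>. \<Sum>i\<in>{1..n}. Z i \<omega>) = 0 \<and>
    expectation (\<lambda>\<omega>. (\<Sum>i\<in>{1..n}. Z i \<omega>)\<^sup>2) = real (card {1..n}) * lvar (clip a b)"
  proof (rule indep_sum_second_moment)
    show "indep_vars (\<lambda>_. borel) Z {1..n}"
      unfolding Z_def[abs_def] by (rule indep_transformed) auto
    fix i assume i: "i \<in> {1..n}"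
    show "\<bar>Z i \<omega>\<bar> \<le> 2 * max \<bar>a\<bar> \<bar>b\<bar>" for \<omega> unfolding Z_def by (rule centered_bounded)
    show "expectation (Z i) = 0"
      unfolding Z_def[abs_def] using expectation_eq_law(1)[of i "centered a b"] i centered_moments(2)[of a b] by simp
    show "expectation (\<lambda>\<omega>. (Z i \<omega>)\<^sup>2) = lvar (clip a b)"
      unfolding Z_def using expectation_eq_law(1)[of i "\<lambda>x. (centered a b x)\<^sup>2"] i centered_moments(4)[of a b] by simp
  qed simp
  have mS: "(\<lambda>\<omega>. \<Sum>i\<in>{1..n}. Z i \<omega>) \<in> borel_measurable M"
  proof (rule borel_measurable_sum)
    fix i assume "i \<in> {1..n}"
    then have [measurable]: "X i \<in> borel_measurable M" by (intro X_measurable) auto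
    show "Z i \<in> borel_measurable M" unfolding Z_def[abs_def] by measurable
  qed
  have mu: "u \<in> borel_measurable M" "v \<in> borel_measurable M"
    unfolding u_def[abs_def] v_def[abs_def] using mS remainder_measurable by (intro borel_measurable_divide borel_measurable_const; simp)+
  have u: "integrable M (\<lambda>\<omega>. (u \<omega>)\<^sup>2)" "expectation u = 0" "expectation (\<lambda>\<omega>. (u \<omega>)\<^sup>2) = lvar (clip a b)"
    using S n unfolding u_def[abs_def] by (auto simp: power_divide)
  note rem = remainder_moment[OF tp i p, folded r_def]
  have iv: "integrable M (\<lambda>\<omega>. (v \<omega>)\<^sup>2)" using rem(1) n by (simp add: v_def power_divide)
  have "expectation (\<lambda>\<omega>. (v \<omega>)\<^sup>2) = expectation (\<lambda>\<omega>. (remainder n (k n) (m n) a b \<omega>)\<^sup>2) / n"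
    using n by (simp add: v_def power_divide)
  also have "\<dots> \<le> 8 * (r powr r * (1 + exp 1) + 3 * 4 powr p * pmom p) *
      (real (k n) * (real (k n) / real n) powr (- 2 / p) + real (m n) * (real (m n) / real n) powr (- 2 / p)) / n"
    by (intro divide_right_mono rem(2)) simp
  also have "\<dots> = 8 * (r powr r * (1 + exp 1) + 3 * 4 powr p * pmom p) *
      (real (k n) / real n * (real (k n) / real n) powr (- 2 / p) + real (m n) / real n * (real (m n) / real n) powr (- 2 / p))"
    by (simp only: times_divide_eq_right[symmetric] add_divide_distrib times_divide_eq_left)
  also have "\<dots> = 8 * (r powr r * (1 + exp 1) + 3 * 4 powr p * pmom p) *
      (trim_frac k n powr (1 - 2 / p) + trim_frac m n powr (1 - 2 / p))"
  proof -
    have "x * x powr (- 2 / p) = x powr (1 - 2 / p)" if "0 < x" for x :: real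
      using powr_add[of x 1 "- 2 / p"] that by simp
    from this[of "real (k n) / real n"] this[of "real (m n) / real n"] show ?thesis
      using km n by (simp only: trim_frac_def) simp
  qed
  finally have ev: "sqrt (expectation (\<lambda>\<omega>. (v \<omega>)\<^sup>2)) \<le> \<rho>" unfolding \<rho>_def by (rule real_sqrt_le_mono)
  note sp = sd_perturbation[OF mu u(1) iv u(2)]
  note iuv = integrable_of_square[OF mu(1) u(1)] integrable_of_square[OF mu(2) iv]
  have Tuv: "T \<omega> = \<mu> + (u \<omega> + v \<omega>) / sqrt n" for \<omega> using uv[of \<omega>] n by (simp add: field_simps)
  have iT: "integrable M T" unfolding Tuv[abs_def] using iuv by simp
  have "sqrt n * (expectation T - \<mu>) = expectation (\<lambda>\<omega>. sqrt n * (T \<omega> - \<mu>))"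
    using iT by (simp add: prob_space)
  also have "\<dots> = expectation v" unfolding uv using iuv u(2) by simp
  finally have "\<bar>sqrt n * (expectation T - \<mu>)\<bar> \<le> \<rho>" using sp(2) ev by simp
  then show "\<bar>sqrt (real n) * (expectation (trimmed_mean X k m n) - trimmed_center (cdf law) k m n)\<bar> \<le> \<rho>"
    unfolding T_def \<mu>_def .
  have "variance (\<lambda>\<omega>. u \<omega> + v \<omega>) = expectation (\<lambda>\<omega>. real n * (T \<omega> - expectation T)\<^sup>2)"
  proof (intro Bochner_Integration.integral_cong refl)
    fix \<omega>
    have "expectation (\<lambda>\<omega>. u \<omega> + v \<omega>) = sqrt n * (expectation T - \<mu>)"
      unfolding uv[symmetric] using iT by (simp add: prob_space)
    then have "u \<omega> + v \<omega> - expectation (\<lambda>\<omega>. u \<omega> + v \<omega>) = sqrt n * (T \<omega> - expectation T)"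
      unfolding uv[symmetric] by (simp add: algebra_simps)
    then show "(u \<omega> + v \<omega> - expectation (\<lambda>\<omega>. u \<omega> + v \<omega>))\<^sup>2 = real n * (T \<omega> - expectation T)\<^sup>2"
      by (simp add: power_mult_distrib)
  qed
  also have "\<dots> = real n * variance T" by simp
  finally have "variance (\<lambda>\<omega>. u \<omega> + v \<omega>) = real n * variance T" .
  then show "\<bar>sqrt (real n * variance (trimmed_mean X k m n)) - winsorized_sd M X k m n\<bar> \<le> \<rho>"
    using sp(1) ev u(3) winsorized_sd_eq[of k n m] km unfolding T_def a_def b_def by simp
qed

end

section \<open>Rates\<close>

lemma powr_half_square: "0 \<le> x \<Longrightarrow> (x powr (1 / 2 - 1 / p))\<^sup>2 = x powr (1 - 2 / p)" for x p :: real
  by (cases "x = 0") (simp_all add: powr_power)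

lemma tendsto_zero_le:
  fixes f g :: "nat \<Rightarrow> real"
  assumes "g \<longlonglongrightarrow> 0" "\<forall>\<^sub>F n in sequentially. \<bar>f n\<bar> \<le> g n"
  shows "f \<longlonglongrightarrow> 0"
proof (rule tendsto_rabs_zero_cancel, rule tendsto_sandwich[OF _ assms(2) tendsto_const assms(1)])
  show "\<forall>\<^sub>F n in sequentially. 0 \<le> \<bar>f n\<bar>" by simp
qed

text \<open>The size condition on the trimming fractions enters as the single limit
  \<open>fraction_small\<close>, the form in which every error term uses it.\<close>

locale trimmed_sample = iid_sample M X for M :: "'a measure" and X :: "nat \<Rightarrow> 'a \<Rightarrow> real" +
  fixes k m :: "nat \<Rightarrow> nat" and p c :: real
  assumes p: "2 < p" and c: "0 < c"
    and moment: "integrable law (\<lambda>x. \<bar>x\<bar> powr p)"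
    and trim: "\<And>n. 1 \<le> n \<Longrightarrow> k n + m n < n"
    and trim_inf: "filterlim (\<lambda>n. min (k n) (m n)) at_top sequentially"
    and liminf_pos: "liminf (\<lambda>n. ereal (winsorized_sd M X k m n)) > 0"
    and log_small: "(\<lambda>n. ln (real n) / real (min (k n) (m n))) \<longlonglongrightarrow> 0"
    and fraction_small: "(\<lambda>n. max (trim_frac k n) (trim_frac m n) powr (1 / 2 - 1 / p) * ln (real n)) \<longlonglongrightarrow> 0"
begin

abbreviation T where "T \<equiv> trimmed_mean X k m"
abbreviation \<mu> where "\<mu> \<equiv> trimmed_center (cdf law) k m"
abbreviation \<sigma>W where "\<sigma>W \<equiv> winsorized_sd M X k m"
abbreviation \<alpha> where "\<alpha> \<equiv> trim_frac k"
abbreviation \<beta> where "\<beta> \<equiv> trim_frac m"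

definition \<theta> where "\<theta> n = max (\<alpha> n) (\<beta> n) powr (1 / 2 - 1 / p)"

lemma \<theta>_nonneg: "0 \<le> \<theta> n"
  by (simp add: \<theta>_def)

lemma \<theta>_ln: "(\<lambda>n. \<theta> n * ln (real n)) \<longlonglongrightarrow> 0"
  unfolding \<theta>_def by (rule fraction_small)

lemma ln_ge_1: "\<forall>\<^sub>F n in sequentially. 1 \<le> ln (real n)"
  by real_asymp

lemma exponent_pos: "0 < 1 / 2 - 1 / p"
  using p by (simp add: field_simps)

lemma \<theta>_tendsto: "\<theta> \<longlonglongrightarrow> 0"
proof (rule tendsto_zero_le[OF \<theta>_ln])
  show "\<forall>\<^sub>F n in sequentially. \<bar>\<theta> n\<bar> \<le> \<theta> n * ln (real n)"
    using ln_ge_1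
  proof eventually_elim
    case (elim n)
    then show ?case using mult_left_mono[OF elim \<theta>_nonneg[of n]] \<theta>_nonneg[of n] by simp
  qed
qed

lemma frac_nonneg: "0 \<le> \<alpha> n" "0 \<le> \<beta> n"
  by (simp_all add: trim_frac_def)

lemma frac_powr_le: "\<alpha> n powr (1 / 2 - 1 / p) \<le> \<theta> n" "\<beta> n powr (1 / 2 - 1 / p) \<le> \<theta> n"
  unfolding \<theta>_def using frac_nonneg[of n] exponent_pos by (auto intro!: powr_mono2)

lemma frac_powr_sum_le: "\<alpha> n powr (1 - 2 / p) + \<beta> n powr (1 - 2 / p) \<le> 2 * (\<theta> n)\<^sup>2"
  using power_mono[OF frac_powr_le(1)[of n], of 2] power_mono[OF frac_powr_le(2)[of n], of 2]
  by (simp add: powr_half_square frac_nonneg)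

text \<open>That eventually at most half of the sample is trimmed at either end follows from
  \<open>\<theta>\<close> tending to 0: a fraction of 1/2 or more would keep
  \<open>\<theta> n\<close> above a positive constant.\<close>

lemma ev_trim: "\<forall>\<^sub>F n in sequentially. 1 \<le> k n \<and> 1 \<le> m n \<and> k n + m n < n \<and> 2 * k n \<le> n \<and> 2 * m n \<le> n"
proof -
  have "\<forall>\<^sub>F n in sequentially. 1 \<le> min (k n) (m n)"
    using trim_inf by (simp add: filterlim_at_top)
  moreover have "\<forall>\<^sub>F n in sequentially. \<theta> n < (1 / 2) powr (1 / 2 - 1 / p)"
    by (rule order_tendstoD(2)[OF \<theta>_tendsto]) simp
  ultimately show ?thesis
    using eventually_ge_at_top[of 1]
  proof eventually_elim
    case (elim n)
    have "\<not> 1 / 2 \<le> max (\<alpha> n) (\<beta> n)"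
    proof
      assume "1 / 2 \<le> max (\<alpha> n) (\<beta> n)"
      then have "(1 / 2) powr (1 / 2 - 1 / p) \<le> \<theta> n"
        unfolding \<theta>_def using exponent_pos by (intro powr_mono2) auto
      with elim(2) show False by simp
    qed
    then have "\<alpha> n < 1 / 2" "\<beta> n < 1 / 2" by auto
    then have "2 * k n \<le> n" "2 * m n \<le> n" using elim(3) by (auto simp: trim_frac_def field_simps)
    then show ?case using elim trim[of n] by auto
  qed
qed

lemma ev_sd: obtains s0 where "0 < s0" "\<forall>\<^sub>F n in sequentially. s0 \<le> \<sigma>W n"
proof -
  obtain z where z: "0 < z" "z < liminf (\<lambda>n. ereal (\<sigma>W n))"
    using dense[OF liminf_pos] by (elim exE conjE)
  from less_LiminfD[OF z(2)] have ev: "\<forall>\<^sub>F n in sequentially. z < ereal (\<sigma>W n)" .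
  \<comment> \<open>\<open>z\<close> is an extended real obtained from density; it is positive and
    below a real term of the sequence, hence finite.\<close>
  then obtain n where "z < ereal (\<sigma>W n)" using eventually_happens'[OF sequentially_bot] by blast
  then obtain s0 where s0: "z = ereal s0" using z(1) by (cases z) auto
  show thesis
  proof (rule that)
    show "0 < s0" using z(1) s0 by simp
    show "\<forall>\<^sub>F n in sequentially. s0 \<le> \<sigma>W n" using ev by eventually_elim (simp add: s0)
  qed
qed

lemma trimmed_mean_rates:
  obtains K where "0 \<le> K"
    "\<forall>\<^sub>F n in sequentially. \<bar>sqrt (real n) * (expectation (T n) - \<mu> n)\<bar> \<le> K * \<theta> n"
    "\<forall>\<^sub>F n in sequentially. \<bar>sqrt (real n * variance (T n)) - \<sigma>W n\<bar> \<le> K * \<theta> n"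
proof -
  define r where "r = 2 * p / (p - 2)"
  define G where "G = 8 * (r powr r * (1 + exp 1) + 3 * 4 powr p * pmom p)"
  have G0: "0 \<le> G" unfolding G_def using pmom_nonneg[of p] by (auto intro!: mult_nonneg_nonneg add_nonneg_nonneg)
  define K where "K = sqrt (2 * G)"
  have le: "sqrt (G * (\<alpha> n powr (1 - 2 / p) + \<beta> n powr (1 - 2 / p))) \<le> K * \<theta> n" for n
  proof -
    have "sqrt (G * (\<alpha> n powr (1 - 2 / p) + \<beta> n powr (1 - 2 / p))) \<le> sqrt (G * (2 * (\<theta> n)\<^sup>2))"
      by (intro real_sqrt_le_mono mult_left_mono frac_powr_sum_le G0)
    also have "G * (2 * (\<theta> n)\<^sup>2) = (2 * G) * (\<theta> n)\<^sup>2" by simp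
    also have "sqrt \<dots> = K * \<theta> n" unfolding real_sqrt_mult K_def using \<theta>_nonneg[of n] by simp
    finally show ?thesis .
  qed
  have ev: "\<forall>\<^sub>F n in sequentially. \<bar>sqrt (real n) * (expectation (T n) - \<mu> n)\<bar> \<le> K * \<theta> n \<and>
      \<bar>sqrt (real n * variance (T n)) - \<sigma>W n\<bar> \<le> K * \<theta> n"
    using ev_trim
  proof eventually_elim
    case (elim n)
    then have km: "1 \<le> k n" "1 \<le> m n" "k n + m n < n" "2 * k n \<le> n" "2 * m n \<le> n" by auto
    note mo = trimmed_mean_moments[of k n m, OF km moment p, folded r_def, folded G_def]
    from order_trans[OF mo(1) le] order_trans[OF mo(2) le] show ?case ..
  qed
  show thesis
  proof (rule that[of K])
    show "0 \<le> K" using G0 by (simp add: K_def)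
    show "\<forall>\<^sub>F n in sequentially. \<bar>sqrt (real n) * (expectation (T n) - \<mu> n)\<bar> \<le> K * \<theta> n"
      using ev by eventually_elim (rule conjunct1)
    show "\<forall>\<^sub>F n in sequentially. \<bar>sqrt (real n * variance (T n)) - \<sigma>W n\<bar> \<le> K * \<theta> n"
      using ev by eventually_elim (rule conjunct2)
  qed
qed

lemma variance_rate:
  obtains K where "0 \<le> K" "\<forall>\<^sub>F n in sequentially. \<bar>variance (X 1) - (\<sigma>W n)\<^sup>2\<bar> \<le> K * (\<theta> n)\<^sup>2"
proof -
  define G where "G = 4 * (1 + pmom p + (pnorm p)\<^sup>2) + (2 * pnorm p + 2 * \<bar>\<integral>x. x \<partial>law\<bar>) * (1 + pmom p + pnorm p)"
  have G0: "0 \<le> G" unfolding G_def using pmom_nonneg[of p] pnorm_nonneg[of p] by (auto intro!: mult_nonneg_nonneg add_nonneg_nonneg)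
  note mom = integrable_moments[OF moment p]
  have "expectation (X 1) = (\<integral>x. x \<partial>law)"
    by (rule expectation_eq_law(1)[of 1 "\<lambda>x. x"]) simp_all
  then have "variance (X 1) = expectation (\<lambda>\<omega>. (X 1 \<omega> - (\<integral>x. x \<partial>law))\<^sup>2)" by (simp only:)
  also have "\<dots> = (\<integral>x. (x - (\<integral>x. x \<partial>law))\<^sup>2 \<partial>law)"
    by (rule expectation_eq_law(1)[of 1 "\<lambda>x. (x - (\<integral>x. x \<partial>law))\<^sup>2"]) simp_all
  also have "\<dots> = lvar (\<lambda>x. x)"
    unfolding lvar_def by (rule law.variance_eq[OF mom])
  finally have VX: "variance (X 1) = lvar (\<lambda>x. x)" .
  have ev: "\<forall>\<^sub>F n in sequentially. \<bar>variance (X 1) - (\<sigma>W n)\<^sup>2\<bar> \<le> 2 * G * (\<theta> n)\<^sup>2"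
    using ev_trim
  proof eventually_elim
    case (elim n)
    then have km: "1 \<le> k n" "1 \<le> m n" "k n + m n < n" "2 * k n \<le> n" "2 * m n \<le> n" by auto
    define a b where "a = qt (\<alpha> n)" and "b = qt (1 - \<beta> n)"
    have tp: "trim_point n (k n) (m n) a b" unfolding a_def b_def by (rule trim_point_quantiles[of k n m]) (use km in auto)
    have "0 \<le> lvar (clip a b)"
      unfolding centered_moments(4)[symmetric] by (intro integral_nonneg_AE AE_I2) simp
    then have s: "(\<sigma>W n)\<^sup>2 = lvar (clip a b)"
      using winsorized_sd_eq[of k n m] km unfolding a_def b_def by simp
    have "\<bar>variance (X 1) - (\<sigma>W n)\<^sup>2\<bar> \<le> G * (\<alpha> n powr (1 - 2 / p) + \<beta> n powr (1 - 2 / p))"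
      unfolding VX s G_def trim_frac_def by (rule clip_variance_error[OF tp moment p])
    also have "\<dots> \<le> G * (2 * (\<theta> n)\<^sup>2)" by (intro mult_left_mono frac_powr_sum_le G0)
    finally show ?case by simp
  qed
  show thesis by (rule that[of "2 * G"]) (use ev G0 in auto)
qed

text \<open>The difference is the mean of what clipping removes plus \<alpha> a + \<beta> b. Both
  parts are of order 1 - 1/p in the fractions, since a quantile grows at most like its level to the
  power -1/p.\<close>

lemma mean_rate:
  obtains K where "0 \<le> K"
    "\<forall>\<^sub>F n in sequentially. \<bar>expectation (X 1) - \<mu> n\<bar> \<le> K * max (\<alpha> n) (\<beta> n) powr (1 - 1 / p)"
proof -
  define G where "G = 1 + pmom p + 2 * pnorm p"
  have G0: "0 \<le> G" unfolding G_def using pmom_nonneg[of p] pnorm_nonneg[of p] by simp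
  note mom = integrable_moments[OF moment p]
  have ev: "\<forall>\<^sub>F n in sequentially. \<bar>expectation (X 1) - \<mu> n\<bar> \<le> 2 * G * max (\<alpha> n) (\<beta> n) powr (1 - 1 / p)"
    using ev_trim
  proof eventually_elim
    case (elim n)
    then have km: "1 \<le> k n" "1 \<le> m n" "k n + m n < n" "2 * k n \<le> n" "2 * m n \<le> n" by auto
    define a b where "a = qt (\<alpha> n)" and "b = qt (1 - \<beta> n)"
    have tp: "trim_point n (k n) (m n) a b" unfolding a_def b_def by (rule trim_point_quantiles[of k n m]) (use km in auto)
    note E = clip_mean_error[OF tp moment p]
    define t where "t = max (\<alpha> n) (\<beta> n) powr (1 - 1 / p)"
    have "\<alpha> n powr (1 - 1 / p) \<le> t" "\<beta> n powr (1 - 1 / p) \<le> t"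
      unfolding t_def using frac_nonneg[of n] p by (auto intro!: powr_mono2)
    then have s: "\<alpha> n powr (1 - 1 / p) + \<beta> n powr (1 - 1 / p) \<le> 2 * t" by simp
    have "expectation (X 1) = (\<integral>x. x \<partial>law)"
      by (rule expectation_eq_law(1)[of 1 "\<lambda>x. x"]) simp_all
    moreover have "(\<integral>x. x - clip a b x \<partial>law) = (\<integral>x. x \<partial>law) - (\<integral>x. clip a b x \<partial>law)"
      by (rule Bochner_Integration.integral_diff[OF mom(1) law.integrable_clip])
    moreover have "\<mu> n = (\<integral>x. clip a b x \<partial>law) - \<alpha> n * a - \<beta> n * b"
      unfolding a_def b_def by (rule trimmed_mean_decomposition(2)[of k n m, OF km])
    ultimately have "expectation (X 1) - \<mu> n = (\<integral>x. x - clip a b x \<partial>law) + (\<alpha> n * a + \<beta> n * b)"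
      by linarith
    then have "\<bar>expectation (X 1) - \<mu> n\<bar> \<le> \<bar>\<integral>x. x - clip a b x \<partial>law\<bar> + \<bar>\<alpha> n * a + \<beta> n * b\<bar>"
      by (simp only: abs_triangle_ineq)
    also have "\<dots> \<le> (1 + pmom p + pnorm p) * (2 * t) + pnorm p * (2 * t)"
      using pmom_nonneg[of p] pnorm_nonneg[of p]
      by (intro add_mono order_trans[OF E(1)[folded trim_frac_def]] order_trans[OF E(6)[folded trim_frac_def]] mult_left_mono s) simp_all
    also have "\<dots> = 2 * G * t" by (simp add: G_def algebra_simps)
    finally show ?case unfolding t_def .
  qed
  show thesis by (rule that[of "2 * G"]) (use ev G0 in auto)
qed

end

section \<open>Moderate deviations of the trimmed mean\<close>

lemma distr_affine_moments:
  fixes f :: "real \<Rightarrow> real"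
  assumes P: "prob_space P" "sets P = sets borel" and [measurable]: "f \<in> borel_measurable borel" and B: "\<And>x. \<bar>f x\<bar> \<le> B"
  shows "AE y in distr P borel f. \<bar>y\<bar> \<le> B" "(\<integral>y. y \<partial>distr P borel f) = (\<integral>x. f x \<partial>P)"
    "(\<integral>y. y\<^sup>2 \<partial>distr P borel f) = (\<integral>x. (f x)\<^sup>2 \<partial>P)"
proof -
  have [measurable_cong]: "sets P = sets borel" by (rule P)
  show "AE y in distr P borel f. \<bar>y\<bar> \<le> B" by (subst AE_distr_iff) (auto simp: B)
  show "(\<integral>y. y \<partial>distr P borel f) = (\<integral>x. f x \<partial>P)" by (rule integral_distr) measurable
  show "(\<integral>y. y\<^sup>2 \<partial>distr P borel f) = (\<integral>x. (f x)\<^sup>2 \<partial>P)" by (rule integral_distr) measurable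
qed

context trimmed_sample
begin

text \<open>The sign \<open>e\<close>, always 1 or -1, lets one argument serve the upper and the
  lower tail.\<close>

definition standardized :: "real \<Rightarrow> nat \<Rightarrow> real \<Rightarrow> real" where
  "standardized e n x = e * centered (qt (\<alpha> n)) (qt (1 - \<beta> n)) x / (\<sigma>W n * sqrt n)"

lemma standardized_measurable[measurable]: "standardized e n \<in> borel_measurable borel"
  unfolding standardized_def[abs_def] by measurable

definition winsor_remainder :: "nat \<Rightarrow> 'a \<Rightarrow> real" where
  "winsor_remainder n = remainder n (k n) (m n) (qt (\<alpha> n)) (qt (1 - \<beta> n))"

text \<open>The quantiles are at most \<open>pnorm p\<close> times (n/k) or (n/m) to the power 1/p,
  hence at most \<open>pnorm p\<close> times n to the power 1/p. Division by sqrt n leaves a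
  negative power of n because p > 2. The added 1 keeps the constant positive even if
  \<open>pnorm p\<close> is 0.\<close>

lemma standardized_bounded:
  assumes km: "1 \<le> k n" "1 \<le> m n" "k n + m n < n" "2 * k n \<le> n" "2 * m n \<le> n"
    and s: "0 < s0" "s0 \<le> \<sigma>W n" and e: "\<bar>e\<bar> = 1"
  shows "\<bar>standardized e n x\<bar> \<le> (2 * pnorm p / s0 + 1) * real n powr - (1 / 2 - 1 / p)"
proof -
  define a b where "a = qt (\<alpha> n)" and "b = qt (1 - \<beta> n)"
  have tp: "trim_point n (k n) (m n) a b" unfolding a_def b_def by (rule trim_point_quantiles[of k n m]) (use km in auto)
  have n: "0 < real n" using km by simp
  have le: "(real j / real n) powr (- 1 / p) \<le> real n powr (1 / p)" if "1 \<le> j" for j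
  proof -
    have "(real j / real n) powr (- 1 / p) \<le> (1 / real n) powr (- 1 / p)"
      using that n p by (intro powr_mono2') (auto simp: divide_right_mono)
    also have "\<dots> = real n powr (1 / p)" using n by (simp add: powr_divide powr_minus_divide)
    finally show ?thesis .
  qed
  have "\<bar>a\<bar> \<le> pnorm p * real n powr (1 / p)" "\<bar>b\<bar> \<le> pnorm p * real n powr (1 / p)"
    using trim_point_abs_le[OF tp moment p] mult_left_mono[OF le[OF km(1)] pnorm_nonneg] mult_left_mono[OF le[OF km(2)] pnorm_nonneg]
    by (meson order_trans)+
  then have M: "2 * max \<bar>a\<bar> \<bar>b\<bar> \<le> 2 * (pnorm p * real n powr (1 / p))" by simp
  have "\<bar>standardized e n x\<bar> = \<bar>centered a b x\<bar> / (\<sigma>W n * sqrt n)"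
    using e s n unfolding standardized_def a_def[symmetric] b_def[symmetric] by (simp add: abs_mult)
  also have "\<dots> \<le> 2 * (pnorm p * real n powr (1 / p)) / (s0 * sqrt n)"
    using order_trans[OF centered_bounded M] s n pnorm_nonneg by (intro frac_le mult_right_mono) auto
  also have "\<dots> = 2 * pnorm p / s0 * (real n powr (1 / p) / sqrt n)" by simp
  also have "real n powr (1 / p) / sqrt n = real n powr - (1 / 2 - 1 / p)"
    using n by (simp add: powr_half_sqrt[symmetric] powr_diff[symmetric])
  also have "2 * pnorm p / s0 * real n powr - (1 / 2 - 1 / p) \<le> (2 * pnorm p / s0 + 1) * real n powr - (1 / 2 - 1 / p)"
    by (intro mult_right_mono) auto
  finally show ?thesis .
qed

lemma standardized_summands:
  assumes e: "\<bar>e\<bar> = 1"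
  obtains C where "0 < C" "\<forall>\<^sub>F n in sequentially. indep_vars (\<lambda>_. borel) (\<lambda>i \<omega>. standardized e n (X i \<omega>)) {1..n} \<and>
      (\<forall>i\<in>{1..n}. distr M borel (\<lambda>\<omega>. standardized e n (X i \<omega>)) = distr law borel (standardized e n)) \<and>
      (AE y in distr law borel (standardized e n). \<bar>y\<bar> \<le> C * real n powr - (1 / 2 - 1 / p)) \<and>
      (\<integral>y. y \<partial>distr law borel (standardized e n)) = 0 \<and> (\<integral>y. y\<^sup>2 \<partial>distr law borel (standardized e n)) = 1 / n"
proof -
  obtain s0 where s0: "0 < s0" "\<forall>\<^sub>F n in sequentially. s0 \<le> \<sigma>W n" by (rule ev_sd)
  show thesis
  proof (rule that[of "2 * pnorm p / s0 + 1"])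
    show "0 < 2 * pnorm p / s0 + 1" using s0 pnorm_nonneg[of p] by (simp add: add_nonneg_pos)
    show "\<forall>\<^sub>F n in sequentially. indep_vars (\<lambda>_. borel) (\<lambda>i \<omega>. standardized e n (X i \<omega>)) {1..n} \<and>
      (\<forall>i\<in>{1..n}. distr M borel (\<lambda>\<omega>. standardized e n (X i \<omega>)) = distr law borel (standardized e n)) \<and>
      (AE y in distr law borel (standardized e n). \<bar>y\<bar> \<le> (2 * pnorm p / s0 + 1) * real n powr - (1 / 2 - 1 / p)) \<and>
      (\<integral>y. y \<partial>distr law borel (standardized e n)) = 0 \<and> (\<integral>y. y\<^sup>2 \<partial>distr law borel (standardized e n)) = 1 / n"
      using ev_trim s0(2)
    proof eventually_elim
      case (elim n)
      then have km: "1 \<le> k n" "1 \<le> m n" "k n + m n < n" "2 * k n \<le> n" "2 * m n \<le> n" by auto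
      have n: "0 < real n" using km by simp
      define a b where "a = qt (\<alpha> n)" and "b = qt (1 - \<beta> n)"
      have st: "standardized e n x = e / (\<sigma>W n * sqrt n) * centered a b x" for x
        by (simp add: standardized_def a_def b_def)
      have "0 \<le> lvar (clip a b)"
        unfolding centered_moments(4)[symmetric] by (intro integral_nonneg_AE AE_I2) simp
      then have s: "(\<sigma>W n)\<^sup>2 = lvar (clip a b)"
        using winsorized_sd_eq[of k n m] km unfolding a_def b_def by simp
      have sp: "0 < \<sigma>W n" using elim s0 by simp
      note dm = distr_affine_moments[OF prob_space_law sets_distr standardized_measurable
          standardized_bounded[OF km s0(1) elim(2) e]]
      have "(\<integral>x. standardized e n x \<partial>law) = 0"
        unfolding st using centered_moments(2)[of a b] by simp
      moreover have "(\<integral>x. (standardized e n x)\<^sup>2 \<partial>law) = 1 / n"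
      proof -
        have "(\<integral>x. (standardized e n x)\<^sup>2 \<partial>law) = (e / (\<sigma>W n * sqrt n))\<^sup>2 * (\<sigma>W n)\<^sup>2"
          unfolding st power_mult_distrib s centered_moments(4)[of a b, symmetric] by simp
        also have "\<dots> = \<bar>e\<bar>\<^sup>2 / n" using n sp by (simp add: power_divide power_mult_distrib)
        finally show ?thesis using e by simp
      qed
      moreover have "distr M borel (\<lambda>\<omega>. standardized e n (X i \<omega>)) = distr law borel (standardized e n)" if "i \<in> {1..n}" for i
      proof -
        have i: "1 \<le> i" using that by simp
        have "distr law borel (standardized e n) = distr (distr M borel (X i)) borel (standardized e n)"
          by (simp only: ident[OF i])
        also have "\<dots> = distr M borel (standardized e n \<circ> X i)"
          by (rule distr_distr[OF standardized_measurable X_measurable[OF i]])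
        finally show ?thesis by (simp add: comp_def)
      qed
      moreover have "indep_vars (\<lambda>_. borel) (\<lambda>i \<omega>. standardized e n (X i \<omega>)) {1..n}"
        by (rule indep_transformed) auto
      ultimately show ?case using dm by simp
    qed
  qed
qed

text \<open>The value L^2 = c^2/2 + 2 exceeds the required exponent by 1, so that one factor n
  absorbs the six exponential terms once n \<ge> 6. Since log n is negligible against min(k, m),
  eventually 2 L^2 log n \<le> min(k, m). This meets the condition of the Chernoff bound for the
  counts and puts exp(-k/2) and exp(-m/2) below exp(-L^2 log n).\<close>

lemma winsor_remainder_tail:
  obtains K where "0 \<le> K" "\<forall>\<^sub>F n in sequentially.
    \<P>(\<omega> in M. \<bar>winsor_remainder n \<omega>\<bar> > K * \<theta> n * sqrt (ln n) * sqrt n) \<le> real n powr (- c\<^sup>2 / 2 - 1)"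
proof -
  define L where "L = sqrt (c\<^sup>2 / 2 + 2)"
  have L: "0 < L" "L\<^sup>2 = c\<^sup>2 / 2 + 2"
    unfolding L_def by (auto intro!: real_sqrt_gt_zero add_nonneg_pos)
  define Q where "Q = (4 * (pmom p + 1)) powr (1 / p)"
  have ll: "\<forall>\<^sub>F n in sequentially. ln (real n) / real (min (k n) (m n)) < 1 / (2 * L\<^sup>2)"
    using L(1) by (intro order_tendstoD(2)[OF log_small]) simp
  show thesis
  proof (rule that[of "32 * L * Q"])
    show "0 \<le> 32 * L * Q" using L by (simp add: Q_def)
    show "\<forall>\<^sub>F n in sequentially.
      \<P>(\<omega> in M. \<bar>winsor_remainder n \<omega>\<bar> > 32 * L * Q * \<theta> n * sqrt (ln n) * sqrt n) \<le> real n powr (- c\<^sup>2 / 2 - 1)"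
      using ev_trim ll ln_ge_1 eventually_ge_at_top[of 6]
    proof eventually_elim
      case (elim n)
      then have km: "1 \<le> k n" "1 \<le> m n" "k n + m n < n" "2 * k n \<le> n" "2 * m n \<le> n" by auto
      have n: "0 < real n" using km by simp
      define g where "g = ln (real n)"
      have g: "0 < g" using elim by (simp add: g_def)
      define a b where "a = qt (\<alpha> n)" and "b = qt (1 - \<beta> n)"
      have tp: "trim_point n (k n) (m n) a b" unfolding a_def b_def by (rule trim_point_quantiles[of k n m]) (use km in auto)
      have "g / real (min (k n) (m n)) < 1 / (2 * L\<^sup>2)" using elim(2) by (simp add: g_def)
      moreover have "0 < real (min (k n) (m n))" using km by simp
      ultimately have "g < 1 / (2 * L\<^sup>2) * real (min (k n) (m n))" by (simp only: pos_divide_less_eq)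
      then have "2 * (L\<^sup>2 * g) < real (min (k n) (m n))"
        using L(1) by (simp add: pos_less_divide_eq mult_ac)
      then have Lg: "2 * (L\<^sup>2 * g) \<le> real (k n)" "2 * (L\<^sup>2 * g) \<le> real (m n)" by auto
      have Lg0: "0 \<le> L\<^sup>2 * g" using g by simp
      have side: "16 * L * sqrt (real j * g) * (4 * (pmom p + 1) / (real j / real n)) powr (1 / p) \<le>
          16 * L * Q * \<theta> n * sqrt g * sqrt n"
        if "1 \<le> j" "(real j / real n) powr (1 / 2 - 1 / p) \<le> \<theta> n" for j
      proof -
        define x where "x = real j / real n"
        have x: "0 < x" "real j = x * real n" using that n by (auto simp: x_def)
        have "(4 * (pmom p + 1) / x) powr (1 / p) = Q * x powr (- (1 / p))"
          using x pmom_nonneg[of p] by (simp add: Q_def powr_divide powr_minus_divide)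
        moreover have "sqrt (real j * g) = x powr (1 / 2) * sqrt g * sqrt n"
          unfolding x(2) using x by (simp add: real_sqrt_mult powr_half_sqrt)
        ultimately have "16 * L * sqrt (real j * g) * (4 * (pmom p + 1) / x) powr (1 / p) =
            16 * L * Q * (x powr (1 / 2) * x powr (- (1 / p))) * sqrt g * sqrt n"
          by simp
        also have "x powr (1 / 2) * x powr (- (1 / p)) = x powr (1 / 2 - 1 / p)"
          using x by (simp add: powr_add[symmetric])
        also have "16 * L * Q * x powr (1 / 2 - 1 / p) * sqrt g * sqrt n \<le> 16 * L * Q * \<theta> n * sqrt g * sqrt n"
          using that(2) L g by (intro mult_right_mono mult_left_mono) (auto simp: x_def Q_def)
        finally show ?thesis unfolding x_def .
      qed
      let ?x = "16 * L * sqrt (real (k n) * g) * (4 * (pmom p + 1) / (real (k n) / real n)) powr (1 / p)"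
      let ?y = "16 * L * sqrt (real (m n) * g) * (4 * (pmom p + 1) / (real (m n) / real n)) powr (1 / p)"
      have xy: "?x + ?y \<le> 32 * L * Q * \<theta> n * sqrt (ln n) * sqrt n"
        using side[OF km(1)] side[OF km(2)] frac_powr_le[of n] unfolding trim_frac_def g_def by simp
      have [measurable]: "winsor_remainder n \<in> borel_measurable M"
        unfolding winsor_remainder_def by (rule remainder_measurable)
      have "\<P>(\<omega> in M. \<bar>winsor_remainder n \<omega>\<bar> > 32 * L * Q * \<theta> n * sqrt (ln n) * sqrt n) \<le>
          \<P>(\<omega> in M. \<bar>winsor_remainder n \<omega>\<bar> > ?x + ?y)"
        using xy by (intro finite_measure_mono) auto
      also have "\<dots> \<le> 4 * exp (- (L\<^sup>2 * g)) + exp (- (real (k n) / 2)) + exp (- (real (m n) / 2))"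
        unfolding winsor_remainder_def a_def[symmetric] b_def[symmetric]
        using Lg Lg0 by (intro remainder_tail[OF tp moment p L(1) g]) auto
      also have "\<dots> \<le> 4 * exp (- (L\<^sup>2 * g)) + exp (- (L\<^sup>2 * g)) + exp (- (L\<^sup>2 * g))"
        using Lg by (intro add_mono) auto
      also have "\<dots> = 6 * exp (- (L\<^sup>2 * g))" by simp
      also have "\<dots> \<le> real n * exp (- (L\<^sup>2 * g))" using elim(4) by (intro mult_right_mono) auto
      also have "\<dots> = exp (g + - (L\<^sup>2 * g))" unfolding exp_add g_def using n by simp
      also have "g + - (L\<^sup>2 * g) = (- c\<^sup>2 / 2 - 1) * g" unfolding L(2) by (simp add: field_simps)
      also have "exp \<dots> = real n powr (- c\<^sup>2 / 2 - 1)" using n by (simp add: powr_def g_def)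
      finally show ?case .
    qed
  qed
qed

text \<open>Another centre \<open>a\<close> or scale \<open>s\<close> only displaces the threshold
  x, so all versions of the relations concern the same sum and remainder.\<close>

lemma standardized_decomposition:
  assumes km: "1 \<le> k n" "1 \<le> m n" "k n + m n < n" "2 * k n \<le> n" "2 * m n \<le> n" and s: "0 < \<sigma>W n" "0 < s"
  shows "x < e * (sqrt n * (T n \<omega> - a) / s) \<longleftrightarrow>
    x + (x * (s / \<sigma>W n - 1) + e * (sqrt n * (a - \<mu> n)) / \<sigma>W n) <
      (\<Sum>i\<in>{1..n}. standardized e n (X i \<omega>)) + e * winsor_remainder n \<omega> / (\<sigma>W n * sqrt n)"
proof -
  have n: "0 < real n" using km by simp
  define S where "S = (\<Sum>i\<in>{1..n}. centered (qt (\<alpha> n)) (qt (1 - \<beta> n)) (X i \<omega>))"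
  have st: "(\<Sum>i\<in>{1..n}. standardized e n (X i \<omega>)) = e * S / (\<sigma>W n * sqrt n)"
    unfolding standardized_def S_def sum_distrib_left sum_divide_distrib ..
  have "real n * (T n \<omega> - \<mu> n) = S + winsor_remainder n \<omega>"
    unfolding S_def winsor_remainder_def by (rule trimmed_mean_decomposition(1)[of k n m, OF km])
  moreover have "real n * (T n \<omega> - \<mu> n) / sqrt n = sqrt n * (T n \<omega> - \<mu> n)"
    using real_div_sqrt[of "real n"] by (simp only: times_divide_eq_left[symmetric])
  ultimately have d: "sqrt n * (T n \<omega> - \<mu> n) = (S + winsor_remainder n \<omega>) / sqrt n" by simp
  have "x < e * (sqrt n * (T n \<omega> - a) / s) \<longleftrightarrow> x * s < e * (sqrt n * (T n \<omega> - a))"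
    using s by (simp add: less_divide_eq)
  also have "e * (sqrt n * (T n \<omega> - a)) = e * (sqrt n * (T n \<omega> - \<mu> n)) - e * (sqrt n * (a - \<mu> n))"
    by (simp add: algebra_simps)
  also have "x * s < \<dots> \<longleftrightarrow> x * s / \<sigma>W n < (e * (sqrt n * (T n \<omega> - \<mu> n)) - e * (sqrt n * (a - \<mu> n))) / \<sigma>W n"
    using s by (simp add: divide_less_cancel)
  also have "\<dots> \<longleftrightarrow> x * s / \<sigma>W n + e * (sqrt n * (a - \<mu> n)) / \<sigma>W n < e * (sqrt n * (T n \<omega> - \<mu> n)) / \<sigma>W n"
    by (simp add: diff_divide_distrib less_diff_eq)
  also have "e * (sqrt n * (T n \<omega> - \<mu> n)) / \<sigma>W n =
      (\<Sum>i\<in>{1..n}. standardized e n (X i \<omega>)) + e * winsor_remainder n \<omega> / (\<sigma>W n * sqrt n)"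
    unfolding d st using s n by (simp add: field_simps)
  also have "x * s / \<sigma>W n + e * (sqrt n * (a - \<mu> n)) / \<sigma>W n =
      x + (x * (s / \<sigma>W n - 1) + e * (sqrt n * (a - \<mu> n)) / \<sigma>W n)"
    by (simp add: algebra_simps)
  finally show ?thesis .
qed

text \<open>A scale error displaces the threshold by x times the error, with x up to order sqrt(log
  n); it must therefore be o(1/log n), whereas o(1/sqrt(log n)) suffices for the standardized
  centre.\<close>

lemma moderate_tail_signed:
  fixes a s :: "nat \<Rightarrow> real"
  assumes e: "\<bar>e\<bar> = 1"
    and a: "(\<lambda>n. sqrt (real n) * (a n - \<mu> n) * sqrt (ln (real n))) \<longlonglongrightarrow> 0"
    and s: "(\<lambda>n. (s n / \<sigma>W n - 1) * ln (real n)) \<longlonglongrightarrow> 0"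
    and A: "0 < A" and \<epsilon>: "0 < \<epsilon>"
  shows "\<forall>\<^sub>F n in sequentially. \<forall>x. - A \<le> x \<and> x \<le> c * sqrt (ln (real n)) \<longrightarrow>
    \<bar>\<P>(\<omega> in M. x < e * (sqrt (real n) * (T n \<omega> - a n) / s n)) / normal_tail x - 1\<bar> < \<epsilon>"
proof -
  obtain s0 where s0: "0 < s0" "\<forall>\<^sub>F n in sequentially. s0 \<le> \<sigma>W n" by (rule ev_sd)
  obtain C where C: "0 < C" and Y: "\<forall>\<^sub>F n in sequentially. indep_vars (\<lambda>_. borel) (\<lambda>i \<omega>. standardized e n (X i \<omega>)) {1..n} \<and>
      (\<forall>i\<in>{1..n}. distr M borel (\<lambda>\<omega>. standardized e n (X i \<omega>)) = distr law borel (standardized e n)) \<and>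
      (AE y in distr law borel (standardized e n). \<bar>y\<bar> \<le> C * real n powr - (1 / 2 - 1 / p)) \<and>
      (\<integral>y. y \<partial>distr law borel (standardized e n)) = 0 \<and> (\<integral>y. y\<^sup>2 \<partial>distr law borel (standardized e n)) = 1 / n"
    by (rule standardized_summands[OF e])
  obtain K where K: "0 \<le> K" and tail: "\<forall>\<^sub>F n in sequentially.
    \<P>(\<omega> in M. \<bar>winsor_remainder n \<omega>\<bar> > K * \<theta> n * sqrt (ln n) * sqrt n) \<le> real n powr (- c\<^sup>2 / 2 - 1)"
    by (rule winsor_remainder_tail)
  define q where "q n = s n / \<sigma>W n - 1" for n
  define d where "d n = sqrt (real n) * (a n - \<mu> n)" for n
  \<comment> \<open>Three displacements of the threshold: the remainder off the exceptional event,
    the change of scale with |x| \<le> A + c sqrt(log n), and the change of centre.\<close>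
  define \<delta> where "\<delta> n = K * \<theta> n * sqrt (ln n) / s0 + (A + c * sqrt (ln n)) * \<bar>q n\<bar> + \<bar>d n\<bar> / s0" for n
  have \<delta>0: "\<forall>\<^sub>F n in sequentially. 0 \<le> \<delta> n"
    using ln_ge_1 by eventually_elim (use K s0 A c \<theta>_nonneg in \<open>simp add: \<delta>_def\<close>)
  have lim: "(\<lambda>n. K / s0 * (\<theta> n * ln n) + (A + c) * \<bar>q n * ln n\<bar> + 1 / s0 * \<bar>d n * sqrt (ln n)\<bar>) \<longlonglongrightarrow> 0"
    using tendsto_add[OF tendsto_add[OF tendsto_mult_right_zero[OF \<theta>_ln, of "K / s0"]
        tendsto_mult_right_zero[OF tendsto_rabs_zero[OF s], of "A + c"]]
        tendsto_mult_right_zero[OF tendsto_rabs_zero[OF a], of "1 / s0"]]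
    unfolding q_def d_def by (simp only: add_0_left)
  have \<delta>_lim: "(\<lambda>n. \<delta> n * sqrt (ln n)) \<longlonglongrightarrow> 0"
  proof (rule tendsto_zero_le[OF lim])
    show "\<forall>\<^sub>F n in sequentially. \<bar>\<delta> n * sqrt (ln n)\<bar> \<le> K / s0 * (\<theta> n * ln n) + (A + c) * \<bar>q n * ln n\<bar> + 1 / s0 * \<bar>d n * sqrt (ln n)\<bar>"
      using \<delta>0 ln_ge_1
    proof eventually_elim
      case (elim n)
      define l where "l = sqrt (ln (real n))"
      have l: "1 \<le> l" "l * l = ln n" using elim(2) by (auto simp: l_def real_le_rsqrt)
      have "l \<le> l * l" using l(1) by simp
      then have "A * l \<le> A * (l * l)" using A by (intro mult_left_mono) simp_all
      then have "(A + c * l) * l \<le> (A + c) * (l * l)" by (simp add: algebra_simps)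
      then have "\<bar>q n\<bar> * ((A + c * l) * l) \<le> \<bar>q n\<bar> * ((A + c) * (l * l))" by (rule mult_left_mono) simp
      then have "\<delta> n * l \<le> K * \<theta> n * (l * l) / s0 + \<bar>q n\<bar> * ((A + c) * (l * l)) + \<bar>d n\<bar> * l / s0"
        unfolding \<delta>_def l_def[symmetric] by (simp add: algebra_simps)
      moreover have "\<bar>\<delta> n * l\<bar> = \<delta> n * l" using elim l by simp
      ultimately show ?case
        unfolding l_def[symmetric] l(2)[symmetric] using l(1) by (simp add: abs_mult mult_ac)
    qed
  qed
  \<comment> \<open>Positivity of the scale, needed to clear the denominator, is inherited from the
    winsorized standard deviation since the ratio tends to 1.\<close>
  have "\<forall>\<^sub>F n in sequentially. 0 < s n"
  proof -
    have "q \<longlonglongrightarrow> 0"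
    proof (rule tendsto_zero_le)
      show "(\<lambda>n. \<bar>q n * ln (real n)\<bar>) \<longlonglongrightarrow> 0" unfolding q_def by (rule tendsto_rabs_zero[OF s])
      show "\<forall>\<^sub>F n in sequentially. \<bar>q n\<bar> \<le> \<bar>q n * ln (real n)\<bar>"
        using ln_ge_1
      proof eventually_elim
        case (elim n)
        then show ?case using mult_left_mono[OF elim, of "\<bar>q n\<bar>"] by (simp add: abs_mult)
      qed
    qed
    then have "\<forall>\<^sub>F n in sequentially. - 1 < q n" by (rule order_tendstoD) simp
    with s0(2) show ?thesis
      by eventually_elim (use s0 in \<open>auto simp: q_def zero_less_divide_iff\<close>)
  qed
  then have P: "\<forall>\<^sub>F n in sequentially. \<forall>x. - A \<le> x \<and> x \<le> c * sqrt (ln (real n)) \<longrightarrow>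
      \<P>(\<omega> in M. x < e * (sqrt (real n) * (T n \<omega> - a n) / s n)) \<le>
        \<P>(\<omega> in M. (\<Sum>i\<in>{1..n}. standardized e n (X i \<omega>)) > x - \<delta> n) + real n powr (- c\<^sup>2 / 2 - 1) \<and>
      \<P>(\<omega> in M. (\<Sum>i\<in>{1..n}. standardized e n (X i \<omega>)) > x + \<delta> n) - real n powr (- c\<^sup>2 / 2 - 1) \<le>
        \<P>(\<omega> in M. x < e * (sqrt (real n) * (T n \<omega> - a n) / s n))"
    using ev_trim s0(2) tail ln_ge_1
  proof eventually_elim
    case (elim n)
    then have km: "1 \<le> k n" "1 \<le> m n" "k n + m n < n" "2 * k n \<le> n" "2 * m n \<le> n" by auto
    have n: "0 < real n" using km by simp
    have sp: "0 < \<sigma>W n" using elim s0 by simp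
    show ?case
    proof (intro allI impI)
      fix x assume x: "- A \<le> x \<and> x \<le> c * sqrt (ln (real n))"
      define S where "S \<omega> = (\<Sum>i\<in>{1..n}. standardized e n (X i \<omega>))" for \<omega>
      define t where "t = x * q n + e * d n / \<sigma>W n"
      define U where "U = {\<omega> \<in> space M. x < e * (sqrt (real n) * (T n \<omega> - a n) / s n)}"
      define Bd where "Bd = {\<omega> \<in> space M. \<bar>winsor_remainder n \<omega>\<bar> > K * \<theta> n * sqrt (ln n) * sqrt n}"
      have [measurable]: "winsor_remainder n \<in> borel_measurable M" "T n \<in> borel_measurable M"
        unfolding winsor_remainder_def by (rule remainder_measurable trimmed_mean_measurable)+
      have [measurable]: "S \<in> borel_measurable M"
        unfolding S_def[abs_def]
      proof (rule borel_measurable_sum)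
        fix i assume "i \<in> {1..n}"
        then have [measurable]: "X i \<in> borel_measurable M" by (intro X_measurable) auto
        show "(\<lambda>\<omega>. standardized e n (X i \<omega>)) \<in> borel_measurable M" by measurable
      qed
      have sets: "U \<in> sets M" "Bd \<in> sets M" "{\<omega> \<in> space M. S \<omega> > y} \<in> sets M" for y
        unfolding U_def Bd_def by measurable
      have mem: "\<omega> \<in> U \<longleftrightarrow> \<omega> \<in> space M \<and> x + t < S \<omega> + e * winsor_remainder n \<omega> / (\<sigma>W n * sqrt n)" for \<omega>
        unfolding U_def S_def t_def q_def d_def using standardized_decomposition[OF km sp elim(1)] by simp
      have t: "\<bar>t\<bar> \<le> (A + c * sqrt (ln n)) * \<bar>q n\<bar> + \<bar>d n\<bar> / s0"
      proof -
        have "\<bar>t\<bar> \<le> \<bar>x * q n\<bar> + \<bar>e * d n / \<sigma>W n\<bar>" unfolding t_def by (rule abs_triangle_ineq)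
        also have "\<dots> = \<bar>x\<bar> * \<bar>q n\<bar> + \<bar>d n\<bar> / \<sigma>W n" using e sp by (simp add: abs_mult)
        also have "\<dots> \<le> (A + c * sqrt (ln n)) * \<bar>q n\<bar> + \<bar>d n\<bar> / s0"
        proof (intro add_mono mult_right_mono divide_left_mono)
          have "0 \<le> c * sqrt (ln n)" using c elim by simp
          then show "\<bar>x\<bar> \<le> A + c * sqrt (ln n)" using x A by (simp add: abs_le_iff)
        qed (use elim s0 sp in auto)
        finally show ?thesis .
      qed
      have good: "\<bar>e * winsor_remainder n \<omega> / (\<sigma>W n * sqrt n)\<bar> \<le> K * \<theta> n * sqrt (ln n) / s0"
        if "\<omega> \<in> space M" "\<omega> \<notin> Bd" for \<omega>
      proof -
        have "\<bar>e * winsor_remainder n \<omega> / (\<sigma>W n * sqrt n)\<bar> = \<bar>winsor_remainder n \<omega>\<bar> / (\<sigma>W n * sqrt n)"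
          using e sp n by (simp add: abs_mult)
        also have "\<dots> \<le> K * \<theta> n * sqrt (ln n) * sqrt n / (s0 * sqrt n)"
          using that elim s0 n K \<theta>_nonneg[of n] by (intro frac_le) (auto simp: Bd_def)
        also have "\<dots> = K * \<theta> n * sqrt (ln n) / s0" using n by simp
        finally show ?thesis .
      qed
      have aux: "x + t' < y + v \<Longrightarrow> x - \<delta>' < y" "x + \<delta>' < y \<Longrightarrow> x + t' < y + v"
        if "\<bar>v\<bar> \<le> u" "\<bar>t'\<bar> \<le> w" "\<delta>' = u + w" for u v w y t' \<delta>' :: real
        using that by linarith+
      have sub1: "U \<subseteq> {\<omega> \<in> space M. S \<omega> > x - \<delta> n} \<union> Bd"
      proof
        fix \<omega> assume "\<omega> \<in> U"
        then have w: "\<omega> \<in> space M" "x + t < S \<omega> + e * winsor_remainder n \<omega> / (\<sigma>W n * sqrt n)"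
          using mem by auto
        have "x - \<delta> n < S \<omega>" if "\<omega> \<notin> Bd"
          by (rule aux(1)[OF good[OF w(1) that] t _ w(2)]) (simp add: \<delta>_def)
        then show "\<omega> \<in> {\<omega> \<in> space M. S \<omega> > x - \<delta> n} \<union> Bd" using w(1) by auto
      qed
      have sub2: "{\<omega> \<in> space M. S \<omega> > x + \<delta> n} \<subseteq> U \<union> Bd"
      proof
        fix \<omega> assume "\<omega> \<in> {\<omega> \<in> space M. S \<omega> > x + \<delta> n}"
        then have w: "\<omega> \<in> space M" "x + \<delta> n < S \<omega>" by auto
        have "x + t < S \<omega> + e * winsor_remainder n \<omega> / (\<sigma>W n * sqrt n)" if "\<omega> \<notin> Bd"
          by (rule aux(2)[OF good[OF w(1) that] t _ w(2)]) (simp add: \<delta>_def)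
        then show "\<omega> \<in> U \<union> Bd" using w(1) mem by auto
      qed
      have B: "prob Bd \<le> real n powr (- c\<^sup>2 / 2 - 1)" using elim unfolding Bd_def by simp
      have "prob U \<le> prob ({\<omega> \<in> space M. S \<omega> > x - \<delta> n} \<union> Bd)"
        by (rule finite_measure_mono[OF sub1]) (intro sets.Un sets)
      also have "\<dots> \<le> prob {\<omega> \<in> space M. S \<omega> > x - \<delta> n} + prob Bd"
        by (intro measure_Un_le sets)
      finally have 1: "prob U \<le> prob {\<omega> \<in> space M. S \<omega> > x - \<delta> n} + prob Bd" .
      have "prob {\<omega> \<in> space M. S \<omega> > x + \<delta> n} \<le> prob (U \<union> Bd)"
        by (rule finite_measure_mono[OF sub2]) (intro sets.Un sets)
      also have "\<dots> \<le> prob U + prob Bd" by (intro measure_Un_le sets)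
      finally have 2: "prob {\<omega> \<in> space M. S \<omega> > x + \<delta> n} \<le> prob U + prob Bd" .
      show "\<P>(\<omega> in M. x < e * (sqrt (real n) * (T n \<omega> - a n) / s n)) \<le>
        \<P>(\<omega> in M. (\<Sum>i\<in>{1..n}. standardized e n (X i \<omega>)) > x - \<delta> n) + real n powr (- c\<^sup>2 / 2 - 1) \<and>
        \<P>(\<omega> in M. (\<Sum>i\<in>{1..n}. standardized e n (X i \<omega>)) > x + \<delta> n) - real n powr (- c\<^sup>2 / 2 - 1) \<le>
        \<P>(\<omega> in M. x < e * (sqrt (real n) * (T n \<omega> - a n) / s n))"
        using 1 2 B unfolding U_def S_def by (intro conjI; linarith)
    qed
  qed
  show ?thesis
    by (rule moderate_tail_approx[OF Y exponent_pos C c \<delta>_lim \<delta>0 _ P \<epsilon>]) simp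
qed

text \<open>The lower relation is the upper one for the negated variable, e = -1, and both have the
  same denominator \<open>normal_tail x\<close>.\<close>

lemma moderate_deviations_centered_scaled:
  assumes a: "(\<lambda>n. sqrt (real n) * (a n - \<mu> n) * sqrt (ln (real n))) \<longlonglongrightarrow> 0"
    and s: "(\<lambda>n. (s n / \<sigma>W n - 1) * ln (real n)) \<longlonglongrightarrow> 0"
  shows "moderate_deviations M T c a s"
  unfolding moderate_deviations_def normal_tail_cdf
proof (intro allI impI)
  fix A \<epsilon> :: real assume "0 < A" "0 < \<epsilon>"
  have m1: "\<bar>- 1 :: real\<bar> = 1" by simp
  have neg: "sqrt (real n) * (T n \<omega> - a n) / s n < - x \<longleftrightarrow> x < - 1 * (sqrt (real n) * (T n \<omega> - a n) / s n)" for n \<omega> x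
    by linarith
  have pos: "x < sqrt (real n) * (T n \<omega> - a n) / s n \<longleftrightarrow> x < 1 * (sqrt (real n) * (T n \<omega> - a n) / s n)" for n \<omega> x
    by simp
  show "\<forall>\<^sub>F n in sequentially. \<forall>x. - A \<le> x \<and> x \<le> c * sqrt (ln (real n)) \<longrightarrow>
      \<bar>\<P>(\<omega> in M. x < sqrt (real n) * (T n \<omega> - a n) / s n) / normal_tail x - 1\<bar> < \<epsilon> \<and>
      \<bar>\<P>(\<omega> in M. sqrt (real n) * (T n \<omega> - a n) / s n < - x) / normal_tail x - 1\<bar> < \<epsilon>"
    unfolding neg unfolding pos
    using moderate_tail_signed[OF abs_one a s \<open>0 < A\<close> \<open>0 < \<epsilon>\<close>] moderate_tail_signed[OF m1 a s \<open>0 < A\<close> \<open>0 < \<epsilon>\<close>]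
    by eventually_elim blast
qed

end

section \<open>Rates for centres and scales in the form required by the theorem\<close>

lemma smallo_inverse:
  fixes f g :: "nat \<Rightarrow> real"
  assumes "(\<lambda>n. f n * g n) \<longlonglongrightarrow> 0" "\<forall>\<^sub>F n in sequentially. g n \<noteq> 0"
  shows "f \<in> o(\<lambda>n. 1 / g n)"
proof (rule smalloI_tendsto)
  show "\<forall>\<^sub>F n in sequentially. 1 / g n \<noteq> 0" using assms(2) by eventually_elim simp
  show "(\<lambda>n. f n / (1 / g n)) \<longlonglongrightarrow> 0" using assms(1) by simp
qed

context trimmed_sample
begin

lemma mean_error_ln: "(\<lambda>n. sqrt (real n) * (expectation (T n) - \<mu> n) * ln (real n)) \<longlonglongrightarrow> 0"
proof -
  obtain K where K: "0 \<le> K"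
    and ev: "\<forall>\<^sub>F n in sequentially. \<bar>sqrt (real n) * (expectation (T n) - \<mu> n)\<bar> \<le> K * \<theta> n"
    by (rule trimmed_mean_rates)
  show ?thesis
  proof (rule tendsto_zero_le[OF tendsto_mult_right_zero[OF \<theta>_ln, of K]])
    show "\<forall>\<^sub>F n in sequentially. \<bar>sqrt (real n) * (expectation (T n) - \<mu> n) * ln (real n)\<bar> \<le> K * (\<theta> n * ln (real n))"
      using ev ln_ge_1
    proof eventually_elim
      case (elim n)
      then have "\<bar>sqrt (real n) * (expectation (T n) - \<mu> n)\<bar> * ln (real n) \<le> K * \<theta> n * ln (real n)"
        by (intro mult_right_mono) auto
      then show ?case using elim(2) by (simp add: abs_mult mult.assoc)
    qed
  qed
qed

lemma tendsto_sqrt_ln: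
  fixes f :: "nat \<Rightarrow> real"
  assumes "(\<lambda>n. f n * ln (real n)) \<longlonglongrightarrow> 0"
  shows "(\<lambda>n. f n * sqrt (ln (real n))) \<longlonglongrightarrow> 0"
proof (rule tendsto_zero_le[OF tendsto_rabs_zero[OF assms]])
  show "\<forall>\<^sub>F n in sequentially. \<bar>f n * sqrt (ln (real n))\<bar> \<le> \<bar>f n * ln (real n)\<bar>"
    using ln_ge_1
  proof eventually_elim
    case (elim n)
    then have "sqrt (ln n) \<le> ln n" by (intro real_le_lsqrt) (auto simp: power2_eq_square)
    then show ?case using elim by (simp add: abs_mult mult_left_mono)
  qed
qed

lemma sd_ratio_ln: "(\<lambda>n. (sqrt (real n * variance (T n)) / \<sigma>W n - 1) * ln (real n)) \<longlonglongrightarrow> 0"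
proof -
  obtain s0 where s0: "0 < s0" "\<forall>\<^sub>F n in sequentially. s0 \<le> \<sigma>W n" by (rule ev_sd)
  obtain K where K: "0 \<le> K"
    and ev: "\<forall>\<^sub>F n in sequentially. \<bar>sqrt (real n * variance (T n)) - \<sigma>W n\<bar> \<le> K * \<theta> n"
    by (rule trimmed_mean_rates)
  show ?thesis
  proof (rule tendsto_zero_le[OF tendsto_mult_right_zero[OF \<theta>_ln, of "K / s0"]])
    show "\<forall>\<^sub>F n in sequentially. \<bar>(sqrt (real n * variance (T n)) / \<sigma>W n - 1) * ln (real n)\<bar> \<le> K / s0 * (\<theta> n * ln (real n))"
      using ev ln_ge_1 s0(2)
    proof eventually_elim
      case (elim n)
      define v where "v = sqrt (real n * variance (T n))"
      have sp: "0 < \<sigma>W n" using elim s0 by simp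
      then have "v / \<sigma>W n - 1 = (v - \<sigma>W n) / \<sigma>W n" by (simp add: diff_divide_distrib)
      then have "\<bar>v / \<sigma>W n - 1\<bar> = \<bar>v - \<sigma>W n\<bar> / \<sigma>W n" using sp by simp
      also have "\<dots> \<le> K * \<theta> n / s0"
        using elim s0 K \<theta>_nonneg[of n] unfolding v_def by (intro frac_le) auto
      finally have "\<bar>v / \<sigma>W n - 1\<bar> * ln n \<le> K * \<theta> n / s0 * ln n" using elim by (intro mult_right_mono) auto
      then show ?case using elim(2) unfolding v_def by (simp add: abs_mult)
    qed
  qed
qed

text \<open>Variances differ by O(\<open>\<theta>\<close> squared), and for u, v \<ge> s0 the
  identity u^2 - v^2 = (u - v)(u + v) passes this on to standard deviations. The square of
  \<open>\<theta> n\<close> log n tends to 0, which explains the squared logarithm. The estimate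
  \<open>gen\<close> is applied with the two quantities in either order.\<close>

lemma winsorized_sd_ratios:
  "(\<lambda>n. (\<sigma>W n / sqrt (variance (X 1)) - 1) * (ln (real n))\<^sup>2) \<longlonglongrightarrow> 0"
  "(\<lambda>n. (sqrt (variance (X 1)) / \<sigma>W n - 1) * (ln (real n))\<^sup>2) \<longlonglongrightarrow> 0"
proof -
  define \<sigma> where "\<sigma> = sqrt (variance (X 1))"
  obtain s0 where s0: "0 < s0" "\<forall>\<^sub>F n in sequentially. s0 \<le> \<sigma>W n" by (rule ev_sd)
  obtain K where K: "0 \<le> K" "\<forall>\<^sub>F n in sequentially. \<bar>variance (X 1) - (\<sigma>W n)\<^sup>2\<bar> \<le> K * (\<theta> n)\<^sup>2"
    by (rule variance_rate)
  have "0 \<le> variance (X 1)" by (intro integral_nonneg_AE AE_I2) simp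
  then have \<sigma>2: "\<sigma>\<^sup>2 = variance (X 1)" "0 \<le> \<sigma>" by (auto simp: \<sigma>_def)
  have \<theta>2: "(\<lambda>n. K * (\<theta> n)\<^sup>2) \<longlonglongrightarrow> K * 0\<^sup>2" by (intro tendsto_intros \<theta>_tendsto)
  \<comment> \<open>The lower bound s0 for the winsorized deviations passes to \<sigma> in the
    limit, so \<sigma> may stand in a denominator.\<close>
  have "(\<lambda>n. \<sigma>\<^sup>2 + K * (\<theta> n)\<^sup>2) \<longlonglongrightarrow> \<sigma>\<^sup>2 + K * 0\<^sup>2" by (intro tendsto_add tendsto_const \<theta>2)
  then have "s0\<^sup>2 \<le> \<sigma>\<^sup>2 + K * 0\<^sup>2"
  proof (rule tendsto_lowerbound)
    show "\<forall>\<^sub>F n in sequentially. s0\<^sup>2 \<le> \<sigma>\<^sup>2 + K * (\<theta> n)\<^sup>2"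
      using s0(2) K(2)
    proof eventually_elim
      case (elim n)
      have "s0\<^sup>2 \<le> (\<sigma>W n)\<^sup>2" using elim s0 by (intro power_mono) auto
      then show ?case using elim(2) unfolding \<sigma>2(1)[symmetric] by linarith
    qed
  qed simp
  then have s\<sigma>: "s0 \<le> \<sigma>" using \<sigma>2(2) s0 by (simp add: power2_le_iff_abs_le)
  have "(\<lambda>n. (\<theta> n * ln (real n))\<^sup>2) \<longlonglongrightarrow> 0\<^sup>2" by (intro tendsto_power \<theta>_ln)
  then have lim: "(\<lambda>n. K / s0\<^sup>2 * (\<theta> n * ln (real n))\<^sup>2) \<longlonglongrightarrow> 0"
    using tendsto_mult_right_zero[of "\<lambda>n. (\<theta> n * ln (real n))\<^sup>2" sequentially "K / s0\<^sup>2"] by simp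
  have gen: "\<bar>(u / v - 1) * g\<^sup>2\<bar> \<le> K / s0\<^sup>2 * (t * g)\<^sup>2"
    if "\<bar>u\<^sup>2 - v\<^sup>2\<bar> \<le> K * t\<^sup>2" "s0 \<le> u" "s0 \<le> v" for u v t g
  proof -
    have pos: "0 < u" "0 < v" using that s0 by auto
    have "\<bar>u - v\<bar> * s0 \<le> \<bar>u - v\<bar> * (u + v)" using that pos by (intro mult_left_mono) auto
    also have "\<dots> = \<bar>(u - v) * (u + v)\<bar>" using pos by (simp add: abs_mult)
    also have "(u - v) * (u + v) = u\<^sup>2 - v\<^sup>2" by (simp add: power2_eq_square algebra_simps)
    finally have "\<bar>u - v\<bar> * s0 \<le> K * t\<^sup>2" using that by simp
    then have d: "\<bar>u - v\<bar> \<le> K * t\<^sup>2 / s0" using s0 by (simp add: pos_le_divide_eq)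
    have "u / v - 1 = (u - v) / v" using pos by (simp add: diff_divide_distrib)
    then have "\<bar>u / v - 1\<bar> = \<bar>u - v\<bar> / v" using pos by simp
    also have "\<dots> \<le> K * t\<^sup>2 / s0 / s0" using d that s0 K by (intro frac_le) auto
    finally have "\<bar>u / v - 1\<bar> * g\<^sup>2 \<le> K * t\<^sup>2 / s0 / s0 * g\<^sup>2" by (intro mult_right_mono) auto
    then show ?thesis by (simp add: abs_mult power2_eq_square mult_ac)
  qed
  show "(\<lambda>n. (\<sigma>W n / sqrt (variance (X 1)) - 1) * (ln (real n))\<^sup>2) \<longlonglongrightarrow> 0"
    unfolding \<sigma>_def[symmetric]
  proof (rule tendsto_zero_le[OF lim])
    show "\<forall>\<^sub>F n in sequentially. \<bar>(\<sigma>W n / \<sigma> - 1) * (ln (real n))\<^sup>2\<bar> \<le> K / s0\<^sup>2 * (\<theta> n * ln (real n))\<^sup>2"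
      using K(2) s0(2) unfolding \<sigma>2(1)[symmetric] abs_minus_commute[of "\<sigma>\<^sup>2"]
      by eventually_elim (intro gen s\<sigma>)
  qed
  show "(\<lambda>n. (sqrt (variance (X 1)) / \<sigma>W n - 1) * (ln (real n))\<^sup>2) \<longlonglongrightarrow> 0"
    unfolding \<sigma>_def[symmetric]
  proof (rule tendsto_zero_le[OF lim])
    show "\<forall>\<^sub>F n in sequentially. \<bar>(\<sigma> / \<sigma>W n - 1) * (ln (real n))\<^sup>2\<bar> \<le> K / s0\<^sup>2 * (\<theta> n * ln (real n))\<^sup>2"
      using K(2) s0(2) unfolding \<sigma>2(1)[symmetric]
      by eventually_elim (intro gen s\<sigma>)
  qed
qed

text \<open>The winsorized deviation is eventually nonzero, so its ratio with itself is then 1; for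
  \<sigma> the rate with the squared logarithm is more than enough.\<close>

lemma scale_ratio_ln:
  assumes "s \<in> {\<sigma>W, \<lambda>_. sqrt (variance (X 1)), \<lambda>n. sqrt (real n * variance (T n))}"
  shows "(\<lambda>n. (s n / \<sigma>W n - 1) * ln (real n)) \<longlonglongrightarrow> 0"
proof -
  obtain s0 where s0: "0 < s0" "\<forall>\<^sub>F n in sequentially. s0 \<le> \<sigma>W n" by (rule ev_sd)
  have 1: "(\<lambda>n. (\<sigma>W n / \<sigma>W n - 1) * ln (real n)) \<longlonglongrightarrow> 0"
    by (rule tendsto_eventually) (use s0(2) in eventually_elim, use s0(1) in auto)
  have 2: "(\<lambda>n. (sqrt (variance (X 1)) / \<sigma>W n - 1) * ln (real n)) \<longlonglongrightarrow> 0"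
  proof (rule tendsto_zero_le[OF tendsto_rabs_zero[OF winsorized_sd_ratios(2)]])
    show "\<forall>\<^sub>F n in sequentially. \<bar>(sqrt (variance (X 1)) / \<sigma>W n - 1) * ln (real n)\<bar> \<le>
        \<bar>(sqrt (variance (X 1)) / \<sigma>W n - 1) * (ln (real n))\<^sup>2\<bar>"
      using ln_ge_1
    proof eventually_elim
      case (elim n)
      then have "ln n \<le> (ln n)\<^sup>2" using power_increasing[of 1 2 "ln (real n)"] by simp
      then show ?case using elim unfolding abs_mult by (intro mult_left_mono) auto
    qed
  qed
  show ?thesis using assms 1 2 sd_ratio_ln by auto
qed

text \<open>The exponent p/(2 (p - 1)) is tuned to \<open>mean_rate\<close>: multiplied by 1 - 1/p
  it equals 1/2, so the bias is o((n log n) to the power -1/2).\<close>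

lemma population_mean_error:
  assumes "(\<lambda>n. max (\<alpha> n) (\<beta> n)) \<in> o(\<lambda>n. (real n * ln (real n)) powr (- (p / (2 * (p - 1)))))"
  shows "(\<lambda>n. sqrt (real n) * (expectation (X 1) - \<mu> n) * sqrt (ln (real n))) \<longlonglongrightarrow> 0"
proof -
  obtain K where K: "0 \<le> K"
    "\<forall>\<^sub>F n in sequentially. \<bar>expectation (X 1) - \<mu> n\<bar> \<le> K * max (\<alpha> n) (\<beta> n) powr (1 - 1 / p)"
    by (rule mean_rate)
  define R where "R n = max (\<alpha> n) (\<beta> n) / (real n * ln (real n)) powr (- (p / (2 * (p - 1))))" for n
  have "R \<longlonglongrightarrow> 0" unfolding R_def by (rule smalloD_tendsto[OF assms])
  moreover have "0 \<le> R n" for n by (simp add: R_def le_max_iff_disj frac_nonneg)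
  moreover have "0 < 1 - 1 / p" using p by simp
  ultimately have "(\<lambda>n. R n powr (1 - 1 / p)) \<longlonglongrightarrow> 0"
    by (intro tendsto_zero_powrI[OF _ tendsto_const] always_eventually allI)
  from tendsto_mult_right_zero[OF this, of K] show ?thesis
  proof (rule tendsto_zero_le)
    show "\<forall>\<^sub>F n in sequentially. \<bar>sqrt (real n) * (expectation (X 1) - \<mu> n) * sqrt (ln (real n))\<bar> \<le> K * R n powr (1 - 1 / p)"
      using K(2) ln_ge_1 eventually_gt_at_top[of 0]
    proof eventually_elim
      case (elim n)
      define x where "x = real n * ln (real n)"
      have l: "0 < ln (real n)" using elim(2) by linarith
      have x: "0 < x" "sqrt x = sqrt (real n) * sqrt (ln (real n))"
        using mult_pos_pos[OF _ l, of "real n"] elim(3) by (simp_all add: x_def real_sqrt_mult)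
      define y where "y = max (\<alpha> n) (\<beta> n)"
      have y: "0 \<le> y" by (simp add: y_def le_max_iff_disj frac_nonneg)
      have "R n powr (1 - 1 / p) = y powr (1 - 1 / p) / (x powr (- (p / (2 * (p - 1))))) powr (1 - 1 / p)"
        unfolding R_def x_def[symmetric] y_def[symmetric] by (rule powr_divide)
      also have "(x powr (- (p / (2 * (p - 1))))) powr (1 - 1 / p) = x powr (- (1 / 2))"
      proof -
        have "- (p / (2 * (p - 1))) * (1 - 1 / p) = - (1 / 2)" using p by (simp add: field_simps)
        then show ?thesis by (simp only: powr_powr)
      qed
      also have "y powr (1 - 1 / p) / x powr (- (1 / 2)) = y powr (1 - 1 / p) * sqrt x"
        using x by (simp add: powr_minus_divide powr_half_sqrt)
      finally have R: "R n powr (1 - 1 / p) = y powr (1 - 1 / p) * sqrt x" .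
      have "\<bar>sqrt (real n) * (expectation (X 1) - \<mu> n) * sqrt (ln (real n))\<bar> = \<bar>expectation (X 1) - \<mu> n\<bar> * sqrt x"
      proof -
        have "sqrt (real n) * (expectation (X 1) - \<mu> n) * sqrt (ln (real n)) = (expectation (X 1) - \<mu> n) * sqrt x"
          unfolding x(2) by (simp only: mult_ac)
        then show ?thesis using x(1) by (simp only: abs_mult) simp
      qed
      also have "\<dots> \<le> K * y powr (1 - 1 / p) * sqrt x"
        using elim(1) x(1) unfolding y_def by (intro mult_right_mono) auto
      finally show ?case unfolding R by (simp add: mult.assoc)
    qed
  qed
qed

end

text \<open>The product is bounded by a constant times log n to the power 1 - \<gamma> q, and this
  exponent is negative.\<close>

lemma fraction_powr_ln_tendsto:
  fixes f :: "nat \<Rightarrow> real"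
  assumes f: "f \<in> O(\<lambda>n. ln (real n) powr - \<gamma>)" "\<And>n. 0 \<le> f n" and \<gamma>: "1 < \<gamma> * q" and q: "0 < q"
  shows "(\<lambda>n. f n powr q * ln (real n)) \<longlonglongrightarrow> 0"
proof -
  obtain C where C: "0 < C" "\<forall>\<^sub>F n in sequentially. norm (f n) \<le> C * norm (ln (real n) powr - \<gamma>)"
    using f(1) by (rule landau_o.bigE)
  have ln1: "\<forall>\<^sub>F n in sequentially. 1 \<le> ln (real n)" by real_asymp
  have ln_top: "filterlim (\<lambda>n. ln (real n)) at_top sequentially" by real_asymp
  have "((\<lambda>x. x powr (1 - \<gamma> * q)) \<longlongrightarrow> 0) at_top"
    using \<gamma> by (intro tendsto_neg_powr filterlim_ident) simp
  from filterlim_compose[OF this ln_top]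
  have "(\<lambda>n. C powr q * ln (real n) powr (1 - \<gamma> * q)) \<longlonglongrightarrow> 0" by (rule tendsto_mult_right_zero)
  then show ?thesis
  proof (rule tendsto_zero_le)
    show "\<forall>\<^sub>F n in sequentially. \<bar>f n powr q * ln (real n)\<bar> \<le> C powr q * ln (real n) powr (1 - \<gamma> * q)"
      using C(2) ln1
    proof eventually_elim
      case (elim n)
      have "f n powr q \<le> (C * ln (real n) powr - \<gamma>) powr q"
        using elim f(2)[of n] q by (intro powr_mono2) auto
      also have "\<dots> = C powr q * ln (real n) powr (- \<gamma> * q)"
        using C elim by (simp add: powr_mult powr_powr)
      finally have "f n powr q * ln n \<le> C powr q * ln (real n) powr (- \<gamma> * q) * ln n"
        using elim by (intro mult_right_mono) auto
      also have "\<dots> = C powr q * (ln (real n) powr (- \<gamma> * q) * ln (real n) powr 1)"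
        using elim by simp
      also have "ln (real n) powr (- \<gamma> * q) * ln (real n) powr 1 = ln (real n) powr (1 - \<gamma> * q)"
        unfolding powr_add[symmetric] by (simp add: algebra_simps)
      finally show ?case using elim by (simp add: abs_mult)
    qed
  qed
qed

theorem theorem1p2:
  fixes M :: "'a measure" and X :: "nat \<Rightarrow> 'a \<Rightarrow> real"
    and k m :: "nat \<Rightarrow> nat" and p c \<gamma> :: real
  defines "T \<equiv> trimmed_mean X k m"
    and "\<alpha> \<equiv> trim_frac k"
    and "\<beta> \<equiv> trim_frac m"
    and "\<mu> \<equiv> trimmed_center (cdf (distr M borel (X 1))) k m"
    and "\<sigma>W \<equiv> winsorized_sd M X k m"
    and "\<sigma> \<equiv> sqrt (prob_space.variance M (X 1))"
    and "ET \<equiv> (\<lambda>n. prob_space.expectation M (trimmed_mean X k m n))"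
    and "VT \<equiv> (\<lambda>n. prob_space.variance M (trimmed_mean X k m n))"
    and "\<mu>X \<equiv> prob_space.expectation M (X 1)"
  assumes "prob_space M"
    and indep: "prob_space.indep_vars M (\<lambda>_. borel) X {1..}"
    and ident: "\<And>i. i \<ge> 1 \<Longrightarrow> distr M borel (X i) = distr M borel (X 1)"
    and trim: "\<And>n. n \<ge> 1 \<Longrightarrow> k n + m n < n"
    and trim_inf: "filterlim (\<lambda>n. min (k n) (m n)) at_top sequentially"
    and liminf_pos: "liminf (\<lambda>n. ereal (\<sigma>W n)) > 0"
    and "c > 0"
    and "p > c\<^sup>2 + 2"
    and moment: "integrable M (\<lambda>\<omega>. \<bar>X 1 \<omega>\<bar> powr p)"
    and "(\<lambda>n. ln (real n) / real (min (k n) (m n))) \<longlonglongrightarrow> 0"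
    and "\<gamma> > 2 * p / (p - 2)"
    and "(\<lambda>n. max (\<alpha> n) (\<beta> n)) \<in> O(\<lambda>n. ln (real n) powr (- \<gamma>))"
  shows "(\<lambda>n. sqrt (real n) * (ET n - \<mu> n)) \<in> o(\<lambda>n. 1 / ln (real n)) \<and>
    (\<lambda>n. \<sigma>W n / \<sigma> - 1) \<in> o(\<lambda>n. 1 / (ln (real n))\<^sup>2) \<and>
    (\<lambda>n. sqrt (VT n) / (\<sigma>W n / sqrt (real n)) - 1) \<in> o(\<lambda>n. 1 / ln (real n)) \<and>
    (\<forall>a \<in> {\<mu>, ET}. \<forall>s \<in> {\<sigma>W, \<lambda>_. \<sigma>, \<lambda>n. sqrt (real n * VT n)}.
        moderate_deviations M T c a s) \<and>
    ((\<lambda>n. max (\<alpha> n) (\<beta> n)) \<in> o(\<lambda>n. (real n * ln (real n)) powr (- (p / (2 * (p - 1))))) \<longrightarrow>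
      (\<lambda>n. sqrt (real n) * (\<mu>X - \<mu> n)) \<in> o(\<lambda>n. ln (real n) powr (- (1 / 2))) \<and>
      (\<forall>s \<in> {\<sigma>W, \<lambda>_. \<sigma>, \<lambda>n. sqrt (real n * VT n)}.
        moderate_deviations M T c (\<lambda>_. \<mu>X) s))"
proof -
  interpret prob_space M by fact
  interpret iid_sample M X
    using indep ident by unfold_locales
  have p: "2 < p" using \<open>p > c\<^sup>2 + 2\<close> zero_le_power2[of c] by linarith
  have q: "0 < 1 / 2 - 1 / p" using p by (simp add: field_simps)
  have \<gamma>: "1 < \<gamma> * (1 / 2 - 1 / p)"
  proof -
    \<comment> \<open>The threshold for \<gamma> is the reciprocal of the exponent 1/2 -
      1/p.\<close>
    have 1: "2 * p / (p - 2) * (1 / 2 - 1 / p) = 1" using p by (simp add: field_simps)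
    from mult_strict_right_mono[OF \<open>\<gamma> > 2 * p / (p - 2)\<close> q] show ?thesis unfolding 1 .
  qed
  have bigo: "(\<lambda>n. max (trim_frac k n) (trim_frac m n)) \<in> O(\<lambda>n. ln (real n) powr (- \<gamma>))"
    using \<open>(\<lambda>n. max (\<alpha> n) (\<beta> n)) \<in> O(\<lambda>n. ln (real n) powr (- \<gamma>))\<close> unfolding \<alpha>_def \<beta>_def .
  interpret trimmed_sample M X k m p c
  proof unfold_locales
    show "integrable law (\<lambda>x. \<bar>x\<bar> powr p)"
      using moment expectation_eq_law(2)[of 1 "\<lambda>x. \<bar>x\<bar> powr p"] by simp
    show "(\<lambda>n. max (trim_frac k n) (trim_frac m n) powr (1 / 2 - 1 / p) * ln (real n)) \<longlonglongrightarrow> 0"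
      by (rule fraction_powr_ln_tendsto[OF bigo _ \<gamma> q]) (simp add: trim_frac_def le_max_iff_disj)
    show "liminf (\<lambda>n. ereal (winsorized_sd M X k m n)) > 0"
      using liminf_pos unfolding \<sigma>W_def .
  qed (use p \<open>c > 0\<close> trim trim_inf \<open>(\<lambda>n. ln (real n) / real (min (k n) (m n))) \<longlonglongrightarrow> 0\<close> in auto)
  have ln0: "\<forall>\<^sub>F n in sequentially. ln (real n) \<noteq> 0"
    using ln_ge_1 by eventually_elim simp
  define E where "E n = expectation (trimmed_mean X k m n)" for n
  define V where "V n = variance (trimmed_mean X k m n)" for n
  define S where "S = winsorized_sd M X k m"
  define C where "C = trimmed_center (cdf law) k m"
  have E: "(\<lambda>n. sqrt (real n) * (E n - C n) * ln (real n)) \<longlonglongrightarrow> 0"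
    unfolding E_def C_def by (rule mean_error_ln)
  have V: "(\<lambda>n. (sqrt (real n * V n) / S n - 1) * ln (real n)) \<longlonglongrightarrow> 0"
    unfolding V_def S_def by (rule sd_ratio_ln)
  have md: "moderate_deviations M (trimmed_mean X k m) c a s"
    if "(\<lambda>n. sqrt (real n) * (a n - C n) * sqrt (ln (real n))) \<longlonglongrightarrow> 0"
      "s \<in> {S, \<lambda>_. sqrt (variance (X 1)), \<lambda>n. sqrt (real n * V n)}" for a s
    using moderate_deviations_centered_scaled[OF _ scale_ratio_ln] that unfolding S_def V_def C_def by blast
  have 1: "(\<lambda>n. sqrt (real n) * (E n - C n)) \<in> o(\<lambda>n. 1 / ln (real n))"
    by (rule smallo_inverse[OF E ln0])
  have 2: "(\<lambda>n. S n / sqrt (variance (X 1)) - 1) \<in> o(\<lambda>n. 1 / (ln (real n))\<^sup>2)"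
  proof (rule smallo_inverse)
    show "(\<lambda>n. (S n / sqrt (variance (X 1)) - 1) * (ln (real n))\<^sup>2) \<longlonglongrightarrow> 0"
      unfolding S_def by (rule winsorized_sd_ratios(1))
    show "\<forall>\<^sub>F n in sequentially. (ln (real n))\<^sup>2 \<noteq> 0" using ln0 by eventually_elim simp
  qed
  have 3: "(\<lambda>n. sqrt (V n) / (S n / sqrt (real n)) - 1) \<in> o(\<lambda>n. 1 / ln (real n))"
  proof (rule smallo_inverse[OF _ ln0])
    have "sqrt (V n) / (S n / sqrt (real n)) = sqrt (real n * V n) / S n" for n
      by (simp add: real_sqrt_mult)
    then show "(\<lambda>n. (sqrt (V n) / (S n / sqrt (real n)) - 1) * ln (real n)) \<longlonglongrightarrow> 0"
      using V by (simp only:)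
  qed
  have 4: "\<forall>a \<in> {C, E}. \<forall>s \<in> {S, \<lambda>_. sqrt (variance (X 1)), \<lambda>n. sqrt (real n * V n)}.
      moderate_deviations M (trimmed_mean X k m) c a s"
  proof (intro ballI md)
    fix a assume "a \<in> {C, E}"
    then show "(\<lambda>n. sqrt (real n) * (a n - C n) * sqrt (ln (real n))) \<longlonglongrightarrow> 0"
      using tendsto_sqrt_ln[OF E] by auto
  qed
  have 5: "(\<lambda>n. sqrt (real n) * (expectation (X 1) - C n)) \<in> o(\<lambda>n. ln (real n) powr (- (1 / 2))) \<and>
      (\<forall>s \<in> {S, \<lambda>_. sqrt (variance (X 1)), \<lambda>n. sqrt (real n * V n)}.
        moderate_deviations M (trimmed_mean X k m) c (\<lambda>_. expectation (X 1)) s)"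
    if "(\<lambda>n. max (trim_frac k n) (trim_frac m n)) \<in> o(\<lambda>n. (real n * ln (real n)) powr (- (p / (2 * (p - 1)))))"
  proof -
    have m: "(\<lambda>n. sqrt (real n) * (expectation (X 1) - C n) * sqrt (ln (real n))) \<longlonglongrightarrow> 0"
      unfolding C_def by (rule population_mean_error[OF that])
    have "(\<lambda>n. sqrt (real n) * (expectation (X 1) - C n)) \<in> o(\<lambda>n. 1 / sqrt (ln (real n)))"
      by (rule smallo_inverse[OF m]) (use ln0 in simp)
    moreover have "1 / sqrt (ln (real n)) = ln (real n) powr (- (1 / 2))" for n
      by (cases "n = 0") (simp_all add: powr_minus_divide powr_half_sqrt)
    ultimately show ?thesis using md[OF m] by simp
  qed
  from 1 2 3 4 5 show ?thesis
    unfolding T_def \<alpha>_def \<beta>_def \<mu>_def \<sigma>W_def \<sigma>_def ET_def VT_def \<mu>X_def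
      E_def[abs_def] V_def[abs_def] S_def C_def by blast
qed

end
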